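(* Every Coxeter group of rank at most $3$ (that is, with $|S|\le 3$) is futuristic.
   Context: Let $(W,S)$ be a Coxeter system with $S=\{s_i:i\in I\}$, $I$ a finite index set; $m(i,i')$ is the order of $s_is_{i'}$. The root space is $V=\mathbb R^I$ with standard basis the simple roots $\{\alpha_i:i\in I\}$ and symmetric bilinear form $B(\alpha_i,\alpha_{i'})=-\cos(\pi/m(i,i'))$ (and $-1$ if $m(i,i')=\infty$). $W$ acts on $V$ by $s_i\beta=\beta-2B(\beta,\alpha_i)\alpha_i$. The root system is $\Phi=\{w\alpha_i:w\in W,i\in I\}=\Phi^+\sqcup\Phi^-$, where $\Phi^+$ are the roots that are nonnegative combinations of simple roots and $\Phi^-=-\Phi^+$. For $\beta\in\Phi$ the half-space $H_\beta^+$ is $\{w\in W:w\beta\in\Phi^+\}$. A subset of $W$ is convex if it is an intersection of half-spaces (the empty intersection being $W$). For a nonempty convex set $\mathscr L\subseteq W$ let $\mathrm R(\mathscr L)=\{\beta\in\Phi:\mathscr L\subseteq H_\beta^+\}$. For $i\in I$, the toggle $\tau_i\colon W\to W$ is defined by $\tau_i(u)=u$ if $u^{-1}\alpha_i\in\mathrm R(\mathscr L)$ and $\tau_i(u)=s_iu$ otherwise. A Coxeter element is a product $c=s_{i_n}\cdots s_{i_1}$ where $i_1,\ldots,i_n$ is an ordering of $I$ (each element once); $\mathrm{Pro}_c=\tau_{i_n}\cdots\tau_{i_1}$ (composition), which depends only on $c$ and $\mathscr L$. The set $\mathscr L$ is heavy with respect to $c$ if every periodic point of $\mathrm{Pro}_c$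 (i.e. every $u\in W$ with $\mathrm{Pro}_c^K(u)=u$ for some $K\ge 1$) lies in $\mathscr L$. The Coxeter group $W$ is futuristic if every nonempty convex subset of $W$ is heavy with respect to every Coxeter element of $W$. *)

theory Defs
  imports Complex_Main "HOL-Algebra.Generated_Groups" "HOL-Algebra.Multiplicative_Group"
begin

locale marked_group = group W for W :: "('w, 'x) monoid_scheme" (structure) +
  fixes I :: "'i set" and s :: "'i \<Rightarrow> 'w"
  assumes finite_index: "finite I"
    and s_closed: "s \<in> I \<rightarrow> carrier W"
begin

text \<open>\<open>word_val [i\<^sub>1, \<dots>, i\<^sub>k]\<close> is \<open>s i\<^sub>1 \<otimes> \<dots> \<otimes> s i\<^sub>k\<close>.\<close>

definition word_val :: "'i list \<Rightarrow> 'w" where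
  "word_val xs = foldr (\<lambda>i w. s i \<otimes> w) xs \<one>"

text \<open>As \<^const>\<open>group.ord\<close> is \<open>0\<close> on elements of infinite order, the value \<open>0\<close>
  encodes \<open>m(i,j) = \<infinity>\<close>.\<close>

definition m :: "'i \<Rightarrow> 'i \<Rightarrow> nat" where
  "m i j = ord (s i \<otimes> s j)"

text \<open>The congruence on the free monoid over \<open>I\<close> generated by the relations
  \<open>(s i \<otimes> s j)\<^bsup>m(i,j)\<^esup> = \<one>\<close>. For \<open>m(i,j) = \<infinity>\<close>, i.e. \<open>m i j = 0\<close>, the rule \<open>relator\<close> is
  trivial, so no relation is imposed. In a Coxeter system the relations contain \<open>s i \<otimes> s i = \<one>\<close>, so
  formal inverses are superfluous and the quotient monoid is the group with this presentation.\<close>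

inductive word_cong :: "'i list \<Rightarrow> 'i list \<Rightarrow> bool" where
  refl: "word_cong xs xs"
| sym: "word_cong xs ys \<Longrightarrow> word_cong ys xs"
| trans: "word_cong xs ys \<Longrightarrow> word_cong ys zs \<Longrightarrow> word_cong xs zs"
| ctxt: "word_cong xs ys \<Longrightarrow> word_cong (us @ xs @ vs) (us @ ys @ vs)"
| relator: "i \<in> I \<Longrightarrow> j \<in> I \<Longrightarrow> word_cong (concat (replicate (m i j) [i, j])) []"

end

text \<open>The relations hold in \<open>W\<close> by the definition of \<open>m\<close>; the last assumption says that every
  relation among the generators follows from them.\<close>

locale coxeter_system = marked_group W I s
  for W :: "('w, 'x) monoid_scheme" (structure) and I :: "'i set" and s :: "'i \<Rightarrow> 'w" +
  assumes s_inj: "inj_on s I"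
    and s_order: "i \<in> I \<Longrightarrow> ord (s i) = 2"
    and s_generate: "generate W (s ` I) = carrier W"
    and presentation: "xs \<in> lists I \<Longrightarrow> word_val xs = \<one> \<Longrightarrow> word_cong xs []"
begin

text \<open>Vectors of \<open>\<real>\<^sup>I\<close> are represented by functions that vanish outside \<open>I\<close>.\<close>

definition simple_root :: "'i \<Rightarrow> 'i \<Rightarrow> real" where
  "simple_root i = (\<lambda>k. if k = i then 1 else 0)"

definition bilinear_form :: "('i \<Rightarrow> real) \<Rightarrow> ('i \<Rightarrow> real) \<Rightarrow> real" where
  "bilinear_form \<beta> \<gamma> =
     (\<Sum>i\<in>I. \<Sum>j\<in>I. \<beta> i * \<gamma> j * (if m i j = 0 then - 1 else - cos (pi / real (m i j))))"

definition reflect :: "'i \<Rightarrow> ('i \<Rightarrow> real) \<Rightarrow> ('i \<Rightarrow> real)" where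
  "reflect i \<beta> = (\<lambda>k. \<beta> k - 2 * bilinear_form \<beta> (simple_root i) * simple_root i k)"

text \<open>The action of \<open>W\<close> extending that of the generators. A word \<open>xs\<close> with value \<open>w\<close> exists as
  \<open>W\<close> is generated by involutions, and on \<open>\<real>\<^sup>I\<close> the result is independent of its choice as the
  reflections satisfy the defining relations of \<open>W\<close>.\<close>

definition act :: "'w \<Rightarrow> ('i \<Rightarrow> real) \<Rightarrow> ('i \<Rightarrow> real)" where
  "act w \<beta> = foldr reflect (SOME xs. xs \<in> lists I \<and> word_val xs = w) \<beta>"

definition roots :: "('i \<Rightarrow> real) set" where
  "roots = {act w (simple_root i) | w i. w \<in> carrier W \<and> i \<in> I}"

definition pos_roots :: "('i \<Rightarrow> real) set" where
  "pos_roots = {\<beta> \<in> roots. \<forall>i\<in>I. 0 \<le> \<beta> i}"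

definition half_space :: "('i \<Rightarrow> real) \<Rightarrow> 'w set" where
  "half_space \<beta> = {w \<in> carrier W. act w \<beta> \<in> pos_roots}"

text \<open>The explicit carrier makes the empty intersection equal to \<open>W\<close>.\<close>

definition convex_subset :: "'w set \<Rightarrow> bool" where
  "convex_subset L \<longleftrightarrow> (\<exists>A \<subseteq> roots. L = carrier W \<inter> (\<Inter>\<beta>\<in>A. half_space \<beta>))"

definition root_set :: "'w set \<Rightarrow> ('i \<Rightarrow> real) set" where
  "root_set L = {\<beta> \<in> roots. L \<subseteq> half_space \<beta>}"

definition toggle :: "'w set \<Rightarrow> 'i \<Rightarrow> 'w \<Rightarrow> 'w" where
  "toggle L i u = (if act (inv u) (simple_root i) \<in> root_set L then u else s i \<otimes> u)"

definition index_ordering :: "'i list \<Rightarrow> bool" where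
  "index_ordering xs \<longleftrightarrow> distinct xs \<and> set xs = I"

text \<open>For an ordering \<open>xs = [i\<^sub>1, \<dots>, i\<^sub>n]\<close>, the associated Coxeter element is
  \<open>s i\<^sub>n \<otimes> \<dots> \<otimes> s i\<^sub>1\<close>, whence the reversal, and promotion applies the toggle of \<open>i\<^sub>1\<close> first.\<close>

definition coxeter_element_of :: "'i list \<Rightarrow> 'w" where
  "coxeter_element_of xs = word_val (rev xs)"

definition coxeter_element :: "'w \<Rightarrow> bool" where
  "coxeter_element c \<longleftrightarrow> (\<exists>xs. index_ordering xs \<and> coxeter_element_of xs = c)"

definition promotion :: "'w set \<Rightarrow> 'i list \<Rightarrow> 'w \<Rightarrow> 'w" where
  "promotion L xs = fold (toggle L) xs"

definition periodic_point :: "('w \<Rightarrow> 'w) \<Rightarrow> 'w \<Rightarrow> bool" where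
  "periodic_point f u \<longleftrightarrow> u \<in> carrier W \<and> (\<exists>K\<ge>1. (f ^^ K) u = u)"

text \<open>Promotion depends on an ordering only through its Coxeter element; quantifying over all
  orderings that yield \<open>c\<close> avoids choosing one.\<close>

definition heavy :: "'w set \<Rightarrow> 'w \<Rightarrow> bool" where
  "heavy L c \<longleftrightarrow> (\<forall>xs. index_ordering xs \<and> coxeter_element_of xs = c \<longrightarrow>
     (\<forall>u. periodic_point (promotion L xs) u \<longrightarrow> u \<in> L))"

definition futuristic :: bool where
  "futuristic \<longleftrightarrow>
     (\<forall>L c. L \<noteq> {} \<and> convex_subset L \<and> coxeter_element c \<longrightarrow> heavy L c)"

end

end

theory Submission
  imports Defs
begin


text \<open>Suppose that a periodic orbit of promotion avoids \<open>L\<close>. A toggle never creates a wall separating the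
  current point \<open>u\<close> from \<open>L\<close>, so by periodicity no separating wall is ever crossed. In the frame of \<open>u\<close>, let
  \<open>R = u R(L)\<close>; a separating wall is a positive root \<open>\<gamma>\<close> with \<open>-\<gamma> \<in> R\<close>. The toggle at \<open>i\<close> fails iff
  \<open>\<alpha>\<^sub>i \<in> R\<close>, and otherwise applies \<open>s\<^sub>i\<close> to \<open>R\<close>. As \<open>R\<close> is closed under positive combinations, after a failure
  \<open>\<gamma>\<close> may be replaced by \<open>s\<^sub>i \<gamma>\<close> if \<open>B(\<gamma>, \<alpha>\<^sub>i) \<ge> 0\<close>; and if \<open>B(\<gamma>, \<alpha>\<^sub>i) \<le> -1\<close>, then the toggle must fail. Since
  \<open>\<gamma>\<close> can be chosen among the elementary (small) roots, it stays among them. In rank 3 there are so few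
  of them that one can follow \<open>\<gamma>\<close>: either it ends as the simple root about to be toggled, that is, the wall is
  crossed, or the pattern of failures is forced, and then the word applied by the toggles moves a linear
  functional to infinity, contradicting periodicity. The finite types are treated by a height
  of \<open>\<gamma>\<close> taken along the Coxeter plane, which is a concave function of time.\<close>

section \<open>Coefficients of dihedral roots\<close>

text \<open>The combinatorics needs only the coordinates of roots in a moving frame and a few
  closure rules; the locales \<open>cox_game\<close> and \<open>path_game\<close> isolate these, so
  that the cases become inequalities between real numbers. The case split follows the Gram matrix.
  If no two letters commute, -B of distinct simple roots is always at least 1/2. Otherwise two
  values P, Q remain, with Gram determinant 1 - P^2 - Q^2. If it is positive, the group is finite
  and every functional stays bounded, so the height replaces it. In the other cases the wall keeps
  returning to a few positions, and from one return to the next the amplitudes (u, v) of the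
  functional, the present and the previous one, become (u', u) with u' >= 2 u - v. This convexity,
  rather than exponential growth, is what the affine types also satisfy. The delicate type is affine
  G_2, where the failures along the cycle are not all forced: one toggle may fail once, and a trace
  of that failure is carried along to exclude a second one. Where only the motion of the wall
  matters, the same phase lemmas are used with the zero functional.\<close>

text \<open>In a dihedral parabolic subgroup with \<open>m(i,j) = p\<close> the positive roots are
  \<open>dcoeff p (k + 1) \<alpha>\<^sub>i + dcoeff p k \<alpha>\<^sub>j\<close> for \<open>k < p\<close>.\<close>

definition dcoeff :: "nat \<Rightarrow> nat \<Rightarrow> real" where
  "dcoeff p j = sin (real j * (pi / real p)) / sin (pi / real p)"

lemma sin_pi_div_pos: "2 \<le> p \<Longrightarrow> 0 < sin (pi / real p)"
  by (rule sin_gt_zero) (auto simp: field_simps)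

lemma dcoeff_0 [simp]: "dcoeff p 0 = 0"
  by (simp add: dcoeff_def)

lemma dcoeff_1 [simp]: "2 \<le> p \<Longrightarrow> dcoeff p (Suc 0) = 1"
  using sin_pi_div_pos[of p] by (simp add: dcoeff_def)

text \<open>The Chebyshev recursion: reflecting a dihedral root with coefficients of index j + 1 and
  j in the second letter replaces index j by j + 2.\<close>

lemma dcoeff_rec:
  "dcoeff p (Suc (Suc j)) = 2 * cos (pi / real p) * dcoeff p (Suc j) - dcoeff p j"
proof -
  define t where "t = pi / real p"
  have a: "real (Suc (Suc j)) * t = real (Suc j) * t + t" "real j * t = real (Suc j) * t - t"
    by (simp_all add: algebra_simps)
  have "sin (real (Suc (Suc j)) * t) + sin (real j * t) = 2 * cos t * sin (real (Suc j) * t)"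
    unfolding a by (simp add: sin_add sin_diff)
  then show ?thesis
    by (simp add: dcoeff_def t_def[symmetric] diff_divide_distrib[symmetric] del: of_nat_Suc)
qed

lemma dcoeff_2: "2 \<le> p \<Longrightarrow> dcoeff p (Suc (Suc 0)) = 2 * cos (pi / real p)"
  by (simp add: dcoeff_rec)

lemma dcoeff_3: "2 \<le> p \<Longrightarrow> dcoeff p (Suc (Suc (Suc 0))) = 4 * (cos (pi / real p))\<^sup>2 - 1"
  by (simp add: dcoeff_rec power2_eq_square)

lemma dcoeff_4: "2 \<le> p \<Longrightarrow>
    dcoeff p (Suc (Suc (Suc (Suc 0)))) = 2 * cos (pi / real p) * (4 * (cos (pi / real p))\<^sup>2 - 2)"
  by (simp add: dcoeff_rec power2_eq_square algebra_simps)

lemma dcoeff_refl: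
  assumes "2 \<le> p" "j \<le> p"
  shows "dcoeff p (p - j) = dcoeff p j"
proof -
  have "real (p - j) * (pi / real p) = pi - real j * (pi / real p)"
    using assms by (simp add: of_nat_diff field_simps)
  then show ?thesis by (simp add: dcoeff_def)
qed

lemma dcoeff_period [simp]: "2 \<le> p \<Longrightarrow> dcoeff p p = 0"
  using dcoeff_refl[of p p] by simp

lemma dcoeff_last:
  assumes "3 \<le> p"
  shows "dcoeff p (p - Suc 0) = 1"
    "dcoeff p (p - Suc (Suc 0)) = 2 * cos (pi / real p)"
    "dcoeff p (p - Suc (Suc (Suc 0))) = 4 * (cos (pi / real p))\<^sup>2 - 1"
  using assms by (simp_all add: dcoeff_refl dcoeff_2 dcoeff_3)

text \<open>The coefficients are symmetric about p/2 and increase up to it, and i <= j <= p - i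
  places j between i and its mirror image. The lower bounds on coordinates of dihedral walls rest on
  this.\<close>

lemma dcoeff_mono:
  assumes "2 \<le> p" "i \<le> j" "i + j \<le> p"
  shows "dcoeff p i \<le> dcoeff p j"
proof -
  define t where "t = pi / real p"
  have t: "0 < t" "real p * t = pi" using assms by (auto simp: t_def)
  have ij: "real i * t \<le> real j * t" using assms t by (simp add: mult_right_mono)
  have "(real i + real j) * t \<le> real p * t"
    using assms t by (intro mult_right_mono) auto
  then have s: "real i * t + real j * t \<le> pi" using t by (simp add: algebra_simps)
  have n: "0 \<le> real i * t" using t by simp
  have "sin (real j * t) - sin (real i * t)
      = 2 * sin ((real j * t - real i * t) / 2) * cos ((real j * t + real i * t) / 2)"
    by (rule sin_diff_sin)
  moreover have "0 \<le> sin ((real j * t - real i * t) / 2)"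
    using ij s n by (intro sin_ge_zero) auto
  moreover have "0 \<le> cos ((real j * t + real i * t) / 2)"
    by (rule cos_ge_zero) (use ij s n pi_gt_zero in \<open>simp_all add: field_simps\<close>)
  ultimately have "0 \<le> sin (real j * t) - sin (real i * t)" by simp
  then show ?thesis
    using sin_pi_div_pos[of p] assms unfolding dcoeff_def t_def
    by (simp add: divide_right_mono)
qed

lemma dcoeff_nonneg: "2 \<le> p \<Longrightarrow> j \<le> p \<Longrightarrow> 0 \<le> dcoeff p j"
  using dcoeff_mono[of p 0 j] by simp

lemma dcoeff_ge_1: "2 \<le> p \<Longrightarrow> 0 < j \<Longrightarrow> j < p \<Longrightarrow> 1 \<le> dcoeff p j"
  using dcoeff_mono[of p "Suc 0" j] by simp

text \<open>The possible values of \<open>- B(\<alpha>\<^sub>i, \<alpha>\<^sub>j)\<close> for \<open>i \<noteq> j\<close>.\<close>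

definition coxeter_cos :: "real \<Rightarrow> bool" where
  "coxeter_cos P \<longleftrightarrow> P = 1 \<or> (\<exists>p\<ge>2. P = cos (pi / real p))"

lemma cos_pi_div_mono: "2 \<le> p \<Longrightarrow> p \<le> q \<Longrightarrow> cos (pi / real p) \<le> cos (pi / real q)"
  by (subst cos_mono_le_eq) (auto simp: field_simps)

lemma cos_pi_div_less_1: "2 \<le> p \<Longrightarrow> cos (pi / real p) < 1"
  using cos_monotone_0_pi[of 0 "pi / real p"] by (auto simp: field_simps)

lemma cos_pi_div_nonneg: "2 \<le> p \<Longrightarrow> 0 \<le> cos (pi / real p)"
  using cos_pi_div_mono[of 2 p] by (simp add: cos_pi_half)

lemma coxeter_cos_cases:
  assumes "coxeter_cos P"
  obtains "P = 0" | "P = 1 / 2" | "P = sqrt 2 / 2"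
    | p where "5 \<le> p" "P = cos (pi / real p)" | "P = 1"
proof -
  consider "P = 1" | p where "2 \<le> p" "P = cos (pi / real p)"
    using assms unfolding coxeter_cos_def by blast
  then show thesis
  proof cases
    case (2 p)
    consider "p = 2" | "p = 3" | "p = 4" | "5 \<le> p" using 2(1) by linarith
    then show thesis
      using that 2(2) by cases (auto simp: cos_60 cos_45)
  qed (use that in blast)
qed

lemma coxeter_cos_bounds:
  assumes "coxeter_cos P"
  shows "0 \<le> P" "P \<le> 1"
  using assms cos_pi_div_nonneg by (auto simp: coxeter_cos_def)

lemma coxeter_cos_ge_half: "coxeter_cos P \<Longrightarrow> P \<noteq> 0 \<Longrightarrow> 1 / 2 \<le> P"
  using cos_pi_div_mono[of 3] by (auto simp: coxeter_cos_def cos_60)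
   (metis cos_60 cos_pi_div_mono cos_pi_half le_antisym not_less_eq_eq numeral_2_eq_2 numeral_3_eq_3 of_nat_numeral order_refl)

lemma coxeter_cos_infinite_or_finite:
  assumes "coxeter_cos P" "P \<noteq> 0"
  shows "P = 1 \<or> (\<exists>p\<ge>3. P = cos (pi / real p))"
proof -
  have "p \<noteq> 2" if "P = cos (pi / real p)" for p using that assms(2) by (auto simp: cos_pi_half)
  then show ?thesis using assms unfolding coxeter_cos_def
    by (metis Suc_leI le_neq_implies_less numeral_2_eq_2 numeral_3_eq_3)
qed

text \<open>In \<open>S a b\<close> the current amplitude is a and the previous one is b. Convexity
  preserves the initial increment 1, so the growth is at least linear.\<close>

lemma linear_growth_unbounded:
  fixes S :: "real \<Rightarrow> real \<Rightarrow> bool"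
  assumes step: "\<And>a b. S a b \<Longrightarrow> 0 \<le> b \<Longrightarrow> b < a \<Longrightarrow> \<exists>a'. S a' a \<and> 2 * a - b \<le> a'"
    and start: "S 1 0" and bound: "\<And>a b. S a b \<Longrightarrow> a \<le> K"
  shows False
proof -
  have "\<exists>a b. S a b \<and> 0 \<le> b \<and> 1 \<le> a - b \<and> real n \<le> a" for n
  proof (induction n)
    case 0
    then show ?case using start by force
  next
    case (Suc n)
    then obtain a b where ab: "S a b" "0 \<le> b" "1 \<le> a - b" "real n \<le> a" by blast
    then obtain a' where "S a' a" "2 * a - b \<le> a'" using step[of a b] by force
    then show ?case using ab by (intro exI[of _ a'] exI[of _ a]) auto
  qed
  moreover obtain n where "K < real n" using reals_Archimedean2 by blast
  ultimately show False using bound by (meson not_less order_trans)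
qed

text \<open>For C > 0, dividing W by sqrt C turns the interleaved sequence Y 0, W 0, Y 1, W 1, ...
  into one with h(t+1) + h(t-1) <= 2 sqrt C h(t), the inequality version of a rotation; like a sine
  it cannot stay positive. The proof is elementary and avoids angles.\<close>

lemma concave_sequence_not_positive:
  fixes Y W :: "nat \<Rightarrow> real"
  assumes Y: "\<And>n. Y (Suc n) \<le> 2 * W n - Y n"
    and W: "\<And>n. W (Suc n) \<le> 2 * C * Y (Suc n) - W n"
    and pos: "\<And>n. 0 < Y n" "\<And>n. 0 \<le> W n" and C: "C < 1"
  shows False
proof -
  have d: "W (Suc n) - Y (Suc n) \<le> W n - Y n - 2 * (1 - C) * Y (Suc n)" for n
    using Y[of n] W[of n] by (simp add: algebra_simps)
  have dec: "W (Suc n) - Y (Suc n) \<le> W n - Y n" for n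
    using d[of n] pos(1)[of "Suc n"] C mult_nonneg_nonneg[of "1 - C" "Y (Suc n)"] by linarith
  \<comment> \<open>If W fell below Y by e, \<open>dec\<close> would preserve the deficit and every
    round would lower W by at least e, eventually below 0.\<close>
  have A: "Y n \<le> W n" for n
  proof (rule ccontr)
    assume neg: "\<not> Y n \<le> W n"
    define e where "e = Y n - W n"
    have e: "0 < e" using neg by (simp add: e_def)
    have "W (n + k) - Y (n + k) \<le> - e \<and> W (n + k) \<le> W n - real k * e" for k
    proof (induction k)
      case (Suc k)
      have "W (Suc (n + k)) \<le> W (n + k) - 2 * e"
        using dec[of "n + k"] Y[of "n + k"] Suc by linarith
      then show ?case using dec[of "n + k"] Suc e by (simp add: algebra_simps)
    qed (simp add: e_def)
    moreover obtain k where "W n < real k * e" using reals_Archimedean3[OF e] by blast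
    ultimately show False using pos(2)[of "n + k"] by (smt (verit))
  qed
  \<comment> \<open>\<open>A\<close> at n + 1 and the bound on W give W n <= Y (n + 1), so
    \<open>A\<close> at n makes Y nondecreasing. Hence W - Y drops by at least the fixed amount
    \<delta> in every round, against \<open>A\<close>.\<close>
  have inc: "Y 0 \<le> Y n" for n
  proof (induction n)
    case (Suc n)
    have "Y n \<le> Y (Suc n)"
      using Y[of n] A[of n] A[of "Suc n"] W[of n] C pos(1)[of "Suc n"]
        mult_right_mono[of C 1 "Y (Suc n)"] by linarith
    then show ?case using Suc by simp
  qed simp
  define \<delta> where "\<delta> = 2 * (1 - C) * Y 0"
  have \<delta>: "0 < \<delta>" using C pos(1)[of 0] by (simp add: \<delta>_def)
  have "W n - Y n \<le> W 0 - Y 0 - real n * \<delta>" for n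
  proof (induction n)
    case (Suc n)
    have "\<delta> \<le> 2 * (1 - C) * Y (Suc n)"
      unfolding \<delta>_def using C inc[of "Suc n"] by (intro mult_left_mono) auto
    then show ?case using d[of n] Suc by (simp add: algebra_simps)
  qed simp
  moreover obtain k where "W 0 - Y 0 < real k * \<delta>" using reals_Archimedean3[OF \<delta>] by blast
  ultimately show False using A[of k] by (smt (verit))
qed


section \<open>Walks on a Coxeter path\<close>

text \<open>Let \<open>b\<close> be the middle letter of a Coxeter path with end letters \<open>a\<close> and \<open>c\<close>, so that promotion alternates a
  white step (the toggle at \<open>b\<close>) and a black step (the commuting toggles at \<open>a\<close> and \<open>c\<close>). The triple
  \<open>(x, y, z)\<close> stands for \<open>x \<alpha>\<^sub>a + y \<alpha>\<^sub>b + z \<alpha>\<^sub>c\<close>, and \<open>Rw n\<close>, \<open>Rb n\<close> are the sets \<open>R\<close> before the \<open>n\<close>-th white and black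
  step. The functions of \<open>path_evolution\<close> are the values at \<open>\<alpha>\<^sub>a\<close>, \<open>\<alpha>\<^sub>b\<close>, \<open>\<alpha>\<^sub>c\<close> of a linear functional transported
  along the walk; they are bounded because the orbit is finite.\<close>

definition path_evolution ::
  "real \<Rightarrow> real \<Rightarrow> (nat \<Rightarrow> real \<Rightarrow> real \<Rightarrow> real \<Rightarrow> bool) \<Rightarrow> (nat \<Rightarrow> real \<Rightarrow> real \<Rightarrow> real \<Rightarrow> bool) \<Rightarrow> nat
    \<Rightarrow> (nat \<Rightarrow> real) \<Rightarrow> (nat \<Rightarrow> real) \<Rightarrow> (nat \<Rightarrow> real) \<Rightarrow> bool" where
  "path_evolution P Q Rw Rb n0 fa fb fc \<longleftrightarrow> (\<forall>n\<ge>n0.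
     let b = (if Rw n 0 1 0 then 0 else fb n); a = fa n + 2 * P * b; c = fc n + 2 * Q * b;
       a' = (if Rb n 1 0 0 then 0 else a); c' = (if Rb n 0 0 1 then 0 else c)
     in fa (Suc n) = a - 2 * a' \<and> fc (Suc n) = c - 2 * c' \<and>
        fb (Suc n) = fb n - 2 * b + 2 * P * a' + 2 * Q * c')"

text \<open>Walls with coordinates x, y, z >= 0 occur with negated arguments. \<open>step_w\<close>
  and \<open>step_b\<close> transport R; \<open>kill_a\<close> and its companions say that no wall
  is crossed; \<open>cone_w\<close> and \<open>cone_b\<close> are closure under positive
  combinations; \<open>dom_a\<close> and its companions force a failure when the product with the
  simple root is at most -1. \<open>start\<close> yields a wall at time 0 in every set E that is
  closed in the way the elementary roots are.\<close>

locale path_game =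
  fixes P Q :: real and root :: "real \<Rightarrow> real \<Rightarrow> real \<Rightarrow> bool"
    and Rw Rb :: "nat \<Rightarrow> real \<Rightarrow> real \<Rightarrow> real \<Rightarrow> bool"
  assumes cos_P: "coxeter_cos P" and cos_Q: "coxeter_cos Q"
    and Rw_root: "Rw n x y z \<Longrightarrow> root x y z" and Rb_root: "Rb n x y z \<Longrightarrow> root x y z"
    and root_sign: "root x y z \<Longrightarrow> 0 \<le> x \<and> 0 \<le> y \<and> 0 \<le> z \<or> x \<le> 0 \<and> y \<le> 0 \<and> z \<le> 0"
    and root_norm: "root x y z \<Longrightarrow> x\<^sup>2 + y\<^sup>2 + z\<^sup>2 - 2 * P * x * y - 2 * Q * y * z = 1"
    and root_a: "root (-1) 0 0" and root_b: "root 0 (-1) 0" and root_c: "root 0 0 (-1)"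
    and root_refl_a: "root x y z \<Longrightarrow> root (2 * P * y - x) y z"
    and root_refl_b: "root x y z \<Longrightarrow> root x (2 * P * x + 2 * Q * z - y) z"
    and root_refl_c: "root x y z \<Longrightarrow> root x y (2 * Q * y - z)"
    and step_w: "Rb n x (if Rw n 0 1 0 then y else 2 * P * x + 2 * Q * z - y) z \<longleftrightarrow> Rw n x y z"
    and step_b: "Rw (Suc n) (if Rb n 1 0 0 then x else 2 * P * y - x) y
      (if Rb n 0 0 1 then z else 2 * Q * y - z) \<longleftrightarrow> Rb n x y z"
    and kill_a: "\<not> Rb n (-1) 0 0" and kill_b: "\<not> Rw n 0 (-1) 0" and kill_c: "\<not> Rb n 0 0 (-1)"
    and cone_w: "Rw n x1 y1 z1 \<Longrightarrow> Rw n x2 y2 z2 \<Longrightarrow> Rw n x3 y3 z3 \<Longrightarrow> 0 \<le> k1 \<Longrightarrow> 0 \<le> k2 \<Longrightarrow> 0 \<le> k3 \<Longrightarrow>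
      x = k1 * x1 + k2 * x2 + k3 * x3 \<Longrightarrow> y = k1 * y1 + k2 * y2 + k3 * y3 \<Longrightarrow> z = k1 * z1 + k2 * z2 + k3 * z3 \<Longrightarrow>
      root x y z \<Longrightarrow> Rw n x y z"
    and cone_b: "Rb n x1 y1 z1 \<Longrightarrow> Rb n x2 y2 z2 \<Longrightarrow> 0 \<le> k1 \<Longrightarrow> 0 \<le> k2 \<Longrightarrow>
      x = k1 * x1 + k2 * x2 \<Longrightarrow> y = k1 * y1 + k2 * y2 \<Longrightarrow> z = k1 * z1 + k2 * z2 \<Longrightarrow>
      root x y z \<Longrightarrow> Rb n x y z"
    and dom_a: "Rb n (-x) (-y) (-z) \<Longrightarrow> 0 \<le> x \<Longrightarrow> 0 \<le> y \<Longrightarrow> 0 \<le> z \<Longrightarrow> x - P * y \<le> -1 \<Longrightarrow> Rb n 1 0 0"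
    and dom_b: "Rw n (-x) (-y) (-z) \<Longrightarrow> 0 \<le> x \<Longrightarrow> 0 \<le> y \<Longrightarrow> 0 \<le> z \<Longrightarrow> y - P * x - Q * z \<le> -1 \<Longrightarrow> Rw n 0 1 0"
    and dom_c: "Rb n (-x) (-y) (-z) \<Longrightarrow> 0 \<le> x \<Longrightarrow> 0 \<le> y \<Longrightarrow> 0 \<le> z \<Longrightarrow> z - Q * y \<le> -1 \<Longrightarrow> Rb n 0 0 1"
    and evolution: "\<exists>fa fb fc K. fa n0 = u \<and> fb n0 = v \<and> fc n0 = w \<and> (\<forall>n\<ge>n0. fb n \<le> K) \<and>
      path_evolution P Q Rw Rb n0 fa fb fc"
    and start: "E 1 0 0 \<Longrightarrow> E 0 1 0 \<Longrightarrow> E 0 0 1 \<Longrightarrow>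
      (\<And>x y z. E x y z \<Longrightarrow> (x, y, z) \<noteq> (1, 0, 0) \<Longrightarrow> -1 < x - P * y \<Longrightarrow> E (2 * P * y - x) y z) \<Longrightarrow>
      (\<And>x y z. E x y z \<Longrightarrow> (x, y, z) \<noteq> (0, 1, 0) \<Longrightarrow> -1 < y - P * x - Q * z \<Longrightarrow> E x (2 * P * x + 2 * Q * z - y) z) \<Longrightarrow>
      (\<And>x y z. E x y z \<Longrightarrow> (x, y, z) \<noteq> (0, 0, 1) \<Longrightarrow> -1 < z - Q * y \<Longrightarrow> E x y (2 * Q * y - z)) \<Longrightarrow>
      \<exists>x y z. E x y z \<and> 0 \<le> x \<and> 0 \<le> y \<and> 0 \<le> z \<and> Rw 0 (-x) (-y) (-z)"
begin

text \<open>The two ends of the path are interchangeable; through this instance every result about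
  one end is also available at the other.\<close>

lemma swap: "path_game Q P (\<lambda>x y z. root z y x) (\<lambda>n x y z. Rw n z y x) (\<lambda>n x y z. Rb n z y x)"
proof (unfold_locales, goal_cases)
  case (3 n x y z) then show ?case by (rule Rw_root)
next
  case (4 n x y z) then show ?case by (rule Rb_root)
next
  case (5 x y z) then show ?case using root_sign by blast
next
  case (6 x y z) then show ?case using root_norm by (force simp: algebra_simps)
next
  case (11 x y z) then show ?case using root_refl_b[of z y x] by (simp add: add.commute)
next
  case (13 n x y z) then show ?case using step_w[of n z y x] by (cases "Rw n 0 1 0") (simp_all add: add.commute)
next
  case (14 n x y z) then show ?case using step_b[of n z y x] by (cases "Rb n 0 0 1"; cases "Rb n 1 0 0") simp_all
next
  case 18 show ?case by (rule cone_w[OF 18(1-6) 18(9) 18(8) 18(7) 18(10)])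
next
  case 19 show ?case by (rule cone_b[OF 19(1-4) 19(7) 19(6) 19(5) 19(8)])
next
  case (21 n x y z) then show ?case by (intro dom_b[of n z y x]) auto
next
  case (23 n0 u v w)
  obtain fa fb fc K where "fa n0 = w" "fb n0 = v" "fc n0 = u" "\<forall>n\<ge>n0. fb n \<le> K"
      "path_evolution P Q Rw Rb n0 fa fb fc" using evolution by blast
  then show ?case unfolding path_evolution_def Let_def
    by (intro exI[of _ fc] exI[of _ fb] exI[of _ fa] exI[of _ K]) auto
next
  case (24 E)
  have "\<exists>x y z. E z y x \<and> 0 \<le> x \<and> 0 \<le> y \<and> 0 \<le> z \<and> Rw 0 (-x) (-y) (-z)"
  proof (rule start[of "\<lambda>x y z. E z y x"])
    fix x y z assume "E z y x" "(x, y, z) \<noteq> (0, 1, 0)" "-1 < y - P * x - Q * z"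
    then show "E z (2 * P * x + 2 * Q * z - y) x" using 24(5)[of z y x] by (auto simp: algebra_simps)
  qed (use 24 in auto)
  then show ?case by blast
qed (use cos_P cos_Q root_a root_b root_c kill_a kill_b kill_c root_refl_a root_refl_c dom_a dom_c in auto)

lemma PQ_bounds: "0 \<le> P" "P \<le> 1" "0 \<le> Q" "Q \<le> 1"
  using coxeter_cos_bounds[OF cos_P] coxeter_cos_bounds[OF cos_Q] by simp_all

lemma w_succ: "Rw n x y z \<Longrightarrow> \<not> Rw n 0 1 0 \<Longrightarrow> Rb n x (2 * P * x + 2 * Q * z - y) z"
  using step_w[of n x y z] by simp

lemma w_fail: "Rw n x y z \<Longrightarrow> Rw n 0 1 0 \<Longrightarrow> Rb n x y z"
  using step_w[of n x y z] by simp

lemma b_step: "Rb n x y z \<Longrightarrow> Rw (Suc n) (if Rb n 1 0 0 then x else 2 * P * y - x) y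
      (if Rb n 0 0 1 then z else 2 * Q * y - z)"
  using step_b by blast

text \<open>The hypothesis says that the wall \<gamma> has product >= 0 with the simple root of b.
  On success it moves to s_b \<gamma>; on failure the negative of s_b \<gamma> is a positive
  combination of elements of R. So the outcome of the toggle is irrelevant.\<close>

lemma w_lower:
  assumes "Rw n (-x) (-y) (-z)" "P * x + Q * z \<le> y"
  shows "Rb n (-x) (-(2 * P * x + 2 * Q * z - y)) (-z)"
proof (cases "Rw n 0 1 0")
  case True
  have "Rw n (-x) (-(2 * P * x + 2 * Q * z - y)) (-z)"
    by (rule cone_w[OF assms(1) True True, where ?k1.0 = 1 and ?k2.0 = "2 * (y - P * x - Q * z)" and ?k3.0 = 0])
     (use assms root_refl_b[OF Rw_root[OF assms(1)]] in \<open>auto simp: algebra_simps\<close>)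
  then show ?thesis using True w_fail by blast
next
  case False
  then show ?thesis using w_succ[OF assms(1)] by (simp add: algebra_simps)
qed

lemma b_lower_a:
  assumes "Rb n (-x) (-y) (-z)" "P * y \<le> x" "Rb n 1 0 0"
  shows "Rb n (-(2 * P * y - x)) (-y) (-z)"
  by (rule cone_b[OF assms(1) assms(3), where ?k1.0 = 1 and ?k2.0 = "2 * (x - P * y)"])
     (use assms root_refl_a[OF Rb_root[OF assms(1)]] in \<open>auto simp: algebra_simps\<close>)

lemma b_lower_c:
  assumes "Rb n (-x) (-y) (-z)" "Q * y \<le> z" "Rb n 0 0 1"
  shows "Rb n (-x) (-y) (-(2 * Q * y - z))"
  by (rule cone_b[OF assms(1) assms(3), where ?k1.0 = 1 and ?k2.0 = "2 * (z - Q * y)"])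
     (use assms root_refl_c[OF Rb_root[OF assms(1)]] in \<open>auto simp: algebra_simps\<close>)

lemma b_lower_ac:
  assumes "Rb n (-x) (-y) (-z)" "P * y \<le> x" "Q * y \<le> z"
  shows "Rw (Suc n) (-(2 * P * y - x)) (-y) (-(2 * Q * y - z))"
proof -
  define x' where "x' = (if Rb n 1 0 0 then 2 * P * y - x else x)"
  define z' where "z' = (if Rb n 0 0 1 then 2 * Q * y - z else z)"
  have "Rb n (-x') (-y) (-z)" using assms b_lower_a by (auto simp: x'_def)
  then have "Rb n (-x') (-y) (-z')" using assms b_lower_c by (auto simp: z'_def)
  from b_step[OF this] show ?thesis by (auto simp: x'_def z'_def algebra_simps split: if_splits)
qed

lemma kill_a_w: "Rw n (-1) 0 0 \<Longrightarrow> Rw n 0 1 0 \<Longrightarrow> False"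
  using w_fail kill_a by blast

text \<open>The failed toggle allows the b-part of the wall to be removed; what is left is the wall
  of a, which the following black step would cross.\<close>

lemma b_fails_a:
  assumes "Rw n (-x) (-y) 0" "0 < x" "0 \<le> y" "Rw n 0 1 0"
  shows False
proof -
  have "Rw n (-1) 0 0"
    by (rule cone_w[OF assms(1) assms(4) assms(4), where ?k1.0 = "1 / x" and ?k2.0 = "y / x" and ?k3.0 = 0])
      (use assms root_a in auto)
  then show False using kill_a_w assms by blast
qed

lemma a_fails_b:
  assumes "Rb n (-x) (-y) 0" "0 \<le> x" "0 < y" "Rb n 1 0 0"
  shows "Rb n 0 (-1) 0"
  by (rule cone_b[OF assms(1) assms(4), where ?k1.0 = "1 / y" and ?k2.0 = "x / y"])
      (use assms root_b in auto)

lemma a_fails_c_fails: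
  assumes "Rb n (-x) (-y) 0" "0 \<le> x" "0 < y" "Rb n 1 0 0" "Rb n 0 0 1"
  shows False
  using b_step[OF a_fails_b[OF assms(1-4)]] assms kill_b by simp

text \<open>\<open>y\<close> and \<open>P x + Q z\<close> are, up to scaling, the values of the root at two points of the Coxeter plane: one on
  the walls \<open>a\<close>, \<open>c\<close> and one on the wall \<open>b\<close>.\<close>

lemma finite_type_step:
  assumes R: "Rw n (-x) (-y) (-z)" and nn: "0 \<le> x" "0 \<le> y" "0 \<le> z"
  shows "\<exists>x' y' z'. Rw (Suc n) (-x') (-y') (-z') \<and> 0 \<le> x' \<and> 0 < y' \<and> 0 \<le> z' \<and>
    y' \<le> 2 * (P * x + Q * z) - y \<and> P * x' + Q * z' \<le> 2 * (P\<^sup>2 + Q\<^sup>2) * y' - (P * x + Q * z)"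
proof -
  note PQ = PQ_bounds
  \<comment> \<open>Equality holds when the wall is reflected. It is kept only if b fails and y < P
    x + Q z, and then y itself satisfies the bound.\<close>
  obtain y' where y': "Rb n (-x) (-y') (-z)" "y' \<le> 2 * (P * x + Q * z) - y"
  proof (cases "P * x + Q * z \<le> y")
    case True
    then show ?thesis using w_lower[OF R True] that[of "2 * P * x + 2 * Q * z - y"] by (simp add: algebra_simps)
  next
    case False
    show ?thesis
    proof (cases "Rw n 0 1 0")
      case True
      then show ?thesis using w_fail[OF R True] False that[of y] by simp
    next
      case f: False
      then show ?thesis using w_succ[OF R f] that[of "2 * P * x + 2 * Q * z - y"] by (simp add: algebra_simps)
    qed
  qed
  have xz: "0 < x \<or> 0 < z"
  proof (rule ccontr)
    assume "\<not> (0 < x \<or> 0 < z)"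
    then have "x = 0" "z = 0" using nn by auto
    moreover from this have "y = 1" using root_norm[OF Rw_root[OF R]] nn by (simp add: power2_eq_1_iff)
    ultimately show False using R kill_b by simp
  qed
  have y'0: "0 \<le> y'" using root_sign[OF Rb_root[OF y'(1)]] xz nn by auto
  have y'pos: "0 < y'"
  proof (rule ccontr)
    assume "\<not> 0 < y'"
    then have [simp]: "y' = 0" using y'0 by simp
    \<comment> \<open>Reflecting in a only flips the sign of x, so a root supported on the commuting
      letters a and c is simple; the coming black step would cross it.\<close>
    have "root x 0 (-z)" using root_refl_a[OF Rb_root[OF y'(1)]] by simp
    then have "x = 0 \<or> z = 0" using root_sign nn by force
    moreover have "x\<^sup>2 + z\<^sup>2 = 1" using root_norm[OF Rb_root[OF y'(1)]] by simp
    ultimately have "x = 0 \<and> z = 1 \<or> x = 1 \<and> z = 0" using nn by (auto simp: power2_eq_1_iff)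
    then show False using y'(1) kill_a kill_c by auto
  qed
  define x' where "x' = (if Rb n 1 0 0 \<and> x < P * y' then x else 2 * P * y' - x)"
  define z' where "z' = (if Rb n 0 0 1 \<and> z < Q * y' then z else 2 * Q * y' - z)"
  have le: "x' \<le> 2 * P * y' - x" "z' \<le> 2 * Q * y' - z" by (auto simp: x'_def z'_def)
  have "Rb n (- (if Rb n 1 0 0 then x' else x)) (-y') (-z)"
    using y'(1) b_lower_a[OF y'(1)] by (auto simp: x'_def)
  then have "Rb n (- (if Rb n 1 0 0 then x' else x)) (-y') (- (if Rb n 0 0 1 then z' else z))"
    using b_lower_c by (auto simp: z'_def)
  from b_step[OF this] have Rw: "Rw (Suc n) (-x') (-y') (-z')"
    by (auto simp: x'_def z'_def algebra_simps split: if_splits)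
  then have "0 \<le> x' \<and> 0 \<le> z'" using root_sign[OF Rw_root[OF Rw]] y'pos by auto
  moreover have "P * x' + Q * z' \<le> P * (2 * P * y' - x) + Q * (2 * Q * y' - z)"
    using le PQ by (intro add_mono mult_left_mono) auto
  then have "P * x' + Q * z' \<le> 2 * (P\<^sup>2 + Q\<^sup>2) * y' - (P * x + Q * z)"
    by (simp add: power2_eq_square algebra_simps)
  ultimately show ?thesis using Rw y'pos y'(2) by blast
qed

lemma finite_type_False:
  assumes "P\<^sup>2 + Q\<^sup>2 < 1"
  shows False
proof -
  note PQ = PQ_bounds
  define S where "S n v \<longleftrightarrow> (case v of (x, y, z) \<Rightarrow> Rw n (-x) (-y) (-z) \<and> 0 \<le> x \<and> 0 \<le> y \<and> 0 \<le> z \<and> (0 < n \<longrightarrow> 0 < y))"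
    for n v
  define T where "T n v v' \<longleftrightarrow> (case (v, v') of ((x, y, z), (x', y', z')) \<Rightarrow>
    y' \<le> 2 * (P * x + Q * z) - y \<and> P * x' + Q * z' \<le> 2 * (P\<^sup>2 + Q\<^sup>2) * y' - (P * x + Q * z))"
    for n :: nat and v v' :: "real \<times> real \<times> real"
  have "\<exists>x y z. True \<and> 0 \<le> x \<and> 0 \<le> y \<and> 0 \<le> z \<and> Rw 0 (-x) (-y) (-z)"
    by (rule start) auto
  then have S0: "\<exists>v. S 0 v" by (auto simp: S_def)
  have S1: "\<exists>v'. S (Suc n) v' \<and> T n v v'" if "S n v" for n v
  proof -
    obtain x y z where v: "v = (x, y, z)" by (cases v) auto
    then obtain x' y' z' where "Rw (Suc n) (-x') (-y') (-z')" "0 \<le> x'" "0 < y'" "0 \<le> z'"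
      "y' \<le> 2 * (P * x + Q * z) - y" "P * x' + Q * z' \<le> 2 * (P\<^sup>2 + Q\<^sup>2) * y' - (P * x + Q * z)"
      using \<open>S n v\<close> finite_type_step[of n x y z] unfolding S_def by auto
    then show ?thesis unfolding v by (intro exI[of _ "(x', y', z')"]) (simp add: S_def T_def)
  qed
  obtain f where f: "\<And>n. S n (f n) \<and> T n (f n) (f (Suc n))"
    using dependent_nat_choice[of S T, OF S0 S1] by blast
  \<comment> \<open>Shifted by one round, because y > 0 is guaranteed only after the first
    one.\<close>
  define Y where "Y n = fst (snd (f (Suc n)))" for n
  define W where "W n = P * fst (f (Suc n)) + Q * snd (snd (f (Suc n)))" for n
  show False
  proof (rule concave_sequence_not_positive[of Y W, OF _ _ _ _ assms])
    fix n
    show "Y (Suc n) \<le> 2 * W n - Y n" "W (Suc n) \<le> 2 * (P\<^sup>2 + Q\<^sup>2) * Y (Suc n) - W n"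
      using f[of "Suc n"] by (auto simp: T_def Y_def W_def split: prod.splits)
    show "0 < Y n" "0 \<le> W n"
      using f[of "Suc n"] PQ by (auto simp: S_def Y_def W_def split: prod.splits)
  qed
qed

text \<open>The products of distinct simple roots are -1 or 0 here, so the simple roots alone
  already form an admissible set for \<open>start\<close>.\<close>

lemma infinite_dihedral_False:
  assumes "P = 1" "Q = 0"
  shows False
proof -
  define E where "E x y z \<longleftrightarrow> (x, y, z) \<in> {(1, 0, 0), (0, 1, 0), (0, 0, 1)}" for x y z :: real
  have "\<exists>x y z. E x y z \<and> 0 \<le> x \<and> 0 \<le> y \<and> 0 \<le> z \<and> Rw 0 (-x) (-y) (-z)"
    by (rule start) (auto simp: E_def assms)
  then consider "Rw 0 (-1) 0 0" | "Rw 0 0 (-1) 0" | "Rw 0 0 0 (-1)" by (auto simp: E_def)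
  then show False
  proof cases
    case 1
    then show ?thesis using kill_a_w[of 0] dom_b[of 0 1 0 0] assms by simp
  next
    case 2
    then show ?thesis using kill_b by blast
  next
    case 3
    then show ?thesis using w_lower[of 0 0 0 1] kill_c assms by simp
  qed
qed

end


section \<open>Paths with both labels at least 4\<close>

text \<open>Only finite labels are covered. For P = 1 the predicate is empty, in accordance with the
  infinite dihedral group having no elementary roots besides the simple ones.\<close>

definition dihedral_root :: "real \<Rightarrow> real \<Rightarrow> real \<Rightarrow> bool" where
  "dihedral_root P x y \<longleftrightarrow> (\<exists>p\<ge>3. P = cos (pi / real p) \<and>
     (\<exists>j<p. x = dcoeff p (Suc j) \<and> y = dcoeff p j))"

lemma dihedral_root_less_1: "dihedral_root P x y \<Longrightarrow> P < 1"
  unfolding dihedral_root_def using cos_pi_div_less_1 by fastforce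

lemma dihedral_root_swap:
  assumes "dihedral_root P x y" shows "dihedral_root P y x"
proof -
  obtain p j where p: "3 \<le> p" "P = cos (pi / real p)" "j < p" "x = dcoeff p (Suc j)" "y = dcoeff p j"
    using assms unfolding dihedral_root_def by blast
  have "x = dcoeff p (p - Suc j)" "y = dcoeff p (Suc (p - Suc j))"
    using p dcoeff_refl[of p "Suc j"] dcoeff_refl[of p j] by (simp_all add: Suc_diff_Suc)
  then show ?thesis unfolding dihedral_root_def using p
    by (intro exI[of _ p] conjI exI[of _ "p - Suc j"]) auto
qed

lemma dihedral_root_refl:
  assumes "dihedral_root P x y" "(x, y) \<noteq> (0, 1)"
  shows "dihedral_root P x (2 * P * x - y)"
proof -
  obtain p j where p: "3 \<le> p" "P = cos (pi / real p)" "j < p" "x = dcoeff p (Suc j)" "y = dcoeff p j"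
    using assms unfolding dihedral_root_def by blast
  have j: "Suc j < p"
  proof (rule ccontr)
    assume "\<not> Suc j < p"
    then have "j = p - 1" using p by simp
    then show False using assms p dcoeff_refl[of p "Suc 0"] by simp
  qed
  have "dihedral_root P (2 * P * x - y) x"
    unfolding dihedral_root_def using p j dcoeff_rec[of p j]
    by (intro exI[of _ p] conjI exI[of _ "Suc j"]) auto
  then show ?thesis by (rule dihedral_root_swap)
qed

lemma dihedral_root_refl':
  assumes "dihedral_root P x y" "(x, y) \<noteq> (1, 0)"
  shows "dihedral_root P (2 * P * y - x) y"
  using assms dihedral_root_refl[of P y x] dihedral_root_swap by blast

lemma dihedral_root_simple:
  assumes "coxeter_cos P" "P \<noteq> 0" "P < 1"
  shows "dihedral_root P 1 0" "dihedral_root P 0 1" "dihedral_root P 1 (2 * P)" "dihedral_root P (2 * P) 1"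
proof -
  obtain p where "3 \<le> p" "P = cos (pi / real p)"
    using coxeter_cos_infinite_or_finite[of P] assms by auto
  then show 1: "dihedral_root P 1 0" unfolding dihedral_root_def by (intro exI[of _ p] conjI exI[of _ 0]) auto
  then show "dihedral_root P 0 1" by (rule dihedral_root_swap)
  show 2: "dihedral_root P 1 (2 * P)" using dihedral_root_refl[OF 1] by simp
  then show "dihedral_root P (2 * P) 1" by (rule dihedral_root_swap)
qed

lemma dihedral_root_simple_or_ge_1:
  assumes "dihedral_root P x y"
  shows "(x, y) = (1, 0) \<or> (x, y) = (0, 1) \<or> 1 \<le> x \<and> 1 \<le> y"
proof -
  obtain p j where p: "3 \<le> p" "P = cos (pi / real p)" "j < p" "x = dcoeff p (Suc j)" "y = dcoeff p j"
    using assms unfolding dihedral_root_def by blast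
  consider "j = 0" | "Suc j = p" | "0 < j" "Suc j < p" using p by linarith
  then show ?thesis
  proof cases
    case 2
    then have "j = p - Suc 0" by simp
    then show ?thesis using p 2 dcoeff_refl[of p "Suc 0"] by simp
  next
    case 3
    then show ?thesis using p dcoeff_ge_1[of p j] dcoeff_ge_1[of p "Suc j"] by auto
  qed (use p in auto)
qed

text \<open>The listed exceptions are the indices 0, p - 1 and 1. At all others y is at least
  \<open>dcoeff p 2\<close>, that is 2 P, which makes the third letter's toggle fail once P Q >=
  1/2.\<close>

lemma dihedral_root_cases:
  assumes "dihedral_root P x y"
  shows "(x, y) \<in> {(1, 0), (0, 1), (2 * P, 1)} \<or> 2 * P \<le> y"
proof -
  obtain p j where p: "3 \<le> p" "P = cos (pi / real p)" "j < p" "x = dcoeff p (Suc j)" "y = dcoeff p j"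
    using assms unfolding dihedral_root_def by blast
  consider "j = 0" | "j = Suc 0" | "Suc j = p" | "2 \<le> j" "j \<le> p - 2" using p by linarith
  then show ?thesis
  proof cases
    case 3
    then have "j = p - Suc 0" by simp
    then show ?thesis using p 3 dcoeff_refl[of p "Suc 0"] by simp
  next
    case 4
    then have "dcoeff p (Suc (Suc 0)) \<le> y" unfolding p(5) using p(1) by (intro dcoeff_mono) auto
    then show ?thesis using p by (simp add: dcoeff_2)
  qed (use p in \<open>auto simp: dcoeff_2\<close>)
qed

lemma path_evolutionD:
  assumes "path_evolution P Q Rw Rb n0 fa fb fc" "n0 \<le> n"
    and b: "b = (if Rw n 0 1 0 then 0 else fb n)"
    and a: "a = (if Rb n 1 0 0 then 0 else fa n + 2 * P * b)"
    and c: "c = (if Rb n 0 0 1 then 0 else fc n + 2 * Q * b)"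
  shows "fa (Suc n) = fa n + 2 * P * b - 2 * a" "fc (Suc n) = fc n + 2 * Q * b - 2 * c"
    "fb (Suc n) = fb n - 2 * b + 2 * P * a + 2 * Q * c"
  using assms(1)[unfolded path_evolution_def Let_def, rule_format, OF assms(2)] unfolding a b c by auto

lemma path_evolution_swap:
  "path_evolution P Q Rw Rb n0 fa fb fc \<Longrightarrow>
   path_evolution Q P (\<lambda>n x y z. Rw n z y x) (\<lambda>n x y z. Rb n z y x) n0 fc fb fa"
  unfolding path_evolution_def Let_def by auto

context path_game begin

text \<open>This wall is s_a s_c applied to the simple root of b. Its product with that root is 1 -
  2 P^2 - 2 Q^2 <= -1, so b fails; the black step then lowers the wall to the simple root of b,
  whatever the outcome of its toggles.\<close>

lemma long_root_False:
  assumes "Rw n (-(2 * P)) (-1) (-(2 * Q))" "1 \<le> P\<^sup>2 + Q\<^sup>2"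
  shows False
proof -
  note PQ = PQ_bounds
  have "Rw n 0 1 0" by (rule dom_b[OF assms(1)]) (use assms(2) PQ in \<open>auto simp: power2_eq_square\<close>)
  then have "Rb n (-(2 * P)) (-1) (-(2 * Q))" using assms w_fail by blast
  from b_lower_ac[OF this] have "Rw (Suc n) 0 (-1) 0" using PQ by simp
  then show False using kill_b by blast
qed

text \<open>At the excluded indices the wall would be a simple root about to be toggled: that of b
  before the white step, or that of a after it.\<close>

lemma dihedral_white_step:
  assumes p: "3 \<le> p" "P = cos (pi / real p)"
    and R: "Rw n (- dcoeff p (Suc j)) (- dcoeff p j) 0" and j: "j < p"
  shows "Suc (Suc j) < p" "\<not> Rw n 0 1 0"
    "Rb n (- dcoeff p (Suc j)) (- dcoeff p (Suc (Suc j))) 0"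
proof -
  let ?V = "dcoeff p"
  have p2: "2 \<le> p" using p by simp
  have "Suc j \<noteq> p"
  proof
    assume e: "Suc j = p"
    then have "j = p - Suc 0" by simp
    then show False using R kill_b dcoeff_last(1)[OF p(1)] e p2 by auto
  qed
  then have j1: "Suc j < p" using j by simp
  show bs: "\<not> Rw n 0 1 0"
    using b_fails_a[OF R] dcoeff_ge_1[of p "Suc j"] j1 p2 dcoeff_nonneg[of p j] j by force
  show Rb: "Rb n (- ?V (Suc j)) (- ?V (Suc (Suc j))) 0"
    using w_succ[OF R bs] by (simp add: dcoeff_rec p(2))
  have "Suc (Suc j) \<noteq> p"
  proof
    assume e: "Suc (Suc j) = p"
    then have "Suc j = p - Suc 0" by simp
    then show False using Rb kill_a dcoeff_last(1)[OF p(1)] e p2 by auto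
  qed
  then show "Suc (Suc j) < p" using j1 by simp
qed

text \<open>While the wall is a root of the parabolic subgroup of \<open>a\<close> and \<open>b\<close> with large \<open>\<alpha>\<^sub>b\<close>-coordinate, the toggle at
  \<open>c\<close> fails and those at \<open>a\<close> and \<open>b\<close> succeed, so the wall is rotated by \<open>s\<^sub>a s\<^sub>b\<close>.\<close>

lemma wide_phase:
  assumes p: "4 \<le> p" "P = cos (pi / real p)" and PQ: "1 / 2 \<le> P * Q" "1 \<le> P\<^sup>2 + Q\<^sup>2"
    and ev: "path_evolution P Q Rw Rb n0 fa fb fc" and u: "0 \<le> u"
  shows "Rw n (- dcoeff p (Suc j)) (- dcoeff p j) 0 \<Longrightarrow> j < p \<Longrightarrow> n0 \<le> n \<Longrightarrow>
    fa n = - dcoeff p j * u \<Longrightarrow> fb n = dcoeff p (Suc j) * u \<Longrightarrow> - v \<le> fc n \<Longrightarrow>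
    \<exists>n'>n. \<exists>u'. Rw n' 0 (-1) (-(2 * Q)) \<and> Q < 1 \<and> fa n' = -u \<and> fb n' = 2 * Q * u' \<and> fc n' = -u' \<and> 2 * u - v \<le> u'"
proof (induction "p - j" arbitrary: n j rule: less_induct)
  case less
  let ?V = "dcoeff p"
  note R = less.prems(1) and j = less.prems(2) and n = less.prems(3) and f = less.prems(4-6)
  note PQ' = PQ_bounds
  have p2: "2 \<le> p" using p by simp
  have Vnn: "i \<le> p \<Longrightarrow> 0 \<le> ?V i" for i using dcoeff_nonneg p2 by blast
  have rec: "?V (Suc (Suc i)) = 2 * P * ?V (Suc i) - ?V i" for i using dcoeff_rec p by simp
  have p3: "3 \<le> p" using p by simp
  note W = dihedral_white_step[OF p3 p(2) R j]
  note j2 = W(1) and bs = W(2) and Rb = W(3)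
  have j1: "Suc j < p" using j2 by simp
  have V2pos: "0 < ?V (Suc (Suc j))" using dcoeff_ge_1[of p "Suc (Suc j)"] j2 p2 by simp
  have fa2: "fa n + 2 * P * fb n = ?V (Suc (Suc j)) * u" unfolding f rec by (simp add: algebra_simps)
  show ?case
  proof (cases "Suc (Suc (Suc j)) = p")
    \<comment> \<open>Last rotation, with the wall at (2 P, 1, 0). A failure at a alone produces the
      long root, one at c alone the simple root of b, and both together are impossible. So both
      succeed and the wall passes to the c-end.\<close>
    case True
    then have "Suc j = p - Suc (Suc 0)" "Suc (Suc j) = p - Suc 0" by auto
    then have VV: "?V (Suc j) = 2 * P" "?V (Suc (Suc j)) = 1"
      using dcoeff_last[OF p3] p(2) by auto
    note Rb' = Rb[unfolded VV]
    have c: "\<not> Rb n 0 0 1" if "Rb n 1 0 0"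
      using a_fails_c_fails[OF Rb' _ _ that] PQ' by auto
    have a: "\<not> Rb n 1 0 0"
    proof
      assume a: "Rb n 1 0 0"
      then have "Rw (Suc n) (-(2 * P)) (-1) (-(2 * Q))" using b_step[OF Rb'] c by simp
      then show False using long_root_False PQ by blast
    qed
    have c: "\<not> Rb n 0 0 1"
    proof
      assume "Rb n 0 0 1"
      then have "Rw (Suc n) 0 (-1) 0" using b_step[OF Rb'] a by simp
      then show False using kill_b by blast
    qed
    have Rw: "Rw (Suc n) 0 (-1) (-(2 * Q))" using b_step[OF Rb'] a c by simp
    have Q1: "Q < 1"
      using dom_c[of n "2 * P" 1 0] Rb' c PQ' by force
    \<comment> \<open>The second term is 4 P Q u, hence at least 2 u.\<close>
    define u' where "u' = fc n + 2 * Q * fb n"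
    have "1 * u \<le> (2 * P * Q) * u" using PQ u by (intro mult_right_mono) auto
    then have "2 * u - v \<le> u'" using f by (simp add: u'_def VV algebra_simps)
    moreover note E = path_evolutionD[OF ev n refl refl refl]
    ultimately show ?thesis using Rw Q1 fa2 f a bs c
      by (intro exI[of _ "Suc n"] conjI exI[of _ u']) (simp_all add: E u'_def VV algebra_simps)
  next
    \<comment> \<open>The b-coordinate is still at least 2 P, so the product with the simple root of
      c is at most -2 P Q <= -1 and c must fail.\<close>
    case False
    then have j3: "Suc (Suc j) \<le> p - 2" using j2 by simp
    then have "?V (Suc (Suc 0)) \<le> ?V (Suc (Suc j))" using p by (intro dcoeff_mono) auto
    then have "Q * (2 * P) \<le> Q * ?V (Suc (Suc j))"
      using PQ' p by (intro mult_left_mono) (auto simp: dcoeff_2)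
    then have c: "Rb n 0 0 1"
      using dom_c[of n "?V (Suc j)" "?V (Suc (Suc j))" 0] Rb PQ Vnn j2 by (simp add: algebra_simps)
    have a: "\<not> Rb n 1 0 0" using a_fails_c_fails[OF Rb _ _ _ c] V2pos Vnn j1 by auto
    have Rw: "Rw (Suc n) (- ?V (Suc (Suc (Suc j)))) (- ?V (Suc (Suc j))) 0"
      using b_step[OF Rb] a c by (simp add: rec[of "Suc j"] algebra_simps)
    note E = path_evolutionD[OF ev n refl refl refl]
    have "fa (Suc n) = - ?V (Suc (Suc j)) * u" using a bs fa2 by (simp add: E)
    moreover have "fb (Suc n) = ?V (Suc (Suc (Suc j))) * u"
      using a bs c fa2 by (simp add: E f(2) rec[of "Suc j"] algebra_simps)
    moreover have "- v \<le> fc (Suc n)" using c bs f(3) f(2) Vnn[of "Suc j"] j1 PQ' u by (simp add: E add_nonneg_nonneg add_increasing2)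
    ultimately show ?thesis
      using less.hyps[of "Suc (Suc j)", OF _ Rw _ _ _ _ ] j2 n by (force dest: Suc_lessD)
  qed
qed

lemma wide_finite:
  assumes "1 / 2 \<le> P\<^sup>2" "P < 1" obtains p where "4 \<le> p" "P = cos (pi / real p)"
proof -
  have "P \<noteq> 0" using assms by auto
  then obtain p where p: "3 \<le> p" "P = cos (pi / real p)"
    using coxeter_cos_infinite_or_finite[OF cos_P] assms by auto
  moreover have "p \<noteq> 3" using assms p by (auto simp: cos_60 power2_eq_square)
  ultimately show thesis using that[of p] by simp
qed

lemma wide_bounds:
  assumes "1 / 2 \<le> P\<^sup>2" "1 / 2 \<le> Q\<^sup>2"
  shows "1 / 2 \<le> P * Q" "1 / 2 \<le> Q * P" "1 \<le> P\<^sup>2 + Q\<^sup>2" "1 \<le> Q\<^sup>2 + P\<^sup>2" "0 < P" "0 < Q"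
proof -
  note PQ = PQ_bounds
  have "(1 / 2)\<^sup>2 \<le> (P * Q)\<^sup>2"
    using mult_mono[OF assms] by (simp add: power2_eq_square algebra_simps)
  then show "1 / 2 \<le> P * Q" using PQ power2_le_imp_le[of "1 / 2" "P * Q"] by simp
  then show "1 / 2 \<le> Q * P" by (simp add: mult.commute)
  show "1 \<le> P\<^sup>2 + Q\<^sup>2" "1 \<le> Q\<^sup>2 + P\<^sup>2" using assms by linarith+
  have "P \<noteq> 0" "Q \<noteq> 0" using assms by auto
  then show "0 < P" "0 < Q" using PQ by simp_all
qed

text \<open>The conclusion of \<open>wide_phase\<close> is its hypothesis at the other end, with
  (u', u) in place of (u, v). The wall thus shuttles between the two ends while the amplitudes grow,
  although the functional is bounded.\<close>

lemma wide_cycle_False: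
  assumes PQ: "1 / 2 \<le> P\<^sup>2" "1 / 2 \<le> Q\<^sup>2" and R: "Rw n0 (-(2 * P)) (-1) 0" "P < 1"
  shows False
proof -
  note PQ' = PQ_bounds
  interpret sw: path_game Q P "\<lambda>x y z. root z y x" "\<lambda>n x y z. Rw n z y x" "\<lambda>n x y z. Rb n z y x"
    by (rule swap)
  note B = wide_bounds[OF PQ]
  note PQ2 = B(1) and PQ3 = B(3) and PQ0 = B(5,6)
  \<comment> \<open>These are the values required by \<open>wide_phase\<close> at index 1 for u = 1
    and v = 0.\<close>
  obtain fa fb fc K where f: "fa n0 = -1" "fb n0 = 2 * P" "fc n0 = 0" "\<And>n. n0 \<le> n \<Longrightarrow> fb n \<le> K"
    and ev: "path_evolution P Q Rw Rb n0 fa fb fc" using evolution[of n0 "-1" "2 * P" 0] by blast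
  note ev' = path_evolution_swap[OF ev]
  define S where "S u v \<longleftrightarrow> (\<exists>n\<ge>n0.
    Rw n (-(2 * P)) (-1) 0 \<and> P < 1 \<and> fa n = -u \<and> fb n = 2 * P * u \<and> fc n = -v \<or>
    Rw n 0 (-1) (-(2 * Q)) \<and> Q < 1 \<and> fc n = -u \<and> fb n = 2 * Q * u \<and> fa n = -v)" for u v
  show False
  proof (rule linear_growth_unbounded[of S "max (K / (2 * P)) (K / (2 * Q))"])
    show "S 1 0" unfolding S_def using f R by (intro exI[of _ n0]) auto
  next
    fix a b assume "S a b"
    then consider n where "n0 \<le> n" "fb n = 2 * P * a" | n where "n0 \<le> n" "fb n = 2 * Q * a"
      unfolding S_def by blast
    then have "a \<le> K / (2 * P) \<or> a \<le> K / (2 * Q)"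
      using f(4) PQ0 by cases (force simp: field_simps)+
    then show "a \<le> max (K / (2 * P)) (K / (2 * Q))" by auto
  next
    fix a b assume "S a b" "0 \<le> b" "b < a"
    then consider (A) n where "n0 \<le> n" "Rw n (-(2 * P)) (-1) 0" "P < 1" "fa n = -a" "fb n = 2 * P * a" "fc n = -b"
      | (C) n where "n0 \<le> n" "Rw n 0 (-1) (-(2 * Q))" "Q < 1" "fc n = -a" "fb n = 2 * Q * a" "fa n = -b"
      unfolding S_def by blast
    then show "\<exists>a'. S a' a \<and> 2 * a - b \<le> a'"
    proof cases
      case A
      obtain p where p: "4 \<le> p" "P = cos (pi / real p)" using wide_finite PQ A(3) by blast
      have "\<exists>n'>n. \<exists>u'. Rw n' 0 (-1) (-(2 * Q)) \<and> Q < 1 \<and> fa n' = -a \<and> fb n' = 2 * Q * u' \<and> fc n' = -u' \<and> 2 * a - b \<le> u'"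
        using wide_phase[OF p PQ2 PQ3 ev, of a n "Suc 0" b] A p \<open>0 \<le> b\<close> \<open>b < a\<close> by (simp add: dcoeff_2)
      then show ?thesis using A(1) unfolding S_def by (meson less_imp_le order_trans)
    next
      case C
      obtain p where p: "4 \<le> p" "Q = cos (pi / real p)" using sw.wide_finite PQ C(3) by blast
      have "\<exists>n'>n. \<exists>u'. Rw n' (-(2 * P)) (-1) 0 \<and> P < 1 \<and> fc n' = -a \<and> fb n' = 2 * P * u' \<and> fa n' = -u' \<and> 2 * a - b \<le> u'"
        using sw.wide_phase[OF p _ _ ev', of a n "Suc 0" b] PQ2 PQ3 C p \<open>0 \<le> b\<close> \<open>b < a\<close>
        by (simp add: dcoeff_2 mult.commute add.commute)
      then show ?thesis using C(1) unfolding S_def by (meson less_imp_le order_trans)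
    qed
  qed
qed

end

text \<open>A set containing the simple roots and stable under simple reflections with product \<open>> -1\<close>, hence
  containing all elementary roots.\<close>

definition wide_root :: "real \<Rightarrow> real \<Rightarrow> real \<Rightarrow> real \<Rightarrow> real \<Rightarrow> bool" where
  "wide_root P Q x y z \<longleftrightarrow> (x, y, z) \<in> {(1, 0, 0), (0, 1, 0), (0, 0, 1)} \<or>
     (x, y, z) = (2 * P, 1, 2 * Q) \<and> P < 1 \<and> Q < 1 \<or> dihedral_root P x y \<and> z = 0 \<or> dihedral_root Q z y \<and> x = 0"

lemma wide_root_swap: "wide_root P Q x y z \<Longrightarrow> wide_root Q P z y x"
  unfolding wide_root_def by auto

lemma wide_root_refl_a:
  assumes E: "wide_root P Q x y z" "(x, y, z) \<noteq> (1, 0, 0)" "-1 < x - P * y"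
    and PQ: "coxeter_cos P" "coxeter_cos Q" "0 < P" "0 < Q" "1 / 2 \<le> P * Q"
  shows "wide_root P Q (2 * P * y - x) y z"
proof -
  consider "(x, y, z) = (0, 1, 0)" | "(x, y, z) = (0, 0, 1)" | "(x, y, z) = (2 * P, 1, 2 * Q)" "Q < 1"
    | "dihedral_root P x y" "z = 0" | "dihedral_root Q z y" "x = 0"
    using E(1,2) unfolding wide_root_def by auto
  then show ?thesis
  proof cases
    case 1
    then show ?thesis using E(3) dihedral_root_simple(4)[of P] PQ by (auto simp: wide_root_def)
  next
    case 2
    then show ?thesis by (auto simp: wide_root_def)
  next
    case 3
    then show ?thesis using dihedral_root_simple(4)[of Q] PQ by (auto simp: wide_root_def)
  next
    case 4
    then show ?thesis using dihedral_root_refl' E(2) by (auto simp: wide_root_def)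
  next
    case 5
    have "\<not> 2 * Q \<le> y"
    proof
      assume "2 * Q \<le> y"
      then have "P * (2 * Q) \<le> P * y" using PQ by (intro mult_left_mono) auto
      moreover have "P * y < 1" "1 \<le> P * (2 * Q)" using E(3) PQ 5 by (simp_all add: algebra_simps)
      ultimately show False by linarith
    qed
    then consider "(z, y) = (1, 0)" | "(z, y) = (0, 1)" | "(z, y) = (2 * Q, 1)"
      using dihedral_root_cases[OF 5(1)] by auto
    then show ?thesis
      using E(3) 5 dihedral_root_simple(4)[of P] PQ dihedral_root_less_1[OF 5(1)]
      by cases (auto simp: wide_root_def)
  qed
qed

lemma wide_root_refl_b:
  assumes E: "wide_root P Q x y z" "(x, y, z) \<noteq> (0, 1, 0)" "-1 < y - P * x - Q * z"
    and PQ: "coxeter_cos P" "coxeter_cos Q" "0 < P" "0 < Q" "1 \<le> P\<^sup>2 + Q\<^sup>2"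
  shows "wide_root P Q x (2 * P * x + 2 * Q * z - y) z"
proof -
  consider "(x, y, z) = (1, 0, 0)" | "(x, y, z) = (0, 0, 1)" | "(x, y, z) = (2 * P, 1, 2 * Q)" "Q < 1"
    | "dihedral_root P x y" "z = 0" | "dihedral_root Q z y" "x = 0"
    using E(1,2) unfolding wide_root_def by auto
  then show ?thesis
  proof cases
    case 1
    then show ?thesis using E(3) dihedral_root_simple(3)[of P] PQ by (auto simp: wide_root_def)
  next
    case 2
    then show ?thesis using E(3) dihedral_root_simple(3)[of Q] PQ by (auto simp: wide_root_def)
  next
    case 3
    then show ?thesis using E(3) PQ by (auto simp: power2_eq_square)
  next
    case 4
    then show ?thesis using dihedral_root_refl[of P x y] E(2) by (auto simp: wide_root_def)
  next
    case 5
    then show ?thesis using dihedral_root_refl[of Q z y] E(2) by (auto simp: wide_root_def)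
  qed
qed

context path_game begin

text \<open>Here \<open>wide_phase\<close> is used for the zero functional, since only the final
  position of the wall is wanted.\<close>

lemma wide_start:
  assumes PQ: "1 / 2 \<le> P * Q" "1 \<le> P\<^sup>2 + Q\<^sup>2" "1 / 2 \<le> P\<^sup>2"
    and x: "dihedral_root P x y" "Rw 0 (-x) (-y) 0"
  shows "\<exists>n. Rw n 0 (-1) (-(2 * Q)) \<and> Q < 1"
proof -
  obtain p j where p: "3 \<le> p" "P = cos (pi / real p)" and j: "j < p" "x = dcoeff p (Suc j)" "y = dcoeff p j"
    using x unfolding dihedral_root_def by blast
  have "p \<noteq> 3" using p(2) PQ(3) by (auto simp: cos_60 power2_eq_square)
  then have p: "4 \<le> p" "P = cos (pi / real p)" using p by auto
  obtain fa fb fc K where f: "fa 0 = 0" "fb 0 = 0" "fc 0 = 0"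
    and ev: "path_evolution P Q Rw Rb 0 fa fb fc" using evolution[of 0 0 0 0] by blast
  show ?thesis using wide_phase[OF p PQ(1,2) ev, of 0 0 j 0] x(2) j f by auto
qed

lemma wide_False:
  assumes PQ: "1 / 2 \<le> P\<^sup>2" "1 / 2 \<le> Q\<^sup>2"
  shows False
proof -
  note PQ' = PQ_bounds
  interpret sw: path_game Q P "\<lambda>x y z. root z y x" "\<lambda>n x y z. Rw n z y x" "\<lambda>n x y z. Rb n z y x"
    by (rule swap)
  note B = wide_bounds[OF PQ]
  note PQ2 = B(1) and PQ3 = B(3) and PQ0 = B(5,6)
  note PQ4 = B(2,4)
  have AF: False if "Rw n (-(2 * P)) (-1) 0" "P < 1" for n
    using wide_cycle_False[OF PQ that] .
  have CF: False if "Rw n 0 (-1) (-(2 * Q))" "Q < 1" for n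
    using sw.wide_cycle_False[OF PQ(2,1)] that by blast
  have "\<exists>x y z. wide_root P Q x y z \<and> 0 \<le> x \<and> 0 \<le> y \<and> 0 \<le> z \<and> Rw 0 (-x) (-y) (-z)"
  proof (rule start)
    fix x y z assume "wide_root P Q x y z" "(x, y, z) \<noteq> (1, 0, 0)" "-1 < x - P * y"
    then show "wide_root P Q (2 * P * y - x) y z"
      using wide_root_refl_a cos_P cos_Q PQ0 PQ2 by blast
  next
    fix x y z assume "wide_root P Q x y z" "(x, y, z) \<noteq> (0, 1, 0)" "-1 < y - P * x - Q * z"
    then show "wide_root P Q x (2 * P * x + 2 * Q * z - y) z"
      using wide_root_refl_b cos_P cos_Q PQ0 PQ3 by blast
  next
    fix x y z assume "wide_root P Q x y z" "(x, y, z) \<noteq> (0, 0, 1)" "-1 < z - Q * y"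
    then show "wide_root P Q x y (2 * Q * y - z)"
      using wide_root_refl_a[of Q P z y x] wide_root_swap cos_P cos_Q PQ0 PQ4 by auto
  qed (auto simp: wide_root_def)
  then obtain x y z where E: "wide_root P Q x y z" and R: "Rw 0 (-x) (-y) (-z)" by blast
  \<comment> \<open>For P = 1 the wall of a has product -1 with the simple root of b, so b fails and
    the wall of a would be crossed in the black step.\<close>
  have a: False if "Rw 0 (-1) 0 0"
  proof (cases "P < 1")
    case True
    then show ?thesis using wide_start[OF PQ2 PQ3 PQ(1), of 1 0] dihedral_root_simple(1)[of P] cos_P PQ0 CF that by auto
  next
    case False
    then show ?thesis using dom_b[of 0 1 0 0] that kill_a_w[of 0] by auto
  qed
  have c: False if "Rw 0 0 0 (-1)"
  proof (cases "Q < 1")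
    case True
    then show ?thesis using sw.wide_start[OF PQ4 PQ(2), of 1 0] dihedral_root_simple(1)[of Q] cos_Q PQ0 AF that by auto
  next
    case False
    then show ?thesis using sw.dom_b[where n = 0 and x = 1 and y = 0 and z = 0] that sw.kill_a_w[of 0] by auto
  qed
  show False
    using E unfolding wide_root_def
  proof (elim disjE conjE)
    assume "dihedral_root P x y" "z = 0"
    then show False using wide_start[OF PQ2 PQ3 PQ(1), of x y] R CF by auto
  next
    assume "dihedral_root Q z y" "x = 0"
    then show False using sw.wide_start[OF PQ4 PQ(2), of z y] R AF by auto
  qed (use a c R kill_b long_root_False PQ3 in auto)
qed

end


section \<open>Paths with a label 3\<close>

text \<open>With Q = 1/2 the bound says that the type is not finite: p = 6 is affine G_2, larger or
  infinite labels are hyperbolic, and p = 5, the finite type H_3, falls just below 3/4.\<close>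

lemma narrow_cos_cases:
  assumes "coxeter_cos P" "3 / 4 \<le> P\<^sup>2"
  obtains "P = 1" | "P\<^sup>2 = 3 / 4" "P = cos (pi / real 6)" | p where "7 \<le> p" "P = cos (pi / real p)"
proof -
  note P = coxeter_cos_bounds[OF assms(1)]
  consider "P = 0" | "P = 1 / 2" | "P = sqrt 2 / 2" | p where "5 \<le> p" "P = cos (pi / real p)" | "P = 1"
    using coxeter_cos_cases[OF assms(1)] by metis
  then show thesis
  proof cases
    case (4 p)
    have c6: "(cos (pi / real 6))\<^sup>2 = 3 / 4" by (simp add: cos_30 power_divide)
    have "p \<noteq> 5"
    proof
      assume "p = 5"
      then have "P < cos (pi / real 6)" using 4 by (auto intro!: cos_monotone_0_pi simp: field_simps)
      then have "P\<^sup>2 < 3 / 4" unfolding c6[symmetric] using P by (intro power_strict_mono) auto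
      then show False using assms by simp
    qed
    then consider "p = 6" | "7 \<le> p" using 4 by linarith
    then show thesis using that 4 c6 by cases auto
  next
    case 1
    then show thesis using assms(2) by simp
  next
    case 2
    have "P\<^sup>2 = 1 / 4" unfolding 2 by (simp add: power2_eq_square)
    then show thesis using assms(2) by simp
  next
    case 3
    have "P\<^sup>2 = 1 / 2" unfolding 3 by (simp add: power_divide)
    then show thesis using assms(2) by simp
  qed (rule that(1))
qed

text \<open>The left-hand side is the product of (4 P^2 - 1, 2 P, 2 P) with the simple root of b.
  For finite p it is -1/2 times \<open>dcoeff p 4\<close>, which for p >= 7 is at most -1/2 times
  \<open>dcoeff p 3\<close>, hence at most -1. In affine G_2 it is -P > -1.\<close>

lemma narrow_cos_cubic:
  assumes "coxeter_cos P" "3 / 4 \<le> P\<^sup>2" "P\<^sup>2 \<noteq> 3 / 4"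
  shows "2 * P - P * (4 * P\<^sup>2 - 1) - P \<le> -1"
  using assms(1,2)
proof (cases rule: narrow_cos_cases)
  case (3 p)
  have "dcoeff p (Suc (Suc (Suc 0))) \<le> dcoeff p (Suc (Suc (Suc (Suc 0))))"
    using 3 by (intro dcoeff_mono) auto
  then have "4 * P\<^sup>2 - 1 \<le> 2 * P * (4 * P\<^sup>2 - 2)"
    using 3 by (simp add: dcoeff_3 dcoeff_4)
  then show ?thesis using assms(2) by (simp add: algebra_simps)
qed (use assms in \<open>auto simp: power2_eq_square\<close>)

lemma dihedral_root_narrow_cases:
  assumes "dihedral_root P x y" "3 / 4 \<le> P\<^sup>2"
  shows "(x, y) \<in> {(1, 0), (0, 1), (2 * P, 1), (1, 2 * P), (4 * P\<^sup>2 - 1, 2 * P)} \<or> 2 \<le> y"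
proof -
  obtain p j where p: "3 \<le> p" "P = cos (pi / real p)" "j < p" "x = dcoeff p (Suc j)" "y = dcoeff p j"
    using assms unfolding dihedral_root_def by blast
  consider "j = 0" | "j = Suc 0" | "j = Suc (Suc 0)" | "Suc j = p" | "Suc (Suc j) = p" | "3 \<le> j" "j \<le> p - 3" using p by linarith
  then show ?thesis
  proof cases
    case 4
    then have "j = p - Suc 0" by simp
    then show ?thesis using p 4 dcoeff_refl[of p "Suc 0"] by simp
  next
    case 5
    then have "j = p - Suc (Suc 0)" "Suc j = p - Suc 0" by auto
    then show ?thesis using p dcoeff_refl[of p "Suc 0"] dcoeff_refl[of p "Suc (Suc 0)"]
      by (simp add: dcoeff_2)
  next
    case 6
    then have "dcoeff p (Suc (Suc (Suc 0))) \<le> y" unfolding p(5) using p(1) by (intro dcoeff_mono) auto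
    then show ?thesis using p assms(2) by (simp add: dcoeff_3)
  qed (use p in \<open>auto simp: dcoeff_2 dcoeff_3\<close>)
qed

text \<open>The counterpart of \<open>wide_root\<close> for Q = 1/2. The three sporadic roots are
  s_a s_c applied to the simple root of b, then s_c s_b and s_a s_c s_b applied to that of a; in
  affine G_2 one more reflection s_b is possible.\<close>

definition narrow_root :: "real \<Rightarrow> real \<Rightarrow> real \<Rightarrow> real \<Rightarrow> bool" where
  "narrow_root P x y z \<longleftrightarrow> (x, y, z) \<in> {(1, 0, 0), (0, 1, 0), (0, 0, 1), (0, 1, 1)} \<or>
     P < 1 \<and> (dihedral_root P x y \<and> z = 0 \<or>
       (x, y, z) \<in> {(2 * P, 1, 1), (1, 2 * P, 2 * P), (4 * P\<^sup>2 - 1, 2 * P, 2 * P)} \<or>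
       P\<^sup>2 = 3 / 4 \<and> (x, y, z) = (2, 4 * P, 2 * P))"

lemma narrow_root_cases [consumes 1]:
  assumes "narrow_root P x y z"
  obtains "(x, y, z) = (1, 0, 0)" | "(x, y, z) = (0, 1, 0)" | "(x, y, z) = (0, 0, 1)" | "(x, y, z) = (0, 1, 1)"
    | "P < 1" "dihedral_root P x y" "z = 0" | "P < 1" "(x, y, z) = (2 * P, 1, 1)"
    | "P < 1" "(x, y, z) = (1, 2 * P, 2 * P)" | "P < 1" "(x, y, z) = (4 * P\<^sup>2 - 1, 2 * P, 2 * P)"
    | "P < 1" "P\<^sup>2 = 3 / 4" "(x, y, z) = (2, 4 * P, 2 * P)"
  using assms unfolding narrow_root_def by (elim disjE conjE insertE emptyE) (assumption | rule that)+

lemma narrow_root_refl_a: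
  assumes E: "narrow_root P x y z" "(x, y, z) \<noteq> (1, 0, 0)" "-1 < x - P * y"
    and P: "coxeter_cos P" "3 / 4 \<le> P\<^sup>2"
  shows "narrow_root P (2 * P * y - x) y z"
proof -
  have "P \<noteq> 0" using P by auto
  note D = dihedral_root_simple[OF P(1) this]
  show ?thesis
    using E(1)
  proof (cases rule: narrow_root_cases)
    case 5
    then show ?thesis using dihedral_root_refl' E(2) by (auto simp: narrow_root_def)
  next
    case 9
    then show ?thesis using E(3) by (auto simp: power2_eq_square)
  qed (use E(2,3) D in \<open>auto simp: narrow_root_def power2_eq_square\<close>)
qed

lemma narrow_root_refl_b:
  assumes E: "narrow_root P x y z" "(x, y, z) \<noteq> (0, 1, 0)" "-1 < y - P * x - 1 / 2 * z"
    and P: "coxeter_cos P" "3 / 4 \<le> P\<^sup>2"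
  shows "narrow_root P x (2 * P * x + 2 * (1 / 2) * z - y) z"
proof -
  have "P \<noteq> 0" using P by auto
  note D = dihedral_root_simple[OF P(1) this]
  show ?thesis
    using E(1)
  proof (cases rule: narrow_root_cases)
    case 5
    then show ?thesis using dihedral_root_refl[of P x y] E(2) by (auto simp: narrow_root_def)
  next
    case 6
    then show ?thesis using E(3) P by (auto simp: power2_eq_square)
  next
    case 8
    have "\<not> 2 * P - P * (4 * P\<^sup>2 - 1) - P \<le> -1" using E(3) 8 by simp
    then have q: "P\<^sup>2 = 3 / 4" using narrow_cos_cubic[OF P] by blast
    then show ?thesis using 8 by (simp add: narrow_root_def)
  next
    case 9
    then show ?thesis by (auto simp: narrow_root_def)
  qed (use E(2,3) D in \<open>auto simp: narrow_root_def power2_eq_square\<close>)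
qed

lemma narrow_root_refl_c:
  assumes E: "narrow_root P x y z" "(x, y, z) \<noteq> (0, 0, 1)" "-1 < z - 1 / 2 * y"
    and P: "coxeter_cos P" "3 / 4 \<le> P\<^sup>2"
  shows "narrow_root P x y (2 * (1 / 2) * y - z)"
proof -
  have "P \<noteq> 0" using P by auto
  note D = dihedral_root_simple[OF P(1) this]
  have D': "P < 1 \<Longrightarrow> dihedral_root P (4 * P\<^sup>2 - 1) (2 * P)"
    using dihedral_root_refl'[OF D(3)] \<open>P \<noteq> 0\<close> by (simp add: power2_eq_square)
  show ?thesis
    using E(1)
  proof (cases rule: narrow_root_cases)
    case 5
    then show ?thesis using dihedral_root_narrow_cases[OF 5(2) P(2)] E by (auto simp: narrow_root_def)
  qed (use E(2,3) D D' in \<open>auto simp: narrow_root_def\<close>)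
qed

locale narrow_path_game = path_game +
  assumes Q: "Q = 1 / 2" and P34: "3 / 4 \<le> P\<^sup>2"
begin

text \<open>The root s_c s_b applied to the simple root of a. It is orthogonal to the simple root of
  b, so white steps fix it, and it is the position to which the wall returns.\<close>

abbreviation theta :: "nat \<Rightarrow> bool" where
  "theta n \<equiv> Rw n (-1) (-(2 * P)) (-(2 * P))"

lemma P_pos: "0 < P" "P \<le> 1" "1 / 2 \<le> P"
proof -
  have "P \<noteq> 0" using P34 by auto
  then show "0 < P" "P \<le> 1" "1 / 2 \<le> P"
    using coxeter_cos_bounds[OF cos_P] coxeter_cos_ge_half[OF cos_P] by auto
qed

lemma root_011_False: "Rw n 0 (-1) (-1) \<Longrightarrow> False"
proof (cases "Rw n 0 1 0")
  case True
  assume R: "Rw n 0 (-1) (-1)"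
  have "Rw n 0 0 (-1)"
    by (rule cone_w[OF R True True, where ?k1.0 = 1 and ?k2.0 = 1 and ?k3.0 = 0]) (use root_c in auto)
  then show False using True w_fail kill_c by blast
next
  case False
  assume "Rw n 0 (-1) (-1)"
  from w_succ[OF this False] show False using kill_c by (simp add: Q)
qed

text \<open>A failure at a makes the simple root of b a wall. Then c either fails, and this wall is
  crossed next, or succeeds and turns it into the root excluded by
  \<open>root_011_False\<close>.\<close>

lemma a_fails_False:
  assumes "Rb n (-x) (-y) 0" "0 \<le> x" "0 < y" "Rb n 1 0 0"
  shows False
  using b_step[OF a_fails_b[OF assms]] assms(4) kill_b root_011_False[of "Suc n"] by (simp add: Q split: if_splits)

lemma root_1P0_False: "Rw n (-1) (-(2 * P)) 0 \<Longrightarrow> False"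
  using b_fails_a[of n 1 "2 * P"] w_succ[of n "-1" "-(2 * P)" 0] kill_a[of n] P_pos by auto

lemma high_root_False: "Rb n (-(4 * P\<^sup>2 - 1)) (-(2 * P)) (-(2 * P)) \<Longrightarrow> False"
  using b_lower_ac[of n "4 * P\<^sup>2 - 1" "2 * P" "2 * P"] root_1P0_False[of "Suc n"] P34 P_pos
  by (simp add: Q power2_eq_square)

lemma G2_root_False:
  assumes "P\<^sup>2 = 3 / 4" "Rw n (-2) (-(4 * P)) (-(2 * P))"
  shows False
proof -
  have "Rb n (-2) (-(2 * P * 2 + 2 * Q * (2 * P) - 4 * P)) (-(2 * P))"
    using w_lower[of n 2 "4 * P" "2 * P"] assms(2) P_pos by (simp add: Q)
  then show False using high_root_False[of n] assms(1) by (simp add: Q)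
qed

text \<open>If b fails, \<open>high_root_False\<close> applies. By \<open>narrow_cos_cubic\<close>
  success is possible only in affine G_2; then a is forced to fail, c fixes the wall, and
  \<open>G2_root_False\<close> applies.\<close>

lemma kappa_False:
  assumes "Rw n (-(4 * P\<^sup>2 - 1)) (-(2 * P)) (-(2 * P))"
  shows False
proof (cases "Rw n 0 1 0")
  case True
  then show ?thesis using w_fail assms high_root_False by blast
next
  case False
  then have "\<not> 2 * P - P * (4 * P\<^sup>2 - 1) - P \<le> -1"
    using dom_b[OF assms] P34 P_pos by (auto simp: Q)
  then have q: "P\<^sup>2 = 3 / 4" using narrow_cos_cubic[OF cos_P P34] by blast
  have Rb: "Rb n (-2) (-(4 * P)) (-(2 * P))" using w_succ[OF assms False] by (simp add: q Q)
  have "2 - P * (4 * P) \<le> -1" using q by (simp add: power2_eq_square)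
  then have a: "Rb n 1 0 0" using dom_a[OF Rb] P_pos by simp
  have "Rw (Suc n) (-2) (-(4 * P)) (-(2 * P))" using b_step[OF Rb] a by (simp add: Q split: if_splits)
  then show False using G2_root_False q by blast
qed

lemma narrow_middle_step:
  assumes p: "6 \<le> p" "P = cos (pi / real p)"
    and R: "Rw n (- dcoeff p (Suc j)) (- dcoeff p j) 0" and j: "0 < j" "Suc (Suc j) \<le> p - 3"
  shows "\<not> Rb n 1 0 0" "Rb n 0 0 1"
    "Rw (Suc n) (- dcoeff p (Suc (Suc (Suc j)))) (- dcoeff p (Suc (Suc j))) 0"
proof -
  let ?V = "dcoeff p"
  have p3: "3 \<le> p" "j < p" using p j by auto
  note Rb = dihedral_white_step(3)[OF p3(1) p(2) R p3(2)]
  have nn: "0 \<le> ?V (Suc j)" using p j by (intro dcoeff_nonneg) auto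
  have "?V (Suc (Suc (Suc 0))) \<le> ?V (Suc (Suc j))" using p j by (intro dcoeff_mono) auto
  then have V: "2 \<le> ?V (Suc (Suc j))" using P34 p by (simp add: dcoeff_3)
  show a: "\<not> Rb n 1 0 0" using a_fails_False[OF Rb nn] V by auto
  show c: "Rb n 0 0 1" using dom_c[of n "?V (Suc j)" "?V (Suc (Suc j))" 0] Rb nn V by (simp add: Q)
  show "Rw (Suc n) (- ?V (Suc (Suc (Suc j)))) (- ?V (Suc (Suc j))) 0"
    using b_step[OF Rb] a c p by (simp add: dcoeff_rec algebra_simps)
qed

text \<open>As in \<open>wide_phase\<close> the index rises by 2 per round, but the exit is from
  index p - 4 to \<open>theta\<close>, which gives the equation for n'. In the other parity the last
  wall would be a root excluded by \<open>kill_b\<close> or \<open>root_011_False\<close>. Index 0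
  is left out because 2 P < 2 does not force c to fail. The exact time n' is needed to keep
  \<open>strip\<close> in step with \<open>theta\<close>.\<close>

lemma narrow_phase:
  assumes p: "6 \<le> p" "P = cos (pi / real p)"
    and ev: "path_evolution P Q Rw Rb n0 fa fb fc" and u: "0 \<le> u"
  shows "Rw n (- dcoeff p (Suc j)) (- dcoeff p j) 0 \<Longrightarrow> 0 < j \<Longrightarrow> j < p \<Longrightarrow> n0 \<le> n \<Longrightarrow>
    fa n = - dcoeff p j * u \<Longrightarrow> fb n = dcoeff p (Suc j) * u \<Longrightarrow> - v \<le> fc n \<Longrightarrow>
    \<exists>n' u'. 2 * n' + j + 2 = 2 * n + p \<and> n < n' \<and> theta n' \<and>
       fa n' = -(2 * P) * u \<and> fb n' = u + u' \<and> fc n' = -u' \<and> 2 * u - v \<le> u'"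
proof (induction "p - j" arbitrary: n j rule: less_induct)
  case less
  let ?V = "dcoeff p"
  note R = less.prems(1) and j = less.prems(2,3) and n = less.prems(4) and f = less.prems(5-7)
  have p2: "2 \<le> p" using p by simp
  have Vnn: "i \<le> p \<Longrightarrow> 0 \<le> ?V i" for i using dcoeff_nonneg p2 by blast
  have rec: "?V (Suc (Suc i)) = 2 * P * ?V (Suc i) - ?V i" for i using dcoeff_rec p by simp
  have p3: "3 \<le> p" using p by simp
  note W = dihedral_white_step[OF p3 p(2) R j(2)]
  note j2 = W(1) and bs = W(2) and Rb = W(3)
  have j1: "Suc j < p" using j2 by simp
  have V2pos: "0 < ?V (Suc (Suc j))" using dcoeff_ge_1[of p "Suc (Suc j)"] j2 p2 by simp
  have a: "\<not> Rb n 1 0 0" using a_fails_False[OF Rb] V2pos Vnn j1 by auto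
  have j3: "Suc (Suc (Suc j)) \<noteq> p"
  proof
    assume "Suc (Suc (Suc j)) = p"
    then have "Suc j = p - Suc (Suc 0)" "Suc (Suc j) = p - Suc 0" by auto
    then have "?V (Suc j) = 2 * P" "?V (Suc (Suc j)) = 1" using dcoeff_last[OF p3] p(2) by auto
    then show False using b_step[OF Rb] a kill_b root_011_False[of "Suc n"] by (simp add: Q split: if_splits)
  qed
  have fa2: "fa n + 2 * P * fb n = ?V (Suc (Suc j)) * u" unfolding f rec by (simp add: algebra_simps)
  note E = path_evolutionD[OF ev n refl refl refl]
  show ?case
  proof (cases "Suc (Suc (Suc (Suc j))) = p")
    case True
    then have "Suc j = p - Suc (Suc (Suc 0))" "Suc (Suc j) = p - Suc (Suc 0)" "Suc (Suc (Suc j)) = p - Suc 0" by auto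
    then have VV: "?V (Suc j) = 4 * P\<^sup>2 - 1" "?V (Suc (Suc j)) = 2 * P" "?V (Suc (Suc (Suc j))) = 1"
      using dcoeff_last[OF p3] p(2) by auto
    have c: "\<not> Rb n 0 0 1"
    proof
      assume "Rb n 0 0 1"
      then have "Rw (Suc n) (-1) (-(2 * P)) 0"
        using b_step[OF Rb] a VV rec[of "Suc j"] by (simp add: algebra_simps power2_eq_square)
      then show False by (rule root_1P0_False)
    qed
    have Rw: "theta (Suc n)"
      using b_step[OF Rb] a c VV rec[of "Suc j"] by (simp add: algebra_simps power2_eq_square Q)
    \<comment> \<open>Here fb n = (4 P^2 - 1) u, which is at least 2 u.\<close>
    define u' where "u' = fc n + fb n"
    have "2 * u \<le> (4 * P\<^sup>2 - 1) * u" using P34 u by (intro mult_right_mono) auto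
    then have "2 * u - v \<le> u'" using f by (simp add: u'_def VV)
    moreover have "fa (Suc n) = - (2 * P) * u" using a bs fa2 by (simp add: E VV)
    moreover have "fb (Suc n) = u + u'"
    proof -
      have "fb (Suc n) = 2 * P * (2 * P * u) + u' - ?V (Suc j) * u"
        using a bs c fa2 by (simp add: E Q u'_def VV(2) f(2))
      moreover have "2 * P * (2 * P * u) - ?V (Suc j) * u = u" unfolding VV by (simp add: algebra_simps power2_eq_square)
      ultimately show ?thesis by linarith
    qed
    moreover have "fc (Suc n) = - u'" using bs c by (simp add: E Q u'_def)
    ultimately show ?thesis using Rw True
      by (intro exI[of _ "Suc n"] conjI exI[of _ u']) auto
  next
    case False
    then have j3: "Suc (Suc j) \<le> p - 3" using j2 j3 by simp
    note M = narrow_middle_step[OF p R j(1) j3]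
    note c = M(2) and Rw = M(3)
    have "fa (Suc n) = - ?V (Suc (Suc j)) * u" using a bs fa2 by (simp add: E)
    moreover have "fb (Suc n) = ?V (Suc (Suc (Suc j))) * u"
      using a bs c fa2 by (simp add: E f(2) rec[of "Suc j"] algebra_simps)
    moreover have "- v \<le> fc (Suc n)" using c bs f(3) f(2) Vnn[of "Suc j"] j1 u by (simp add: E Q add_nonneg_nonneg add_increasing2)
    ultimately have "\<exists>n' u'. 2 * n' + Suc (Suc j) + 2 = 2 * Suc n + p \<and> Suc n < n' \<and> theta n' \<and>
       fa n' = -(2 * P) * u \<and> fb n' = u + u' \<and> fc n' = -u' \<and> 2 * u - v \<le> u'"
      using less.hyps[of "Suc (Suc j)", OF _ Rw _ _ _ _ ] j2 n j by simp
    then show ?thesis by (elim exE) (intro exI conjI, auto)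
  qed
qed

text \<open>A failure at a leads to (1, 2 P, 0) whatever happens at c, and a failure at c alone
  leads to the root of \<open>kappa_False\<close>; both are excluded.\<close>

lemma theta_step:
  assumes "theta n"
  shows "\<not> Rb n 1 0 0" "\<not> Rb n 0 0 1" "Rw (Suc n) (-(4 * P\<^sup>2 - 1)) (-(2 * P)) 0"
proof -
  have Rb: "Rb n (-1) (-(2 * P)) (-(2 * P))"
    using w_succ[OF assms] w_fail[OF assms] by (cases "Rw n 0 1 0") (simp_all add: Q)
  show a: "\<not> Rb n 1 0 0"
  proof
    assume a: "Rb n 1 0 0"
    have "Rw (Suc n) (-1) (-(2 * P)) 0"
      using b_step[OF Rb] b_step[OF b_lower_c[OF Rb]] a P_pos by (cases "Rb n 0 0 1") (simp_all add: Q)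
    then show False by (rule root_1P0_False)
  qed
  show c: "\<not> Rb n 0 0 1"
  proof
    assume "Rb n 0 0 1"
    then have "Rw (Suc n) (-(4 * P\<^sup>2 - 1)) (-(2 * P)) (-(2 * P))"
      using b_step[OF Rb] a by (simp add: power2_eq_square algebra_simps)
    then show False by (rule kappa_False)
  qed
  show "Rw (Suc n) (-(4 * P\<^sup>2 - 1)) (-(2 * P)) 0"
    using b_step[OF Rb] a c by (simp add: Q power2_eq_square algebra_simps)
qed

text \<open>If b failed, c would be forced to fail one round later. Carried back to round n, that
  failure puts (2 P, 1, 0) into R; combined with the wall and the simple root of b it gives the wall
  of c, which the black step of round n would cross.\<close>

lemma theta_b_succeeds_of_large:
  assumes p: "7 \<le> p" "P = cos (pi / real p)" and th: "theta n"
  shows "\<not> Rw n 0 1 0"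
proof
  assume b: "Rw n 0 1 0"
  note T = theta_step[OF th]
  have b': "\<not> Rw (Suc n) 0 1 0" using b_fails_a[OF T(3)] P34 P_pos by force
  have V: "dcoeff p (Suc (Suc (Suc 0))) \<le> dcoeff p (Suc (Suc (Suc (Suc 0))))"
    using p by (intro dcoeff_mono) auto
  define y where "y = 2 * P * (4 * P\<^sup>2 - 2)"
  have y: "2 \<le> y" using V p P34 by (simp add: dcoeff_3 dcoeff_4 y_def)
  have "Rb (Suc n) (-(4 * P\<^sup>2 - 1)) (-y) 0"
    using w_succ[OF T(3) b'] by (simp add: y_def algebra_simps)
  then have "Rb (Suc n) 0 0 1" using dom_c[of "Suc n" "4 * P\<^sup>2 - 1" y 0] y P34 by (simp add: Q)
  then have "Rw (Suc n) 0 1 1" using step_w[of "Suc n" 0 1 1] b' by (simp add: Q)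
  then have "Rb n (2 * P) 1 0" using step_b[of n "2 * P" 1 0] T by (simp add: Q)
  then have R: "Rw n (2 * P) 1 0" using step_w[of n "2 * P" 1 0] b by simp
  have "1 / (4 * P\<^sup>2) \<le> 1" using P34 by (simp add: divide_le_eq)
  have "Rw n 0 0 (-1)"
    by (rule cone_w[OF th R b, where ?k1.0 = "1 / (2 * P)" and ?k2.0 = "1 / (4 * P\<^sup>2)" and ?k3.0 = "1 - 1 / (4 * P\<^sup>2)"])
      (use P34 P_pos root_c \<open>1 / (4 * P\<^sup>2) \<le> 1\<close> in \<open>auto simp: power2_eq_square\<close>)
  then show False using w_fail[OF _ b] kill_c by blast
qed

text \<open>In type \<open>G\<^sub>2\<close> affine the toggle at \<open>b\<close> can fail once. Afterwards its wall reappears as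
  \<open>2 k \<delta> - \<alpha>\<^sub>b\<close> with \<open>\<delta> = (\<surd>3, 2, 1)\<close> the null root, and a second failure would confine \<open>L\<close> to a strip on the
  other side of the wall of \<open>\<alpha>\<^sub>c\<close>, which is crossed next.\<close>

definition strip :: "nat \<Rightarrow> bool" where
  "strip n \<longleftrightarrow> (\<exists>k>0. Rw n (4 * k * P) (4 * k - 1) (2 * k))"

text \<open>The weights cancel the a- and b-coordinates: with P^2 = 3/4 the b-coordinates are -3/2,
  1 - 1/(4 k) and 1/2 + 1/(4 k), and the c-coordinates add up to -3/2 + 1/2 = -1.\<close>

lemma strip_b_succeeds:
  assumes q: "P\<^sup>2 = 3 / 4" and th: "theta n" and s: "strip n"
  shows "\<not> Rw n 0 1 0"
proof
  assume b: "Rw n 0 1 0"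
  obtain k where k: "0 < k" "Rw n (4 * k * P) (4 * k - 1) (2 * k)" using s strip_def by blast
  have "Rw n 0 0 (-1)"
    by (rule cone_w[OF th k(2) b, where ?k1.0 = P and ?k2.0 = "1 / (4 * k)" and ?k3.0 = "1 / 2 + 1 / (4 * k)"])
      (use k q P_pos root_c in \<open>auto simp: power2_eq_square field_simps\<close>)
  then show False using w_fail[OF _ b] kill_c by blast
qed

text \<open>From \<open>theta\<close> on, the five toggles following the white step of round n all
  succeed, so every element of R is transported by s_a s_c s_b s_a s_c.\<close>

lemma G2_two_steps:
  assumes q: "P\<^sup>2 = 3 / 4" and th: "theta n" and R: "Rb n x y z"
  shows "Rw (Suc (Suc n)) (4 * P * y - 2 * x - 2 * P * z) (3 * y - 2 * P * x - z) (2 * y - 2 * P * x)"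
proof -
  note T = theta_step[OF th]
  have b': "\<not> Rw (Suc n) 0 1 0" using b_fails_a[OF T(3)] P34 P_pos by force
  have pp: "P * P = 3 / 4" using q by (simp add: power2_eq_square)
  have K: "Rb (Suc n) (-2) (-(2 * P)) 0" using w_succ[OF T(3) b'] by (simp add: q)
  have a: "\<not> Rb (Suc n) 1 0 0" using a_fails_False[OF K] P_pos by auto
  have c: "\<not> Rb (Suc n) 0 0 1"
  proof
    assume "Rb (Suc n) 0 0 1"
    then have "Rw (Suc (Suc n)) (-1) (-(2 * P)) 0"
      using b_step[OF K] a pp by (simp add: algebra_simps)
    then show False by (rule root_1P0_False)
  qed
  have "Rw (Suc n) (2 * P * y - x) y (y - z)" using b_step[OF R] T by (simp add: Q)
  from w_succ[OF this b'] have "Rb (Suc n) (2 * P * y - x) (2 * P * (2 * P * y - x) + (y - z) - y) (y - z)"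
    by (simp add: Q)
  also have "2 * P * (2 * P * y - x) + (y - z) - y = 3 * y - 2 * P * x - z"
    using q by (simp add: power2_eq_square algebra_simps)
  finally have "Rb (Suc n) (2 * P * y - x) (3 * y - 2 * P * x - z) (y - z)" .
  from b_step[OF this] have "Rw (Suc (Suc n)) (2 * P * (3 * y - 2 * P * x - z) - (2 * P * y - x)) (3 * y - 2 * P * x - z)
     (3 * y - 2 * P * x - z - (y - z))" using a c by (simp add: Q)
  also have "2 * P * (3 * y - 2 * P * x - z) - (2 * P * y - x) = 4 * P * y - (4 * P\<^sup>2 - 1) * x - 2 * P * z"
    by (simp add: power2_eq_square algebra_simps)
  also have "\<dots> = 4 * P * y - 2 * x - 2 * P * z" using q by simp
  also have "3 * y - 2 * P * x - z - (y - z) = 2 * y - 2 * P * x" by simp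
  finally show ?thesis .
qed

lemma strip_start:
  assumes q: "P\<^sup>2 = 3 / 4" and th: "theta n" and b: "Rw n 0 1 0"
  shows "strip (Suc (Suc n))"
  using G2_two_steps[OF q th w_fail[OF b b]] unfolding strip_def by (intro exI[of _ 1]) auto

lemma strip_step:
  assumes q: "P\<^sup>2 = 3 / 4" and th: "theta n" and s: "strip n"
  shows "strip (Suc (Suc n))"
proof -
  obtain k where k: "0 < k" "Rw n (4 * k * P) (4 * k - 1) (2 * k)" using s strip_def by blast
  have "2 * P * (4 * k * P) + 2 * Q * (2 * k) - (4 * k - 1) = 8 * k * P\<^sup>2 - 2 * k + 1"
    by (simp add: power2_eq_square algebra_simps Q)
  then have e: "2 * P * (4 * k * P) + 2 * Q * (2 * k) - (4 * k - 1) = 4 * k + 1" using q by simp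
  have R: "Rb n (4 * k * P) (4 * k + 1) (2 * k)"
    using w_succ[OF k(2) strip_b_succeeds[OF q th s]] unfolding e .
  have "4 * P * (4 * k + 1) - 2 * (4 * k * P) - 2 * P * (2 * k) = 4 * (k + 1) * P" by (simp add: algebra_simps)
  moreover have "2 * P * (4 * k * P) = 8 * k * P\<^sup>2" by (simp add: power2_eq_square)
  then have "3 * (4 * k + 1) - 2 * P * (4 * k * P) - 2 * k = 4 * (k + 1) - 1"
    "2 * (4 * k + 1) - 2 * P * (4 * k * P) = 2 * (k + 1)" using q by simp_all
  ultimately have "Rw (Suc (Suc n)) (4 * (k + 1) * P) (4 * (k + 1) - 1) (2 * (k + 1))"
    using G2_two_steps[OF q th R] by (simp only:)
  then show ?thesis unfolding strip_def using k by (intro exI[of _ "k + 1"]) auto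
qed

text \<open>G is an invariant ensuring that b succeeds at \<open>theta\<close>. One round then leads
  to the dihedral wall of index 2 and \<open>narrow_phase\<close> leads back, p/2 - 1 rounds after
  the start, with amplitudes (u', u) in place of (u, v).\<close>

lemma theta_cycle_False:
  assumes p: "6 \<le> p" "P = cos (pi / real p)" and th: "theta n0" and G: "G n0"
    and step: "\<And>n. theta n \<Longrightarrow> G n \<Longrightarrow>
      \<not> Rw n 0 1 0 \<and> (\<forall>n'. 2 * n' + 2 = 2 * n + p \<longrightarrow> G n')"
  shows False
proof -
  have V: "dcoeff p 2 = 2 * P" "dcoeff p (Suc 2) = 4 * P\<^sup>2 - 1" "dcoeff p 3 = 4 * P\<^sup>2 - 1"
    using p by (simp_all add: numeral_2_eq_2 numeral_3_eq_3 dcoeff_2 dcoeff_3)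
  obtain fa fb fc K where f: "fa n0 = 0" "fb n0 = 1" "fc n0 = -1" "\<And>n. n0 \<le> n \<Longrightarrow> fb n \<le> K"
    and ev: "path_evolution P Q Rw Rb n0 fa fb fc" using evolution[of n0 0 1 "-1"] by blast
  define S where "S u v \<longleftrightarrow> (\<exists>n\<ge>n0. theta n \<and> G n \<and> 0 \<le> v \<and>
     fa n = -(2 * P) * v \<and> fb n = v + u \<and> fc n = -u)" for u v
  show False
  proof (rule linear_growth_unbounded[of S K])
    show "S 1 0" unfolding S_def using f th G by auto
    show "a \<le> K" if "S a b" for a b using that f(4) unfolding S_def by force
  next
    fix a b :: real assume S: "S a b" and ab: "0 \<le> b" "b < a"
    obtain n where n: "n0 \<le> n" "theta n" "G n" "fa n = -(2 * P) * b" "fb n = b + a" "fc n = -a"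
      using S unfolding S_def by blast
    note T = theta_step[OF n(2)]
    have b: "\<not> Rw n 0 1 0" using step n by blast
    note E = path_evolutionD[OF ev n(1) refl refl refl]
    have fa: "fa (Suc n) = - dcoeff p 2 * a"
      using b T by (simp add: E V n algebra_simps)
    have fb: "fb (Suc n) = dcoeff p (Suc 2) * a"
      using b T unfolding E V n by (simp add: Q algebra_simps power2_eq_square)
    have fc: "- b \<le> fc (Suc n)" using b T by (simp add: E n Q)
    have R: "Rw (Suc n) (- dcoeff p (Suc 2)) (- dcoeff p 2) 0"
      using T(3) by (simp add: V)
    obtain n' u' where n': "2 * n' + 2 + 2 = 2 * Suc n + p" "Suc n < n'" "theta n'"
       "fa n' = -(2 * P) * a" "fb n' = a + u'" "fc n' = -u'" "2 * a - b \<le> u'"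
      using narrow_phase[OF p ev, of a "Suc n" 2 b, OF _ R _ _ _ fa fb fc] ab n(1) p by auto
    then have "S u' a" unfolding S_def using step[OF n(2,3)] n(1) ab by (intro exI[of _ n']) auto
    then show "\<exists>a'. S a' a \<and> 2 * a - b \<le> a'" using n' by blast
  qed
qed

lemma theta_False:
  assumes th: "theta n" and "P < 1"
  shows False
  using cos_P P34
proof (cases rule: narrow_cos_cases)
  case 2
  show ?thesis
  \<comment> \<open>After a failure at \<open>theta\<close>, the invariant \<open>strip\<close>
    holds from two rounds later on and rules out another one; if no failure ever occurs, the trivial
    invariant is enough.\<close>
  proof (cases "\<exists>n. theta n \<and> Rw n 0 1 0")
    case True
    then obtain m where m: "theta m" "Rw m 0 1 0" by blast
    have "theta (Suc (Suc m))"
    proof -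
      have "4 * P * (-(2 * P)) - 2 * (-1) - 2 * P * (-(2 * P)) = 2 - 4 * P\<^sup>2"
        by (simp add: power2_eq_square)
      then have e: "4 * P * (-(2 * P)) - 2 * (-1) - 2 * P * (-(2 * P)) = -1" using 2(1) by simp
      show ?thesis
        using G2_two_steps[OF 2(1) m(1) w_fail[OF m]] unfolding e by simp
    qed
    then show False
    proof (rule theta_cycle_False[of 6 "Suc (Suc m)" strip, rotated 2])
      show "strip (Suc (Suc m))" by (rule strip_start[OF 2(1) m])
    next
      fix n' assume t: "theta n'" "strip n'"
      have "2 * k + 2 = 2 * n' + 6 \<Longrightarrow> k = Suc (Suc n')" for k by simp
      then show "\<not> Rw n' 0 1 0 \<and> (\<forall>k. 2 * k + 2 = 2 * n' + 6 \<longrightarrow> strip k)"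
        using strip_b_succeeds[OF 2(1) t] strip_step[OF 2(1) t] by blast
    qed (use 2 in auto)
  next
    case False
    then show ?thesis
      using theta_cycle_False[of 6 n "\<lambda>_. True"] th 2 by auto
  qed
next
  case (3 p)
  show ?thesis
    by (rule theta_cycle_False[of p n "\<lambda>_. True"]) (use 3 th theta_b_succeeds_of_large in auto)
qed (use \<open>P < 1\<close> in simp)

lemma dihedral_root_False:
  assumes D: "dihedral_root P x y" "(x, y) \<noteq> (1, 0)" and R: "Rw n (-x) (-y) 0"
  shows False
proof -
  have P1: "P < 1" using D(1) by (rule dihedral_root_less_1)
  obtain p j where p: "3 \<le> p" "P = cos (pi / real p)" and j: "j < p" "x = dcoeff p (Suc j)" "y = dcoeff p j"
    using D unfolding dihedral_root_def by blast
  have p6: "6 \<le> p"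
  proof (rule ccontr)
    assume "\<not> 6 \<le> p"
    then have "P < cos (pi / real 6)" using p by (auto intro!: cos_monotone_0_pi simp: field_simps)
    then have "P\<^sup>2 < (cos (pi / real 6))\<^sup>2" using P_pos by (intro power_strict_mono) auto
    also have "\<dots> = 3 / 4" by (simp add: cos_30 power_divide)
    finally show False using P34 by simp
  qed
  have j0: "0 < j" using D(2) j p by (cases j) auto
  obtain fa fb fc K where f: "fa n = 0" "fb n = 0" "fc n = 0"
    and ev: "path_evolution P Q Rw Rb n fa fb fc" using evolution[of n 0 0 0] by blast
  show False
    using narrow_phase[OF p6 p(2) ev, of 0 n j 0] R j j0 f theta_False P1 by auto
qed

lemma narrow_False: False
proof -
  have PQ3: "1 \<le> P\<^sup>2 + Q\<^sup>2" using P34 by (simp add: Q power2_eq_square)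
  have P0: "P \<noteq> 0" using P_pos by simp
  note D = dihedral_root_simple[OF cos_P P0]
  have D': "P < 1 \<Longrightarrow> dihedral_root P (4 * P\<^sup>2 - 1) (2 * P)"
    using dihedral_root_refl'[OF D(3)] P0 by (simp add: power2_eq_square)
  \<comment> \<open>\<open>narrow_phase\<close> does not cover index 0. The first round leads to the
    dihedral root of index 2 if c fails, and to the root of \<open>kappa_False\<close> if it
    succeeds.\<close>
  have a: False if R: "Rw 0 (-1) 0 0"
  proof (cases "P < 1")
    case True
    have b: "\<not> Rw 0 0 1 0" using kill_a_w[OF R] by blast
    have Rb: "Rb 0 (-1) (-(2 * P)) 0" using w_succ[OF R b] by simp
    have a: "\<not> Rb 0 1 0 0" using a_fails_False[OF Rb] P_pos by auto
    show ?thesis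
    proof (cases "Rb 0 0 0 1")
      case c: True
      have "Rw 1 (-(4 * P\<^sup>2 - 1)) (-(2 * P)) 0" using b_step[OF Rb] a c by (simp add: power2_eq_square algebra_simps)
      then show ?thesis using dihedral_root_False[OF D'] True P0 by auto
    next
      case c: False
      have "Rw 1 (-(4 * P\<^sup>2 - 1)) (-(2 * P)) (-(2 * P))" using b_step[OF Rb] a c by (simp add: Q power2_eq_square algebra_simps)
      then show ?thesis by (rule kappa_False)
    qed
  next
    case False
    then show ?thesis using dom_b[of 0 1 0 0] that kill_a_w[of 0] by auto
  qed
  have c: False if R: "Rw 0 0 0 (-1)"
  proof -
    have b: "\<not> Rw 0 0 1 0" using w_fail[OF R] kill_c by blast
    have Rb: "Rb 0 0 (-1) (-1)" using w_succ[OF R b] by (simp add: Q)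
    have "Rw 1 0 (-1) 0 \<or> \<not> Rb 0 1 0 0 \<and> Rw 1 (-(2 * P)) (-1) 0"
      using b_step[OF Rb] b_step[OF b_lower_c[of 0 0 1 1]] Rb
      by (cases "Rb 0 0 0 1"; cases "Rb 0 1 0 0") (simp_all add: Q)
    then have "\<not> Rb 0 1 0 0" "Rw 1 (-(2 * P)) (-1) 0" using kill_b by auto
    moreover from this have "P < 1" using dom_a[of 0 0 1 1] Rb by force
    ultimately show False using dihedral_root_False[OF D(4)] by auto
  qed
  have "\<exists>x y z. narrow_root P x y z \<and> 0 \<le> x \<and> 0 \<le> y \<and> 0 \<le> z \<and> Rw 0 (-x) (-y) (-z)"
  proof (rule start)
    fix x y z assume "narrow_root P x y z" "(x, y, z) \<noteq> (1, 0, 0)" "-1 < x - P * y"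
    then show "narrow_root P (2 * P * y - x) y z" using narrow_root_refl_a cos_P P34 by blast
  next
    fix x y z assume "narrow_root P x y z" "(x, y, z) \<noteq> (0, 1, 0)" "-1 < y - P * x - Q * z"
    then show "narrow_root P x (2 * P * x + 2 * Q * z - y) z"
      unfolding Q using narrow_root_refl_b cos_P P34 by blast
  next
    fix x y z assume "narrow_root P x y z" "(x, y, z) \<noteq> (0, 0, 1)" "-1 < z - Q * y"
    then show "narrow_root P x y (2 * Q * y - z)"
      unfolding Q using narrow_root_refl_c cos_P P34 by blast
  qed (simp_all add: narrow_root_def)
  then obtain x y z where E: "narrow_root P x y z" and R: "Rw 0 (-x) (-y) (-z)" by blast
  show False
    using E
  proof (cases rule: narrow_root_cases)
    case 5
    then show ?thesis using dihedral_root_False[of x y 0] R a by (cases "(x, y) = (1, 0)") auto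
  next
    case 9
    then show ?thesis using G2_root_False R by auto
  next
    case 6
    then show ?thesis using long_root_False[OF _ PQ3, of 0] R by (simp add: Q)
  next
    case 1
    then show ?thesis using a R by simp
  next
    case 2
    then show ?thesis using kill_b R by simp
  next
    case 3
    then show ?thesis using c R by simp
  next
    case 4
    then show ?thesis using root_011_False[of 0] R by simp
  next
    case 7
    then show ?thesis using theta_False[of 0] R by simp
  next
    case 8
    then show ?thesis using kappa_False[of 0] R by simp
  qed
qed

end

text \<open>Outside finite type a missing edge forces the other value to be 1. Otherwise one label
  is 3 and the other at least 6, or both are at least 4.\<close>

lemma (in path_game) path_game_False: False
proof -
  interpret sw: path_game Q P "\<lambda>x y z. root z y x" "\<lambda>n x y z. Rw n z y x" "\<lambda>n x y z. Rb n z y x"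
    by (rule swap)
  have c: "C = 0 \<or> C = 1 / 2 \<or> 1 / 2 \<le> C\<^sup>2 \<and> C \<le> 1" if "coxeter_cos C" for C
    using that
  proof (cases rule: coxeter_cos_cases)
    case (4 p)
    have "cos (pi / real 4) \<le> C" unfolding 4 using 4(1) by (intro cos_pi_div_mono) auto
    then have "(cos (pi / real 4))\<^sup>2 \<le> C\<^sup>2" by (intro power_mono) (auto simp: cos_45)
    then show ?thesis using coxeter_cos_bounds[OF that] by (simp add: cos_45 power_divide)
  next
    case 3
    have "C\<^sup>2 = 1 / 2" unfolding 3 by (simp add: power_divide)
    then show ?thesis using coxeter_cos_bounds[OF that] by simp
  qed auto
  show False
  proof (cases "P\<^sup>2 + Q\<^sup>2 < 1")
    case True
    then show ?thesis by (rule finite_type_False)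
  next
    case False
    note PQ = PQ_bounds
    have sq: "1 \<le> C\<^sup>2 \<Longrightarrow> 0 \<le> C \<Longrightarrow> C \<le> 1 \<Longrightarrow> C = 1" for C :: real
      using abs_le_square_iff[of 1 C] by auto
    consider "Q = 0" | "P = 0" | "Q = 1 / 2" | "P = 1 / 2" | "1 / 2 \<le> P\<^sup>2" "1 / 2 \<le> Q\<^sup>2"
      using c[OF cos_P] c[OF cos_Q] by blast
    then show ?thesis
    proof cases
      case 1
      then show ?thesis using infinite_dihedral_False sq[of P] False PQ by simp
    next
      case 2
      then show ?thesis using sw.infinite_dihedral_False sq[of Q] False PQ by simp
    next
      case 3
      interpret n: narrow_path_game P Q root Rw Rb
      proof unfold_locales
        have "Q\<^sup>2 = 1 / 4" unfolding 3 by (simp add: power2_eq_square)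
        then show "3 / 4 \<le> P\<^sup>2" using False by simp
      qed (rule 3)
      show ?thesis by (rule n.narrow_False)
    next
      case 4
      interpret n: narrow_path_game Q P "\<lambda>x y z. root z y x" "\<lambda>n x y z. Rw n z y x" "\<lambda>n x y z. Rb n z y x"
      proof unfold_locales
        have "P\<^sup>2 = 1 / 4" unfolding 4 by (simp add: power2_eq_square)
        then show "3 / 4 \<le> Q\<^sup>2" using False by simp
      qed (rule 4)
      show ?thesis by (rule n.narrow_False)
    next
      case 5
      then show ?thesis by (rule wide_False)
    qed
  qed
qed


section \<open>Walks in rank 3\<close>

text \<open>The coordinates at time \<open>t\<close> refer to the letters toggled at times \<open>t\<close>, \<open>t + 1\<close>, \<open>t + 2\<close>, in this order, so that
  they rotate at every step; \<open>c t\<close> is \<open>- B\<close> of the simple roots of the letters toggled at \<open>t\<close> and \<open>t + 1\<close>.\<close>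

definition cox_evolution ::
  "(nat \<Rightarrow> real) \<Rightarrow> (nat \<Rightarrow> real \<Rightarrow> real \<Rightarrow> real \<Rightarrow> bool) \<Rightarrow> nat
    \<Rightarrow> (nat \<Rightarrow> real) \<Rightarrow> (nat \<Rightarrow> real) \<Rightarrow> (nat \<Rightarrow> real) \<Rightarrow> bool" where
  "cox_evolution c R t0 f g h \<longleftrightarrow> (\<forall>t\<ge>t0. let a = (if R t 1 0 0 then 0 else f t)
     in f (Suc t) = g t + 2 * c t * a \<and> g (Suc t) = h t + 2 * c (Suc (Suc t)) * a \<and> h (Suc t) = f t - 2 * a)"

lemma cox_evolutionD:
  assumes "cox_evolution c R t0 f g h" "t0 \<le> t" and a: "a = (if R t 1 0 0 then 0 else f t)"
  shows "f (Suc t) = g t + 2 * c t * a" "g (Suc t) = h t + 2 * c (Suc (Suc t)) * a" "h (Suc t) = f t - 2 * a"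
  using assms(1)[unfolded cox_evolution_def Let_def, rule_format, OF assms(2)] unfolding a by auto

text \<open>The rules of \<open>path_game\<close> with one letter per step. \<open>step\<close>,
  \<open>kill\<close> and \<open>dom\<close> need to mention only the first coordinate, since the
  rotation brings each letter there when its turn comes.\<close>

locale cox_game =
  fixes c :: "nat \<Rightarrow> real" and root R :: "nat \<Rightarrow> real \<Rightarrow> real \<Rightarrow> real \<Rightarrow> bool"
  assumes c_cos: "coxeter_cos (c t)" and c_per: "c (Suc (Suc (Suc t))) = c t"
    and R_root: "R t x y z \<Longrightarrow> root t x y z"
    and root_rot: "root (Suc t) y z x \<longleftrightarrow> root t x y z"
    and root_sign: "root t x y z \<Longrightarrow> 0 \<le> x \<and> 0 \<le> y \<and> 0 \<le> z \<or> x \<le> 0 \<and> y \<le> 0 \<and> z \<le> 0"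
    and root_norm: "root t x y z \<Longrightarrow>
      x\<^sup>2 + y\<^sup>2 + z\<^sup>2 - 2 * c t * x * y - 2 * c (Suc t) * y * z - 2 * c (Suc (Suc t)) * x * z = 1"
    and root_unit: "root t (-1) 0 0"
    and root_refl: "root t x y z \<Longrightarrow> root t (2 * c t * y + 2 * c (Suc (Suc t)) * z - x) y z"
    and step: "R (Suc t) y z (if R t 1 0 0 then x else 2 * c t * y + 2 * c (Suc (Suc t)) * z - x) \<longleftrightarrow> R t x y z"
    and kill: "\<not> R t (-1) 0 0"
    and cone: "R t x1 y1 z1 \<Longrightarrow> R t x2 y2 z2 \<Longrightarrow> R t x3 y3 z3 \<Longrightarrow> 0 \<le> k1 \<Longrightarrow> 0 \<le> k2 \<Longrightarrow> 0 \<le> k3 \<Longrightarrow>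
      x = k1 * x1 + k2 * x2 + k3 * x3 \<Longrightarrow> y = k1 * y1 + k2 * y2 + k3 * y3 \<Longrightarrow> z = k1 * z1 + k2 * z2 + k3 * z3 \<Longrightarrow>
      root t x y z \<Longrightarrow> R t x y z"
    and dom: "R t (-x) (-y) (-z) \<Longrightarrow> 0 \<le> x \<Longrightarrow> 0 \<le> y \<Longrightarrow> 0 \<le> z \<Longrightarrow>
      x - c t * y - c (Suc (Suc t)) * z \<le> -1 \<Longrightarrow> R t 1 0 0"
    and evolution: "\<exists>f g h K. f t0 = u \<and> g t0 = v \<and> h t0 = w \<and> (\<forall>t\<ge>t0. f t \<le> K) \<and> cox_evolution c R t0 f g h"
    and start: "E 1 0 0 \<Longrightarrow> E 0 1 0 \<Longrightarrow> E 0 0 1 \<Longrightarrow>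
      (\<And>x y z. E x y z \<Longrightarrow> (x, y, z) \<noteq> (1, 0, 0) \<Longrightarrow> -1 < x - c t * y - c (Suc (Suc t)) * z \<Longrightarrow>
        E (2 * c t * y + 2 * c (Suc (Suc t)) * z - x) y z) \<Longrightarrow>
      (\<And>x y z. E x y z \<Longrightarrow> (x, y, z) \<noteq> (0, 1, 0) \<Longrightarrow> -1 < y - c (Suc t) * z - c t * x \<Longrightarrow>
        E x (2 * c (Suc t) * z + 2 * c t * x - y) z) \<Longrightarrow>
      (\<And>x y z. E x y z \<Longrightarrow> (x, y, z) \<noteq> (0, 0, 1) \<Longrightarrow> -1 < z - c (Suc (Suc t)) * x - c (Suc t) * y \<Longrightarrow>
        E x y (2 * c (Suc (Suc t)) * x + 2 * c (Suc t) * y - z)) \<Longrightarrow>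
      \<exists>x y z. E x y z \<and> 0 \<le> x \<and> 0 \<le> y \<and> 0 \<le> z \<and> R t (-x) (-y) (-z)"
begin

lemma root_unit2: "root t 0 (-1) 0"
  using root_unit[of "Suc t"] root_rot by blast

lemma root_unit3: "root t 0 0 (-1)"
  using root_unit2[of "Suc t"] root_rot by blast

lemma R_succ: "R t x y z \<Longrightarrow> \<not> R t 1 0 0 \<Longrightarrow> R (Suc t) y z (2 * c t * y + 2 * c (Suc (Suc t)) * z - x)"
  using step[of t y z x] by simp

lemma R_fail: "R t x y z \<Longrightarrow> R t 1 0 0 \<Longrightarrow> R (Suc t) y z x"
  using step[of t y z x] by simp

lemma fail_2:
  assumes "R t (-x) (-y) 0" "0 \<le> x" "0 < y" "R t 1 0 0" shows False
proof -
  have "R t 0 (-1) 0"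
    by (rule cone[OF assms(1) assms(4) assms(4), where ?k1.0 = "1 / y" and ?k2.0 = "x / y" and ?k3.0 = 0])
      (use assms root_unit2 in auto)
  then show False using R_fail[OF _ assms(4)] kill by blast
qed

lemma fail_3:
  assumes "R t (-x) 0 (-z)" "0 \<le> x" "0 < z" "R t 1 0 0" shows "R t 0 0 (-1)"
  by (rule cone[OF assms(1) assms(4) assms(4), where ?k1.0 = "1 / z" and ?k2.0 = "x / z" and ?k3.0 = 0])
      (use assms root_unit3 in auto)

end

text \<open>If no two letters commute, the elementary roots lie in the dihedral parabolic subgroups.\<close>

definition triangle_root :: "real \<Rightarrow> real \<Rightarrow> real \<Rightarrow> real \<Rightarrow> real \<Rightarrow> real \<Rightarrow> bool" where
  "triangle_root c0 c1 c2 x y z \<longleftrightarrow> (x, y, z) \<in> {(1, 0, 0), (0, 1, 0), (0, 0, 1)} \<or>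
     dihedral_root c0 x y \<and> z = 0 \<or> dihedral_root c1 y z \<and> x = 0 \<or> dihedral_root c2 z x \<and> y = 0"

lemma triangle_root_rot: "triangle_root c0 c1 c2 x y z \<longleftrightarrow> triangle_root c1 c2 c0 y z x"
  unfolding triangle_root_def by auto

lemma triangle_root_refl:
  assumes E: "triangle_root c0 c1 c2 x y z" "(x, y, z) \<noteq> (1, 0, 0)" "-1 < x - c0 * y - c2 * z"
    and c: "coxeter_cos c0" "coxeter_cos c2" "1 / 2 \<le> c0" "1 / 2 \<le> c2"
  shows "triangle_root c0 c1 c2 (2 * c0 * y + 2 * c2 * z - x) y z"
proof -
  have c0: "c0 \<noteq> 0" "c2 \<noteq> 0" using c by auto
  consider "(x, y, z) = (0, 1, 0)" | "(x, y, z) = (0, 0, 1)" | "dihedral_root c0 x y" "z = 0"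
    | "1 \<le> y" "1 \<le> z" "x = 0" | "dihedral_root c2 z x" "y = 0"
    using E(1,2) dihedral_root_simple_or_ge_1[of c1 y z] unfolding triangle_root_def by auto
  then show ?thesis
  proof cases
    case 1
    then show ?thesis using E(3) dihedral_root_simple(4)[OF c(1) c0(1)] by (auto simp: triangle_root_def)
  next
    case 2
    then show ?thesis using E(3) dihedral_root_simple(3)[OF c(2) c0(2)] by (auto simp: triangle_root_def)
  next
    case 3
    then show ?thesis using dihedral_root_refl' E(2) by (auto simp: triangle_root_def)
  next
    case 4
    have "1 / 2 * 1 \<le> c0 * y" "1 / 2 * 1 \<le> c2 * z" by (rule mult_mono; use c 4 in simp)+
    then show ?thesis using E(3) 4 by simp
  next
    case 5
    then show ?thesis using dihedral_root_refl[of c2 z x] E(2) by (auto simp: triangle_root_def)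
  qed
qed

context cox_game begin

context
  assumes half: "\<And>t. 1 / 2 \<le> c t"
begin

lemma dom_complete:
  assumes "R t 0 (-y) (-z)" "1 \<le> y" "1 \<le> z" shows "R t 1 0 0"
proof -
  have "1 / 2 * 1 \<le> c t * y" "1 / 2 * 1 \<le> c (Suc (Suc t)) * z"
    by (rule mult_mono; use half[of t] half[of "Suc (Suc t)"] assms in simp)+
  then show ?thesis using dom[of t 0 y z] assms by simp
qed

text \<open>The wall lies in the dihedral subgroup of the letters toggled at t and t + 1. Both
  toggles succeed and the third is forced to fail, so three steps raise i by 2. At i = p - 3 the
  wall becomes the simple root of the letter toggled second next, the case i = 0 of the
  hypothesis.\<close>

lemma triangle_phase:
  assumes p: "3 \<le> p" and ev: "cox_evolution c R t0 f g h" and u: "0 \<le> u"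
  shows "c t = cos (pi / real p) \<Longrightarrow> R t (- dcoeff p i) (- dcoeff p (Suc i)) 0 \<Longrightarrow> i < p \<Longrightarrow> t0 \<le> t \<Longrightarrow>
    f t = dcoeff p (Suc i) * u \<Longrightarrow> g t = - dcoeff p i * u \<Longrightarrow> - v \<le> h t \<Longrightarrow>
    \<exists>t'\<ge>t0. \<exists>u'. R t' 0 (-1) 0 \<and> f t' = u' \<and> g t' = 0 \<and> h t' = -u \<and> 2 * u - v \<le> u'"
proof (induction "p - i" arbitrary: t i rule: less_induct)
  case less
  let ?V = "dcoeff p"
  note P = less.prems(1) and R = less.prems(2) and i = less.prems(3) and t = less.prems(4) and f = less.prems(5-7)
  have p2: "2 \<le> p" using p by simp
  note V1 = dcoeff_last(1)[OF p] and V2 = dcoeff_last(2)[OF p, folded P]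
  have Vnn: "i \<le> p \<Longrightarrow> 0 \<le> ?V i" for i using dcoeff_nonneg p2 by blast
  have V1': "0 < i \<Longrightarrow> i < p \<Longrightarrow> 1 \<le> ?V i" for i using dcoeff_ge_1 p2 by blast
  have rec: "?V (Suc (Suc i)) = 2 * c t * ?V (Suc i) - ?V i" for i using dcoeff_rec P by simp
  have "Suc i \<noteq> p"
  proof
    assume e: "Suc i = p"
    then have "i = p - Suc 0" by simp
    then show False using R kill V1 e p2 by auto
  qed
  then have i1: "Suc i < p" using i by simp
  have s0: "\<not> R t 1 0 0" using fail_2[OF R] V1'[of "Suc i"] Vnn[of i] i1 by fastforce
  have R1: "R (Suc t) (- ?V (Suc i)) 0 (- ?V (Suc (Suc i)))"
    using R_succ[OF R s0] by (simp add: rec)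
  have "Suc (Suc i) \<noteq> p"
  proof
    assume e: "Suc (Suc i) = p"
    then have "Suc i = p - Suc 0" by simp
    then show False using R1 kill V1 e p2 by auto
  qed
  then have i2: "Suc (Suc i) < p" using i1 by simp
  \<comment> \<open>A failure here would make the simple root of the letter toggled at t a wall. The
    third letter is forced to fail as well, so this wall would be crossed right afterwards.\<close>
  have s1: "\<not> R (Suc t) 1 0 0"
  proof
    assume s1: "R (Suc t) 1 0 0"
    have a: "R (Suc (Suc t)) 0 (-1) 0"
      using R_fail[OF fail_3[OF R1 _ _ s1] s1] V1'[of "Suc (Suc i)"] Vnn i2 by simp
    have "R (Suc (Suc t)) 0 (- ?V (Suc (Suc i))) (- ?V (Suc i))" using R_fail[OF R1 s1] .
    then have "R (Suc (Suc t)) 1 0 0" using dom_complete V1' i2 by simp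
    then show False using R_fail[OF a] kill by blast
  qed
  have R2: "R (Suc (Suc t)) 0 (- ?V (Suc (Suc i))) (- ?V (Suc (Suc (Suc i))))"
    using R_succ[OF R1 s1] by (simp add: c_per rec[of "Suc i"])
  note E0 = cox_evolutionD[OF ev t refl] and E1 = cox_evolutionD[OF ev le_SucI[OF t] refl]
    and E2 = cox_evolutionD[OF ev le_SucI[OF le_SucI[OF t]] refl]
  have f1: "f (Suc t) = ?V (Suc (Suc i)) * u" using s0 by (simp add: E0 f rec algebra_simps)
  have g1: "g (Suc t) = h t + 2 * c (Suc (Suc t)) * (?V (Suc i) * u)" using s0 by (simp add: E0 f)
  have h1: "h (Suc t) = - ?V (Suc i) * u" using s0 by (simp add: E0 f)
  have f2: "f (Suc (Suc t)) = h t + 2 * c (Suc (Suc t)) * (?V (Suc i) * u) + 2 * c (Suc t) * (?V (Suc (Suc i)) * u)"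
    using s1 by (simp add: E1 f1 g1)
  have g2: "g (Suc (Suc t)) = ?V (Suc (Suc (Suc i))) * u"
    using s1 by (simp add: E1 f1 h1 c_per rec[of "Suc i"] algebra_simps)
  have h2: "h (Suc (Suc t)) = - ?V (Suc (Suc i)) * u" using s1 by (simp add: E1 f1)
  show ?case
  proof (cases "Suc (Suc (Suc i)) = p")
    case True
    then have "Suc i = p - Suc (Suc 0)" "Suc (Suc i) = p - Suc 0" by auto
    then have VV: "?V (Suc i) = 2 * c t" "?V (Suc (Suc i)) = 1" "?V (Suc (Suc (Suc i))) = 0"
      using V1 V2 True p2 by auto
    \<comment> \<open>The two terms gained in \<open>f2\<close> are 4 c (t + 2) c t u and 2 c (t +
      1) u; since every c is at least 1/2, each is at least u.\<close>
    have "1 / 2 * (1 / 2) \<le> c (Suc (Suc t)) * c t"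
      by (rule mult_mono) (use half coxeter_cos_bounds[OF c_cos] in auto)
    then have "1 * u \<le> (4 * (c (Suc (Suc t)) * c t)) * u" using u by (intro mult_right_mono) auto
    moreover have "1 * u \<le> (2 * c (Suc t)) * u" using u half[of "Suc t"] by (intro mult_right_mono) auto
    ultimately have "2 * u - v \<le> f (Suc (Suc t))" unfolding f2 VV using f(3) by (simp add: algebra_simps)
    then show ?thesis using R2 t unfolding VV
      by (intro exI[of _ "Suc (Suc t)"] conjI exI[of _ "f (Suc (Suc t))"]) (auto simp: g2 h2 VV)
  next
    case False
    then have i3: "Suc (Suc (Suc i)) < p" using i2 by simp
    have s2: "R (Suc (Suc t)) 1 0 0" using dom_complete[OF R2] V1' i3 by simp
    have R3: "R (Suc (Suc (Suc t))) (- ?V (Suc (Suc i))) (- ?V (Suc (Suc (Suc i)))) 0" using R_fail[OF R2 s2] .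
    have "0 \<le> 2 * c (Suc (Suc t)) * (?V (Suc i) * u)" "0 \<le> 2 * c (Suc t) * (?V (Suc (Suc i)) * u)"
      using half[of "Suc t"] half[of "Suc (Suc t)"] Vnn[of "Suc i"] Vnn[of "Suc (Suc i)"] i2 u by auto
    moreover have "h (Suc (Suc (Suc t))) = f (Suc (Suc t))" using s2 by (simp add: E2)
    ultimately have h3: "- v \<le> h (Suc (Suc (Suc t)))" using f(3) f2 by linarith
    show ?thesis
      using less.hyps[of "Suc (Suc i)" "Suc (Suc (Suc t))", OF _ _ R3 i2 _ _ _ h3] i2 t P s2
      by (simp add: c_per E2 g2 h2)
  qed
qed

text \<open>\<open>triangle_phase\<close> started at index 0 returns to the same position with (u',
  u) for (u, v), so the amplitudes grow linearly.\<close>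

lemma simple_2_False: "R t0 0 (-1) 0 \<Longrightarrow> False"
proof -
  assume R: "R t0 0 (-1) 0"
  obtain f g h K where f: "f t0 = 1" "g t0 = 0" "h t0 = 0" "\<And>t. t0 \<le> t \<Longrightarrow> f t \<le> K"
    and ev: "cox_evolution c R t0 f g h" using evolution[of t0 1 0 0] by blast
  define S where "S u v \<longleftrightarrow> (\<exists>t\<ge>t0. R t 0 (-1) 0 \<and> f t = u \<and> g t = 0 \<and> h t = -v)" for u v
  show False
  proof (rule linear_growth_unbounded[of S K])
    show "S 1 0" unfolding S_def using f R by auto
    show "a \<le> K" if "S a b" for a b using that f(4) unfolding S_def by force
  next
    fix a b :: real assume S: "S a b" and ab: "0 \<le> b" "b < a"
    obtain t where t: "t0 \<le> t" "R t 0 (-1) 0" "f t = a" "g t = 0" "h t = -b"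
      using S unfolding S_def by blast
    have "c t \<noteq> 1"
    proof
      assume "c t = 1"
      then have "R t 1 0 0" using dom[of t 0 1 0] t by simp
      then show False using R_fail[OF t(2)] kill by blast
    qed
    moreover have "c t \<noteq> 0" using half[of t] by auto
    ultimately obtain p where p: "3 \<le> p" "c t = cos (pi / real p)"
      using coxeter_cos_infinite_or_finite[OF c_cos] by blast
    have "\<exists>t'\<ge>t0. \<exists>u'. R t' 0 (-1) 0 \<and> f t' = u' \<and> g t' = 0 \<and> h t' = -a \<and> 2 * a - b \<le> u'"
      using triangle_phase[OF p(1) ev _ p(2), of a 0 b] p t ab by simp
    then show "\<exists>a'. S a' a \<and> 2 * a - b \<le> a'" unfolding S_def by blast
  qed
qed

lemma dihedral_12_False:
  assumes "R t (-x) (-y) 0" "dihedral_root (c t) x y" shows False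
proof -
  obtain p i where p: "3 \<le> p" "c t = cos (pi / real p)" and i: "i < p" "y = dcoeff p (Suc i)" "x = dcoeff p i"
    using dihedral_root_swap[OF assms(2)] unfolding dihedral_root_def by blast
  obtain f g h K where f: "f t = 0" "g t = 0" "h t = 0"
    and ev: "cox_evolution c R t f g h" using evolution[of t 0 0 0] by blast
  show False
    using triangle_phase[OF p(1) ev _ p(2), of 0 i 0] assms(1) i f simple_2_False by auto
qed

lemma dihedral_23_False:
  assumes "R t 0 (-y) (-z)" "dihedral_root (c (Suc t)) y z" "1 \<le> y" "1 \<le> z" shows False
  using R_fail[OF assms(1) dom_complete[OF assms(1,3,4)]] dihedral_12_False assms(2) by blast

lemma simple_3_False:
  assumes R: "R t 0 0 (-1)" shows False
proof (cases "R t 1 0 0")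
  case True
  then show ?thesis using R_fail[OF R] simple_2_False by blast
next
  case False
  have h: "1 / 2 \<le> c (Suc (Suc t))" by (rule half)
  then have "dihedral_root (c (Suc (Suc t))) 1 (2 * c (Suc (Suc t)))"
    using dihedral_root_simple(3)[OF c_cos, of "Suc (Suc t)"] dom[of t 0 0 1] R False by force
  then show ?thesis using dihedral_23_False[of "Suc t" 1 "2 * c (Suc (Suc t))"] R_succ[OF R False] h by simp
qed

lemma dihedral_13_False:
  assumes R: "R t (-x) 0 (-z)" and D: "dihedral_root (c (Suc (Suc t))) z x" and xz: "1 \<le> x" "1 \<le> z" shows False
proof (cases "R t 1 0 0")
  case True
  then show ?thesis using fail_3[OF R] xz simple_3_False by auto
next
  case False
  define w where "w = 2 * c (Suc (Suc t)) * z - x"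
  have D': "dihedral_root (c (Suc (Suc t))) z w"
    unfolding w_def using D xz by (intro dihedral_root_refl) auto
  have R': "R (Suc t) 0 (-z) (-w)" using R_succ[OF R False] by (simp add: w_def)
  consider "z = 1" "w = 0" | "1 \<le> z" "1 \<le> w" using dihedral_root_simple_or_ge_1[OF D'] xz by auto
  then show ?thesis
  proof cases
    case 1
    then show ?thesis using R' simple_2_False by simp
  next
    case 2
    then show ?thesis using dihedral_23_False[OF R'] D' by blast
  qed
qed

lemma triangle_False: False
proof -
  have c0: "c t \<noteq> 0" for t using half[of t] by auto
  let ?E = "triangle_root (c 0) (c (Suc 0)) (c (Suc (Suc 0)))"
  have "\<exists>x y z. ?E x y z \<and> 0 \<le> x \<and> 0 \<le> y \<and> 0 \<le> z \<and> R 0 (-x) (-y) (-z)"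
  proof (rule start)
    fix x y z assume "?E x y z" "(x, y, z) \<noteq> (1, 0, 0)" "-1 < x - c 0 * y - c (Suc (Suc 0)) * z"
    then show "?E (2 * c 0 * y + 2 * c (Suc (Suc 0)) * z - x) y z"
      using triangle_root_refl c_cos half by blast
  next
    fix x y z assume "?E x y z" "(x, y, z) \<noteq> (0, 1, 0)" "-1 < y - c (Suc 0) * z - c 0 * x"
    then show "?E x (2 * c (Suc 0) * z + 2 * c 0 * x - y) z"
      using triangle_root_refl[of "c (Suc 0)" "c (Suc (Suc 0))" "c 0" y z x] c_cos half
      by (subst triangle_root_rot) (use triangle_root_rot in blast)
  next
    fix x y z assume "?E x y z" "(x, y, z) \<noteq> (0, 0, 1)" "-1 < z - c (Suc (Suc 0)) * x - c (Suc 0) * y"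
    then show "?E x y (2 * c (Suc (Suc 0)) * x + 2 * c (Suc 0) * y - z)"
      using triangle_root_refl[of "c (Suc (Suc 0))" "c 0" "c (Suc 0)" z x y] c_cos half
      by (subst triangle_root_rot, subst triangle_root_rot) (use triangle_root_rot in blast)
  qed (auto simp: triangle_root_def)
  then obtain x y z where E: "?E x y z" and R: "R 0 (-x) (-y) (-z)" by blast
  then show False
    unfolding triangle_root_def
  proof (elim disjE conjE)
    assume "(x, y, z) \<in> {(1, 0, 0), (0, 1, 0), (0, 0, 1)}"
    then show False using R kill simple_2_False simple_3_False by auto
  next
    assume "dihedral_root (c 0) x y" "z = 0"
    then show False using R dihedral_12_False by simp
  next
    assume D: "dihedral_root (c (Suc 0)) y z" "x = 0"
    then show False using R dihedral_23_False[of 0 y z] dihedral_root_simple_or_ge_1[OF D(1)]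
      simple_2_False simple_3_False by auto
  next
    assume D: "dihedral_root (c (Suc (Suc 0))) z x" "y = 0"
    then show False using R dihedral_13_False[of 0 x z] dihedral_root_simple_or_ge_1[OF D(1)]
      kill simple_3_False by auto
  qed
qed

end

section \<open>Reduction to a Coxeter path when two letters commute\<close>

lemma shift: "cox_game (\<lambda>t. c (s + t)) (\<lambda>t. root (s + t)) (\<lambda>t. R (s + t))"
proof (unfold_locales, goal_cases)
  case (13 t0 u v w)
  obtain f g h K where "f (s + t0) = u" "g (s + t0) = v" "h (s + t0) = w" "\<forall>t\<ge>s + t0. f t \<le> K"
    "cox_evolution c R (s + t0) f g h" using evolution by blast
  then show ?case unfolding cox_evolution_def Let_def
    by (intro exI[of _ "\<lambda>t. f (s + t)"] exI[of _ "\<lambda>t. g (s + t)"] exI[of _ "\<lambda>t. h (s + t)"] exI[of _ K]) auto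
next
  case (9 t y z x)
  show ?case unfolding add_Suc_right by (rule step)
next
  case 11
  then show ?case by (rule cone)
next
  case (14 E t)
  then show ?case using start[of E "s + t"] by simp
qed (use c_cos c_per R_root root_rot root_sign root_norm root_unit root_refl step kill dom in auto)

lemma periodic: "c (3 * n + t) = c t" "root (3 * n + t) = root t"
proof (induction n)
  case (Suc n)
  have "root (Suc (Suc (Suc t))) x y z = root t x y z" for t x y z
    using root_rot[of t y z x] root_rot[of "Suc t" z x y] root_rot[of "Suc (Suc t)" x y z] by blast
  then have r: "root (Suc (Suc (Suc t))) = root t" for t by (intro ext) auto
  have e: "3 * Suc n + t = Suc (Suc (Suc (3 * n + t)))" by simp
  case 1 then show ?case unfolding e c_per using Suc by simp
  case 2 then show ?case unfolding e r using Suc by simp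
qed auto

text \<open>A vanishing entry at time \<open>1\<close> means that the last two letters commute, so each round is a white step
  (the first letter) followed by a black step.\<close>

lemma path_game_of_cox_game:
  assumes c1: "c (Suc 0) = 0"
  shows "path_game (c (Suc (Suc 0))) (c 0) (\<lambda>x y z. root 0 y z x)
    (\<lambda>n x y z. R (3 * n) y z x) (\<lambda>n x y z. R (Suc (3 * n)) z x y)"
proof -
  have c: "c (3 * n) = c 0" "c (Suc (3 * n)) = 0" "c (Suc (Suc (3 * n))) = c (Suc (Suc 0))"
    "c (Suc (Suc (Suc (3 * n)))) = c 0" "c (Suc (Suc (Suc (Suc (3 * n))))) = 0" for n
    using periodic(1)[of n 0] periodic(1)[of n 1] periodic(1)[of n 2] c_per[of "3 * n"] c_per[of "Suc (3 * n)"] c1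
    by (simp_all add: numeral_2_eq_2)
  have r: "root (3 * n) = root 0" for n using periodic(2)[of n 0] by simp
  have r1: "root (Suc (3 * n)) z x y = root 0 y z x" for n x y z
    using root_rot[of "3 * n" z x y] r by simp
  have r2: "root (Suc (Suc (3 * n))) x y z = root 0 y z x" for n x y z
    using root_rot[of "Suc (3 * n)" x y z] r1 by simp
  \<comment> \<open>The simple root of a is fixed by s_c, so the fate of the toggle at a is decided
    before the toggle at c, and the two merge into one black step.\<close>
  have a: "R (Suc (Suc (3 * n))) x 0 0 = R (Suc (3 * n)) 0 x 0" for n x
  proof -
    have e: "(if R (Suc (3 * n)) 1 0 0 then 0 else 2 * 0 * x + 2 * c 0 * 0 - 0) = 0" by simp
    show ?thesis using step[of "Suc (3 * n)" x 0 0] unfolding c e .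
  qed
  show ?thesis
  proof (unfold_locales, goal_cases)
    case (3 n x y z)
    then show ?case using R_root[of "3 * n" y z x] r by simp
  next
    case (4 n x y z)
    then show ?case using R_root[of "Suc (3 * n)" z x y] r1 by simp
  next
    case (6 x y z)
    then show ?case using root_norm[of 0 y z x] c1 by (simp add: algebra_simps)
  next
    case 7
    then show ?case using root_unit3 .
  next
    case 8
    then show ?case using root_unit .
  next
    case 9
    then show ?case using root_unit2 .
  next
    case (10 x y z)
    then show ?case using root_refl[of 2 x y z] r2[of 0 x y z] r2[of 0 _ y z] c[of 0] by (simp add: numeral_2_eq_2)
  next
    case (11 x y z)
    then show ?case using root_refl[of 0 y z x] by (simp add: add.commute)
  next
    case (12 x y z)
    then show ?case using root_refl[of 1 z x y] r1[of 0 z x y] r1[of 0 _ x y] c[of 0] by simp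
  next
    case (13 n x y z)
    then show ?case using step[of "3 * n" z x y] c[of n] by (cases "R (3 * n) 1 0 0") (simp_all add: add.commute)
  next
    case (14 n x y z)
    have 1: "R (Suc (Suc (3 * n))) x y (if R (Suc (3 * n)) 1 0 0 then z else 2 * c 0 * y - z) = R (Suc (3 * n)) z x y"
      using step[of "Suc (3 * n)" x y z, unfolded c] by (cases "R (Suc (3 * n)) 1 0 0") simp_all
    have 2: "R (Suc (Suc (Suc (3 * n)))) y z' (if R (Suc (3 * n)) 0 1 0 then x else 2 * c (Suc (Suc 0)) * y - x) =
      R (Suc (Suc (3 * n))) x y z'" for z'
      using step[of "Suc (Suc (3 * n))" y z' x, unfolded c a] by (cases "R (Suc (3 * n)) 0 1 0") simp_all
    have e: "3 * Suc n = Suc (Suc (Suc (3 * n)))" by simp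
    show ?case unfolding e 2 by (rule 1)
  next
    case (15 n) then show ?case using a[of n "-1"] kill by blast
  next
    case (18 n x1 y1 z1 x2 y2 z2 x3 y3 z3 k1 k2 k3 x y z)
    show ?case using cone[OF 18(1-6) 18(8,9,7)] 18(10) r by simp
  next
    case (19 n x1 y1 z1 x2 y2 z2 k1 k2 x y z)
    show ?case using cone[OF 19(1,2,2,3,4) order_refl, of z x y] 19(5-8) r1 by simp
  next
    case (20 n x y z)
    have 1: "R (Suc (Suc (3 * n))) (-x) (-y) (if R (Suc (3 * n)) 1 0 0 then -z else 2 * c 0 * -y - -z)"
      using iffD2[OF step[of "Suc (3 * n)" "-x" "-y" "-z"] 20(1)] unfolding c
      by (cases "R (Suc (3 * n)) 1 0 0") simp_all
    \<comment> \<open>The toggle at a comes second, so \<open>dom\<close> has to be applied to the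
      wall as changed by the toggle at c; \<open>root_sign\<close> keeps its c-coordinate
      nonnegative.\<close>
    define z' where "z' = (if R (Suc (3 * n)) 1 0 0 then z else 2 * c 0 * y - z)"
    have z': "R (Suc (Suc (3 * n))) (-x) (-y) (-z')" using 1 by (simp add: z'_def split: if_splits)
    have "x \<noteq> 0 \<or> y \<noteq> 0" using 20(5) by auto
    then have "0 \<le> z'" using root_sign[OF R_root[OF z']] 20(2,3) by auto
    then have "R (Suc (Suc (3 * n))) 1 0 0" using dom[OF z'] 20 c[of n] by simp
    then show ?case using a by blast
  next
    case (21 n x y z)
    then show ?case using dom[OF 21(1) 21(3,4,2)] c[of n] by simp
  next
    case (22 n x y z)
    then show ?case using dom[OF 22(1) 22(4,2,3)] c[of n] by simp
  next
    case (23 n0 u v w)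
    obtain f g h K where f: "f (3 * n0) = v" "g (3 * n0) = w" "h (3 * n0) = u" "\<forall>t\<ge>3 * n0. f t \<le> K"
      and ev: "cox_evolution c R (3 * n0) f g h" using evolution by blast
    have "path_evolution (c (Suc (Suc 0))) (c 0) (\<lambda>n x y z. R (3 * n) y z x) (\<lambda>n x y z. R (Suc (3 * n)) z x y) n0
      (\<lambda>n. h (3 * n)) (\<lambda>n. f (3 * n)) (\<lambda>n. g (3 * n))"
      unfolding path_evolution_def Let_def
    proof (intro allI impI)
      fix n assume "n0 \<le> n"
      then have n: "3 * n0 \<le> 3 * n" by simp
      have e: "3 * Suc n = Suc (Suc (Suc (3 * n)))" by simp
      note E0 = cox_evolutionD[OF ev n refl] and E1 = cox_evolutionD[OF ev le_SucI[OF n] refl]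
        and E2 = cox_evolutionD[OF ev le_SucI[OF le_SucI[OF n]] refl]
      show "h (3 * Suc n) = h (3 * n) + 2 * c (Suc (Suc 0)) * (if R (3 * n) 1 0 0 then 0 else f (3 * n)) -
          2 * (if R (Suc (3 * n)) 0 1 0 then 0 else h (3 * n) + 2 * c (Suc (Suc 0)) * (if R (3 * n) 1 0 0 then 0 else f (3 * n))) \<and>
        g (3 * Suc n) = g (3 * n) + 2 * c 0 * (if R (3 * n) 1 0 0 then 0 else f (3 * n)) -
          2 * (if R (Suc (3 * n)) 1 0 0 then 0 else g (3 * n) + 2 * c 0 * (if R (3 * n) 1 0 0 then 0 else f (3 * n))) \<and>
        f (3 * Suc n) = f (3 * n) - 2 * (if R (3 * n) 1 0 0 then 0 else f (3 * n)) +
          2 * c (Suc (Suc 0)) * (if R (Suc (3 * n)) 0 1 0 then 0 else h (3 * n) + 2 * c (Suc (Suc 0)) * (if R (3 * n) 1 0 0 then 0 else f (3 * n))) +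
          2 * c 0 * (if R (Suc (3 * n)) 1 0 0 then 0 else g (3 * n) + 2 * c 0 * (if R (3 * n) 1 0 0 then 0 else f (3 * n)))"
        unfolding e E2 E1 E0 c a by simp
    qed
    then show ?case using f
      by (intro exI[of _ "\<lambda>n. h (3 * n)"] exI[of _ "\<lambda>n. f (3 * n)"] exI[of _ "\<lambda>n. g (3 * n)"] exI[of _ K]) auto
  next
    case (24 E)
    have "\<exists>y z x. E x y z \<and> 0 \<le> y \<and> 0 \<le> z \<and> 0 \<le> x \<and> R 0 (-y) (-z) (-x)"
    proof (rule start[of "\<lambda>y z x. E x y z"], goal_cases)
      case (4 y z x)
      then show ?case using 24(5)[of x y z] by (auto simp: algebra_simps)
    next
      case (5 y z x)
      then show ?case using 24(6)[of x y z] c1 by auto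
    next
      case (6 y z x)
      then show ?case using 24(4)[of x y z] c1 by auto
    qed (use 24 in auto)
    then show ?case by auto
  next
    case (5 x y z)
    then show ?case using root_sign by blast
  qed (use c_cos kill in auto)
qed

theorem cox_game_False: False
proof (cases "\<exists>t. c t = 0")
  case True
  then obtain t where t: "c t = 0" by blast
  \<comment> \<open>The offset t + 2 moves the vanishing entry to time 1, because c has period
    3.\<close>
  interpret g: cox_game "\<lambda>i. c (t + 2 + i)" "\<lambda>i. root (t + 2 + i)" "\<lambda>i. R (t + 2 + i)" by (rule shift)
  have "c (t + 2 + Suc 0) = 0" using t c_per[of t] by (simp add: eval_nat_numeral)
  from g.path_game_of_cox_game[OF this] show False by (rule path_game.path_game_False)
next
  case False
  then show ?thesis using triangle_False coxeter_cos_ge_half[OF c_cos] by blast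
qed

end


section \<open>Roots of a Coxeter system\<close>

text \<open>The letter i stands at the right end, the letter that \<open>foldr reflect\<close>
  applies first.\<close>

fun altword :: "'i \<Rightarrow> 'i \<Rightarrow> nat \<Rightarrow> 'i list" where
  "altword i t 0 = []"
| "altword i t (Suc n) = altword t i n @ [i]"

lemma length_altword [simp]: "length (altword i t n) = n"
  by (induction n arbitrary: i t) auto

lemma set_altword: "set (altword i t n) \<subseteq> {i, t}"
  by (induction n arbitrary: i t) auto

lemma altword_split: "\<exists>xs. altword i t (a + b) = xs @ altword i t b \<and> length xs = a \<and> set xs \<subseteq> {i, t}"
proof (induction b arbitrary: i t)
  case 0
  then show ?case using set_altword[of i t a] by simp
next
  case (Suc b)
  then show ?case using Suc[of t i] by (simp add: insert_commute)
qed

lemma altword_even: "altword i t (2 * k) = concat (replicate k [t, i])"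
proof (induction k)
  case (Suc k)
  have "altword i t (2 * Suc k) = altword i t (2 * k) @ [t, i]" by simp
  also have "\<dots> = concat (replicate (Suc k) [t, i])"
    unfolding Suc replicate_Suc replicate_append_same[symmetric] by simp
  finally show ?case .
qed simp

lemma eq_altword:
  assumes "set ls \<subseteq> {i, t}" "ls \<noteq> []" "last ls = i" "\<And>ys zs x. ls \<noteq> ys @ [x, x] @ zs"
  shows "ls = altword i t (length ls)"
  using assms
proof (induction "length ls" arbitrary: ls i t)
  case (Suc n)
  then obtain ls' where ls: "ls = ls' @ [i]" by (metis append_butlast_last_id)
  show ?case
  proof (cases "ls' = []")
    case False
    then obtain ls'' x where ls': "ls' = ls'' @ [x]" by (metis append_butlast_last_id)
    have "x \<noteq> i" using Suc(6)[of ls'' i "[]"] ls ls' by auto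
    then have "x = t" using Suc(3) ls ls' by auto
    have "ls' = altword t i (length ls')"
    proof (rule Suc(1))
      show "ls' \<noteq> ys @ [x, x] @ zs" for ys zs x using Suc(6)[of ys x "zs @ [i]"] ls by auto
    qed (use Suc False ls ls' \<open>x = t\<close> in auto)
    then show ?thesis using ls by simp
  qed (use ls in simp)
qed simp

context coxeter_system
begin

lemma s_in [simp]: "i \<in> I \<Longrightarrow> s i \<in> carrier W"
  using s_closed by auto

lemma s_s [simp]: "i \<in> I \<Longrightarrow> s i \<otimes> s i = \<one>"
  using pow_ord_eq_1[of "s i"] s_order[of i] by (simp add: numeral_2_eq_2)

lemma inv_s [simp]: "i \<in> I \<Longrightarrow> inv (s i) = s i"
  using inv_unique'[of "s i" "s i"] by simp

lemma s_s_cancel_right [simp]: "i \<in> I \<Longrightarrow> w \<in> carrier W \<Longrightarrow> w \<otimes> s i \<otimes> s i = w"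
  by (simp add: m_assoc)

lemma word_val_Nil [simp]: "word_val [] = \<one>"
  by (simp add: word_val_def)

lemma word_val_Cons [simp]: "word_val (x # xs) = s x \<otimes> word_val xs"
  by (simp add: word_val_def)

lemma word_val_in [simp]: "set xs \<subseteq> I \<Longrightarrow> word_val xs \<in> carrier W"
  by (induction xs) auto

lemma word_val_append: "set xs \<subseteq> I \<Longrightarrow> set ys \<subseteq> I \<Longrightarrow> word_val (xs @ ys) = word_val xs \<otimes> word_val ys"
  by (induction xs) (auto simp: m_assoc)

lemma word_val_rev: "set xs \<subseteq> I \<Longrightarrow> word_val (rev xs) = inv (word_val xs)"
  by (induction xs) (auto simp: word_val_append inv_mult_group)

lemma word_val_surj:
  assumes "w \<in> carrier W" obtains xs where "set xs \<subseteq> I" "word_val xs = w"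
proof -
  have "w \<in> generate W (s ` I)" using assms s_generate by simp
  then have "\<exists>xs. set xs \<subseteq> I \<and> word_val xs = w"
  proof induction
    case one
    then show ?case by (intro exI[of _ "[]"]) simp
  next
    case (incl h)
    then obtain i where "i \<in> I" "h = s i" by blast
    then show ?case by (intro exI[of _ "[i]"]) simp
  next
    case (inv h)
    then obtain i where "i \<in> I" "h = s i" by blast
    then show ?case by (intro exI[of _ "[i]"]) simp
  next
    case (eng h1 h2)
    then obtain xs ys where "set xs \<subseteq> I" "word_val xs = h1" "set ys \<subseteq> I" "word_val ys = h2" by blast
    then show ?case by (intro exI[of _ "xs @ ys"]) (simp add: word_val_append)
  qed
  then show thesis using that by blast
qed

lemma m_diag: "i \<in> I \<Longrightarrow> m i i = 1"
  by (simp add: m_def ord_id)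

lemma m_sym: "i \<in> I \<Longrightarrow> j \<in> I \<Longrightarrow> m i j = m j i"
  using ord_inv[of "s i \<otimes> s j"] by (simp add: m_def inv_mult_group)

lemma m_off_diag: "i \<in> I \<Longrightarrow> j \<in> I \<Longrightarrow> i \<noteq> j \<Longrightarrow> m i j = 0 \<or> 2 \<le> m i j"
proof -
  assume ij: "i \<in> I" "j \<in> I" "i \<noteq> j"
  have "m i j \<noteq> 1"
  proof
    assume "m i j = 1"
    then have "s i \<otimes> s j = \<one>" using ij ord_eq_1[of "s i \<otimes> s j"] by (simp add: m_def)
    then have "s i = s j" using ij inv_equality[of "s i" "s j"] by simp
    then show False using s_inj ij by (auto simp: inj_on_def)
  qed
  then show ?thesis by linarith
qed

definition gram :: "'i \<Rightarrow> 'i \<Rightarrow> real" where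
  "gram i j = (if m i j = 0 then - 1 else - cos (pi / real (m i j)))"

lemma gram_diag [simp]: "i \<in> I \<Longrightarrow> gram i i = 1"
  by (simp add: gram_def m_diag)

lemma gram_sym: "i \<in> I \<Longrightarrow> j \<in> I \<Longrightarrow> gram i j = gram j i"
  by (simp add: gram_def m_sym)

lemma gram_cos: "i \<in> I \<Longrightarrow> j \<in> I \<Longrightarrow> i \<noteq> j \<Longrightarrow> coxeter_cos (- gram i j)"
  using m_off_diag[of i j] unfolding coxeter_cos_def gram_def by auto

lemma bilinear_form_gram: "bilinear_form x y = (\<Sum>i\<in>I. \<Sum>j\<in>I. x i * y j * gram i j)"
  by (simp add: bilinear_form_def gram_def)

lemma bilinear_form_sym: "bilinear_form x y = bilinear_form y x"
proof -
  have "bilinear_form x y = (\<Sum>j\<in>I. \<Sum>i\<in>I. x i * y j * gram i j)"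
    unfolding bilinear_form_gram by (rule sum.swap)
  also have "\<dots> = bilinear_form y x"
    unfolding bilinear_form_gram by (rule sum.cong[OF HOL.refl], rule sum.cong[OF HOL.refl]) (simp add: gram_sym mult_ac)
  finally show ?thesis .
qed

lemma bilinear_form_lin:
  "bilinear_form (\<lambda>k. a * x k + b * y k) z = a * bilinear_form x z + b * bilinear_form y z"
  by (simp add: bilinear_form_gram sum_distrib_left distrib_right sum.distrib mult.assoc)

lemma bilinear_form_lin':
  "bilinear_form z (\<lambda>k. a * x k + b * y k) = a * bilinear_form z x + b * bilinear_form z y"
  by (subst bilinear_form_sym, subst bilinear_form_lin) (simp add: bilinear_form_sym)

abbreviation pairing :: "('i \<Rightarrow> real) \<Rightarrow> 'i \<Rightarrow> real" where
  "pairing v i \<equiv> bilinear_form v (simple_root i)"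

lemma pairing_gram: "i \<in> I \<Longrightarrow> pairing v i = (\<Sum>k\<in>I. v k * gram k i)"
proof -
  assume i: "i \<in> I"
  have "(\<Sum>j\<in>I. v k * simple_root i j * gram k j) = v k * gram k i" for k
  proof -
    have "(\<Sum>j\<in>I. v k * simple_root i j * gram k j) = (\<Sum>j\<in>I. if j = i then v k * gram k j else 0)"
      by (intro sum.cong) (auto simp: simple_root_def)
    then show ?thesis using i finite_index by simp
  qed
  then show ?thesis by (simp add: bilinear_form_gram)
qed

lemma pairing_simple: "i \<in> I \<Longrightarrow> j \<in> I \<Longrightarrow> pairing (simple_root i) j = gram i j"
proof -
  assume ij: "i \<in> I" "j \<in> I"
  have "(\<Sum>k\<in>I. simple_root i k * gram k j) = (\<Sum>k\<in>I. if k = i then gram k j else 0)"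
    by (intro sum.cong) (auto simp: simple_root_def)
  then show ?thesis using ij finite_index by (simp add: pairing_gram)
qed

lemma reflect_lin_form: "reflect i v = (\<lambda>k. 1 * v k + (- 2 * pairing v i) * simple_root i k)"
  by (simp add: reflect_def)

lemma reflect_lin: "reflect i (\<lambda>k. a * x k + b * y k) = (\<lambda>k. a * reflect i x k + b * reflect i y k)"
  by (simp add: reflect_def bilinear_form_lin algebra_simps)

lemma reflect_reflect [simp]: "i \<in> I \<Longrightarrow> reflect i (reflect i v) = v"
proof -
  assume "i \<in> I"
  then have "pairing (reflect i v) i = - pairing v i"
    unfolding reflect_lin_form bilinear_form_lin by (simp add: pairing_simple)
  then show ?thesis by (simp add: reflect_def)
qed

lemma bilinear_form_reflect: "i \<in> I \<Longrightarrow> bilinear_form (reflect i x) (reflect i y) = bilinear_form x y"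
  unfolding reflect_lin_form bilinear_form_lin bilinear_form_lin' bilinear_form_sym[of "simple_root i" y]
  by (simp add: pairing_simple)

lemma foldr_reflect_lin:
  "foldr reflect xs (\<lambda>k. a * x k + b * y k) = (\<lambda>k. a * foldr reflect xs x k + b * foldr reflect xs y k)"
  by (induction xs) (simp_all add: reflect_lin)

lemma bilinear_form_foldr_reflect:
  "set xs \<subseteq> I \<Longrightarrow> bilinear_form (foldr reflect xs x) (foldr reflect xs y) = bilinear_form x y"
  by (induction xs) (simp_all add: bilinear_form_reflect)

text \<open>The vector splits into a part orthogonal to both simple roots and a part in their span,
  on which the product of the two reflections is a rotation by 2 \<theta>; its m-th power is a full
  turn.\<close>

lemma dihedral_relation:
  assumes ij: "i \<in> I" "j \<in> I"
  shows "foldr reflect (concat (replicate (m i j) [i, j])) v = v"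
proof (cases "i = j \<or> m i j = 0")
  case True
  then show ?thesis using ij by (auto simp: m_diag)
next
  case False
  define n where "n = m i j"
  have n: "2 \<le> n" using m_off_diag[of i j] ij False by (auto simp: n_def)
  define \<theta> where "\<theta> = pi / real n"
  define S where "S a = sin (real_of_int a * \<theta>) / sin \<theta>" for a :: int
  have sin: "0 < sin \<theta>" using sin_pi_div_pos[OF n] by (simp add: \<theta>_def)
  have S_rec: "2 * cos \<theta> * S a - S (a - 1) = S (a + 1)" for a
  proof -
    have "sin (real_of_int (a + 1) * \<theta>) + sin (real_of_int (a - 1) * \<theta>) = 2 * cos \<theta> * sin (real_of_int a * \<theta>)"
      by (simp add: algebra_simps sin_add sin_diff)
    then show ?thesis using sin by (simp add: S_def field_simps)
  qed
  have g: "gram i j = - cos \<theta>" "gram j i = - cos \<theta>"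
    using False m_sym[OF ij] by (auto simp: gram_def n_def \<theta>_def)
  \<comment> \<open>The Gram determinant of the two simple roots; x and y are the coordinates of the
    projection of v to their span, by Cramer's rule.\<close>
  define d where "d = 1 - (cos \<theta>)\<^sup>2"
  have d: "d \<noteq> 0" using sin by (simp add: d_def sin_squared_eq[symmetric])
  define x where "x = (pairing v i + cos \<theta> * pairing v j) / d"
  define y where "y = (pairing v j + cos \<theta> * pairing v i) / d"
  have xy: "x - cos \<theta> * y = pairing v i" "y - cos \<theta> * x = pairing v j"
    using d unfolding x_def y_def by (simp_all add: divide_simps) (simp_all add: d_def power2_eq_square algebra_simps)
  define v' where "v' = (\<lambda>k. 1 * v k + (-1) * (x * simple_root i k + y * simple_root j k))"
  have v': "pairing v' i = 0" "pairing v' j = 0"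
    unfolding v'_def bilinear_form_lin using ij g xy by (simp_all add: pairing_simple algebra_simps)
  define V where "V X Y = (\<lambda>k. 1 * v' k + 1 * (X * simple_root i k + Y * simple_root j k))" for X Y
  have pV: "pairing (V X Y) i = X - cos \<theta> * Y" "pairing (V X Y) j = Y - cos \<theta> * X" for X Y
    unfolding V_def bilinear_form_lin using ij g v' by (simp_all add: pairing_simple)
  have rj: "reflect j (V X Y) = V X (2 * cos \<theta> * X - Y)" for X Y
    unfolding reflect_def pV by (auto simp: V_def algebra_simps)
  have ri: "reflect i (V X Y) = V (2 * cos \<theta> * Y - X) Y" for X Y
    unfolding reflect_def pV by (auto simp: V_def algebra_simps)
  have *: "foldr reflect (concat (replicate k [i, j])) (V x y) =
      V (x * S (2 * int k + 1) - y * S (2 * int k)) (x * S (2 * int k) - y * S (2 * int k - 1))" for k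
  proof (induction k)
    case 0
    have "S 0 = 0" "S 1 = 1" "S (-1) = -1" using sin by (simp_all add: S_def)
    then show ?case by simp
  next
    case (Suc k)
    have 1: "2 * cos \<theta> * (x * S (2 * int k + 1) - y * S (2 * int k)) - (x * S (2 * int k) - y * S (2 * int k - 1))
      = x * S (2 * int (Suc k)) - y * S (2 * int (Suc k) - 1)"
      using S_rec[of "2 * int k"] S_rec[of "2 * int k + 1"] by (simp add: algebra_simps)
    have 2: "2 * cos \<theta> * (x * S (2 * int (Suc k)) - y * S (2 * int (Suc k) - 1)) - (x * S (2 * int k + 1) - y * S (2 * int k))
      = x * S (2 * int (Suc k) + 1) - y * S (2 * int (Suc k))"
      using S_rec[of "2 * int k + 2"] S_rec[of "2 * int k + 1"] by (simp add: algebra_simps)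
    show ?case using Suc 1 2 by (simp add: rj ri)
  qed
  have "real n * \<theta> = pi" using n by (simp add: \<theta>_def)
  then have e: "real_of_int (2 * int n + 1) * \<theta> = 2 * pi + \<theta>" "real_of_int (2 * int n) * \<theta> = 2 * pi"
    "real_of_int (2 * int n - 1) * \<theta> = 2 * pi - \<theta>"
    by (simp_all add: algebra_simps)
  have "S (2 * int n + 1) = 1" "S (2 * int n) = 0" "S (2 * int n - 1) = -1"
    unfolding S_def e using sin by (simp_all add: sin_add sin_diff)
  then have "foldr reflect (concat (replicate n [i, j])) (V x y) = V x y" using *[of n] by simp
  moreover have "V x y = v" by (simp add: V_def v'_def)
  ultimately show ?thesis by (simp add: n_def)
qed

lemma word_cong_foldr_reflect: "word_cong xs ys \<Longrightarrow> foldr reflect xs v = foldr reflect ys v"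
proof (induction arbitrary: v rule: word_cong.induct)
  case (relator i j)
  then show ?case using dihedral_relation by simp
qed auto

text \<open>The sign character. It ensures that multiplication by a generator always changes the
  word length.\<close>

lemma word_cong_even_length: "word_cong xs ys \<Longrightarrow> even (length xs) = even (length ys)"
proof (induction rule: word_cong.induct)
  case (relator i j)
  have "length (concat (replicate n [i, j])) = 2 * n" for n by (induction n) auto
  then show ?case by simp
qed auto

lemma word_cong_cancel: "set xs \<subseteq> I \<Longrightarrow> word_cong (rev xs @ xs) []"
proof (induction xs)
  case (Cons x xs)
  have "word_cong [x, x] []" using word_cong.relator[of x x] Cons by (simp add: m_diag)
  then have "word_cong (rev xs @ [x, x] @ xs) (rev xs @ [] @ xs)" by (rule word_cong.ctxt)
  then show ?case using Cons word_cong.trans by auto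
qed (simp add: word_cong.refl)

lemma word_cong_of_word_val_eq:
  assumes "set xs \<subseteq> I" "set ys \<subseteq> I" "word_val xs = word_val ys"
  shows "word_cong xs ys"
proof -
  have "word_cong (xs @ rev ys) []"
    by (rule presentation) (use assms in \<open>auto simp: word_val_append word_val_rev\<close>)
  then have "word_cong ([] @ (xs @ rev ys) @ ys) ([] @ [] @ ys)" by (rule word_cong.ctxt)
  then have 1: "word_cong (xs @ rev ys @ ys) ys" by simp
  have "word_cong (xs @ (rev ys @ ys) @ []) (xs @ [] @ [])"
    by (rule word_cong.ctxt) (rule word_cong_cancel[OF assms(2)])
  then have "word_cong (xs @ rev ys @ ys) xs" by simp
  then show ?thesis using word_cong.trans[OF word_cong.sym 1] by blast
qed

text \<open>Frees \<open>act\<close> from the word picked by its choice operator: words with the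
  same value are congruent and hence act alike.\<close>

lemma act_word_val:
  assumes "set xs \<subseteq> I" shows "act (word_val xs) v = foldr reflect xs v"
proof -
  define ys where "ys = (SOME ys. ys \<in> lists I \<and> word_val ys = word_val xs)"
  have "ys \<in> lists I \<and> word_val ys = word_val xs"
    unfolding ys_def by (rule someI[of _ xs]) (use assms in auto)
  then have "word_cong ys xs" using word_cong_of_word_val_eq assms by auto
  then show ?thesis using word_cong_foldr_reflect unfolding act_def ys_def by blast
qed

lemma act_one [simp]: "act \<one> v = v"
  using act_word_val[of "[]" v] by simp

lemma act_mult:
  assumes "v \<in> carrier W" "w \<in> carrier W" shows "act (v \<otimes> w) x = act v (act w x)"
proof -
  obtain xs ys where "set xs \<subseteq> I" "word_val xs = v" "set ys \<subseteq> I" "word_val ys = w"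
    using word_val_surj assms by metis
  then show ?thesis using act_word_val[of "xs @ ys" x] act_word_val[of xs] act_word_val[of ys]
    by (auto simp: word_val_append)
qed

lemma act_s: "i \<in> I \<Longrightarrow> act (s i) v = reflect i v"
  using act_word_val[of "[i]" v] by simp

lemma act_inv [simp]: "w \<in> carrier W \<Longrightarrow> act w (act (inv w) v) = v" "w \<in> carrier W \<Longrightarrow> act (inv w) (act w v) = v"
  by (simp_all flip: act_mult)

lemma act_lin: "w \<in> carrier W \<Longrightarrow> act w (\<lambda>k. a * x k + b * y k) = (\<lambda>k. a * act w x k + b * act w y k)"
  by (erule word_val_surj) (auto simp: act_word_val foldr_reflect_lin)

lemma bilinear_form_act: "w \<in> carrier W \<Longrightarrow> bilinear_form (act w x) (act w y) = bilinear_form x y"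
  by (erule word_val_surj) (auto simp: act_word_val bilinear_form_foldr_reflect)

section \<open>Word length and the sign of roots\<close>

definition word_length :: "'w \<Rightarrow> nat" where
  "word_length w = (LEAST n. \<exists>xs. set xs \<subseteq> I \<and> word_val xs = w \<and> length xs = n)"

lemma word_length_le: "set xs \<subseteq> I \<Longrightarrow> word_length (word_val xs) \<le> length xs"
  unfolding word_length_def by (rule Least_le) auto

lemma reduced_word:
  assumes "w \<in> carrier W" obtains xs where "set xs \<subseteq> I" "word_val xs = w" "length xs = word_length w"
proof -
  have "\<exists>n xs. set xs \<subseteq> I \<and> word_val xs = w \<and> length xs = n" using word_val_surj[OF assms] by metis
  from LeastI_ex[OF this] show thesis using that unfolding word_length_def by blast
qed

lemma word_length_mult_le:
  assumes "w \<in> carrier W" "set ys \<subseteq> I"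
  shows "word_length (w \<otimes> word_val ys) \<le> word_length w + length ys"
proof -
  obtain xs where "set xs \<subseteq> I" "word_val xs = w" "length xs = word_length w" using reduced_word assms by blast
  then show ?thesis using word_length_le[of "xs @ ys"] assms by (simp add: word_val_append)
qed

lemma word_length_s_cases:
  assumes "w \<in> carrier W" "i \<in> I"
  obtains "word_length (w \<otimes> s i) = Suc (word_length w)" | "word_length w = Suc (word_length (w \<otimes> s i))"
proof -
  have 1: "word_length (w \<otimes> s i) \<le> Suc (word_length w)"
    using word_length_mult_le[of w "[i]"] assms by simp
  have 2: "word_length w \<le> Suc (word_length (w \<otimes> s i))"
    using word_length_mult_le[of "w \<otimes> s i" "[i]"] assms by simp
  obtain xs ys where "set xs \<subseteq> I" "word_val xs = w" "length xs = word_length w"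
    "set ys \<subseteq> I" "word_val ys = w \<otimes> s i" "length ys = word_length (w \<otimes> s i)"
    using reduced_word assms by (metis m_closed s_in)
  moreover from this have "word_cong (xs @ [i]) ys"
    using assms by (intro word_cong_of_word_val_eq) (auto simp: word_val_append)
  ultimately have "word_length w \<noteq> word_length (w \<otimes> s i)" using word_cong_even_length by fastforce
  then show thesis using 1 2 that by linarith
qed

text \<open>When lengths add up, no factor can be rewritten by a shorter word. This excludes
  repeated letters and overlong alternating words below.\<close>

lemma reduced_sublist_le:
  assumes "w \<in> carrier W" "set (xs @ ys @ zs) \<subseteq> I" "set ys' \<subseteq> I" "word_val ys' = word_val ys"
    "word_length (w \<otimes> word_val (xs @ ys @ zs)) = word_length w + length (xs @ ys @ zs)"
  shows "length ys \<le> length ys'"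
proof -
  have "word_val (xs @ ys' @ zs) = word_val (xs @ ys @ zs)" using assms(2-4) by (simp add: word_val_append)
  then show ?thesis using word_length_mult_le[of w "xs @ ys' @ zs"] assms by simp
qed

text \<open>The relator is an alternating word of length 2 m, so its suffix of length m + 1 is the
  inverse of the remaining m - 1 letters.\<close>

lemma altword_relation:
  assumes "i \<in> I" "t \<in> I" "0 < m i t"
  shows "\<exists>ys. set ys \<subseteq> I \<and> length ys = m i t - 1 \<and> word_val ys = word_val (altword i t (Suc (m i t)))"
proof -
  let ?n = "m i t"
  have e: "2 * ?n = (?n - 1) + Suc ?n" using assms by simp
  obtain xs where xs: "altword i t (2 * ?n) = xs @ altword i t (Suc ?n)" "length xs = ?n - 1" "set xs \<subseteq> {i, t}"
    using altword_split[of i t "?n - 1" "Suc ?n"] unfolding e by blast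
  have "word_val (concat (replicate k [t, i])) = (s t \<otimes> s i) [^] k" for k
    using assms by (induction k) (simp_all add: m_assoc[symmetric] nat_pow_Suc2[symmetric] del: nat_pow_Suc)
  then have 1: "word_val (altword i t (2 * ?n)) = \<one>"
    using assms m_sym[of i t] unfolding altword_even by (simp add: m_def)
  have I: "set xs \<subseteq> I" "set (altword i t (Suc ?n)) \<subseteq> I" using xs(3) assms set_altword[of i t "Suc ?n"] by auto
  have "word_val xs \<otimes> word_val (altword i t (Suc ?n)) = \<one>"
    using 1 I unfolding xs(1) by (simp add: word_val_append del: altword.simps)
  then have "word_val (altword i t (Suc ?n)) = inv (word_val xs)"
    using I by (metis inv_equality inv_inv word_val_in inv_closed)
  then show ?thesis using I xs(2) by (intro exI[of _ "rev xs"]) (simp add: word_val_rev del: altword.simps)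
qed

text \<open>For an infinite label U is j itself, the limit of the dihedral coefficients. Each letter
  raises the index by one, and the bound on a + k keeps it in the range of nonnegative
  coefficients.\<close>

lemma altword_action:
  assumes "i \<in> I" "t \<in> I" "i \<noteq> t"
    and "m i t = 0 \<or> Suc (a + k) \<le> m i t"
  defines "U \<equiv> (\<lambda>j. if m i t = 0 then real j else dcoeff (m i t) j)"
  shows "\<exists>x\<ge>0. \<exists>y\<ge>0. foldr reflect (altword t i k) (\<lambda>r. U (Suc a) * simple_root i r + U a * simple_root t r)
     = (\<lambda>r. x * simple_root i r + y * simple_root t r)"
  using assms(1-4) unfolding U_def
proof (induction k arbitrary: a i t)
  case 0
  have "0 \<le> (if m i t = 0 then real j else dcoeff (m i t) j)" if "j \<le> Suc a" for j
    using that m_off_diag[of i t] 0 by (auto intro!: dcoeff_nonneg)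
  from this[of "Suc a"] this[of a] show ?case
    by (intro exI[of _ "if m i t = 0 then real (Suc a) else dcoeff (m i t) (Suc a)"] conjI
        exI[of _ "if m i t = 0 then real a else dcoeff (m i t) a"]) simp_all
next
  case (Suc k)
  let ?U = "\<lambda>i t j. if m i t = 0 then real j else dcoeff (m i t) j"
  have p: "pairing (\<lambda>r. ?U i t (Suc a) * simple_root i r + ?U i t a * simple_root t r) t =
      ?U i t (Suc a) * gram i t + ?U i t a"
    using Suc.prems by (simp add: bilinear_form_lin pairing_simple)
  have rec: "?U i t (Suc (Suc a)) = - 2 * gram i t * ?U i t (Suc a) - ?U i t a"
    by (simp add: gram_def dcoeff_rec)
  have "reflect t (\<lambda>r. ?U i t (Suc a) * simple_root i r + ?U i t a * simple_root t r) =
      (\<lambda>r. ?U t i (Suc (Suc a)) * simple_root t r + ?U t i (Suc a) * simple_root i r)"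
    unfolding reflect_def p m_sym[OF Suc.prems(2,1)] rec by (simp add: algebra_simps)
  moreover obtain x y where "0 \<le> x" "0 \<le> y" "foldr reflect (altword i t k)
      (\<lambda>r. ?U t i (Suc (Suc a)) * simple_root t r + ?U t i (Suc a) * simple_root i r) =
      (\<lambda>r. x * simple_root t r + y * simple_root i r)"
    using Suc.IH[of t i "Suc a"] Suc.prems m_sym[of i t] by auto
  ultimately show ?case
    by (intro exI[of _ y] conjI exI[of _ x]) (simp_all add: add.commute)
qed

text \<open>The classical descent to rank 2: w is written as v times a word in i and the last letter
  t of a reduced word, with lengths adding up and v as short as possible. The word sends the simple
  root of i to a nonnegative combination of those of i and t, and the induction hypothesis applies
  to v and both letters.\<close>

lemma act_simple_root_nonneg:
  "w \<in> carrier W \<Longrightarrow> i \<in> I \<Longrightarrow> word_length (w \<otimes> s i) = Suc (word_length w) \<Longrightarrow> 0 \<le> act w (simple_root i) k"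
proof (induction "word_length w" arbitrary: w i k rule: less_induct)
  case less
  note w = less.prems(1) and i = less.prems(2) and up = less.prems(3)
  obtain xs where xs: "set xs \<subseteq> I" "word_val xs = w" "length xs = word_length w" using reduced_word[OF w] .
  show ?case
  proof (cases xs rule: rev_cases)
    case Nil
    then show ?thesis using xs by (auto simp: simple_root_def)
  next
    case (snoc ys t)
    have t: "t \<in> I" "set ys \<subseteq> I" using xs snoc by auto
    have wt: "w = word_val ys \<otimes> s t" using xs t unfolding snoc by (auto simp: word_val_append)
    have ly: "word_length (word_val ys) < word_length w"
      using word_length_le[OF t(2)] xs(3) snoc by simp
    have it: "i \<noteq> t" using up ly wt t by auto
    define P where "P v \<longleftrightarrow> v \<in> carrier W \<and> (\<exists>zs. set zs \<subseteq> {i, t} \<and> v \<otimes> word_val zs = w \<and> word_length v + length zs = word_length w)" for v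
    have "P (word_val ys)"
      unfolding P_def using t wt ly word_length_mult_le[of "word_val ys" "[t]"]
      by (intro conjI exI[of _ "[t]"]) auto
    then obtain v where v: "P v" "\<And>u. P u \<Longrightarrow> word_length v \<le> word_length u"
      using ex_has_least_nat[of P "word_val ys" word_length] by blast
    have vw: "word_length v < word_length w" using v(2)[OF \<open>P (word_val ys)\<close>] ly by simp
    obtain zs where vc: "v \<in> carrier W" and zs: "set zs \<subseteq> {i, t}" "v \<otimes> word_val zs = w" "word_length v + length zs = word_length w"
      using v(1) P_def by blast
    have zsI: "set zs \<subseteq> I" using zs t i by auto
    have vj: "word_length (v \<otimes> s j) = Suc (word_length v)" if j: "j \<in> {i, t}" for j
    proof (rule word_length_s_cases[OF vc, of j])
      assume d: "word_length v = Suc (word_length (v \<otimes> s j))"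
      have jI: "j \<in> I" using j i t by auto
      have "P (v \<otimes> s j)"
        unfolding P_def using vc zs d jI j zsI
        by (intro conjI exI[of _ "j # zs"]) (auto simp flip: m_assoc)
      then show ?thesis using v(2) d by fastforce
    qed (use j i t in auto)
    have pos: "0 \<le> act v (simple_root i) r" "0 \<le> act v (simple_root t) r" for r
      using less.hyps[OF vw vc] vj i t by auto
    have zs': "word_length (v \<otimes> word_val (zs @ [i])) = word_length v + length (zs @ [i])"
      using zs up zsI i vc by (simp add: word_val_append flip: m_assoc)
    have "zs @ [i] = altword i t (length (zs @ [i]))"
    proof (rule eq_altword)
      fix as bs x
      show "zs @ [i] \<noteq> as @ [x, x] @ bs"
      proof
        assume e: "zs @ [i] = as @ [x, x] @ bs"
        have I: "set (as @ [x, x] @ bs) \<subseteq> I" using zsI i e by (metis Un_subset_iff empty_subsetI insert_subset list.simps(15) set_append list.set(1))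
        have "length [x, x] \<le> length ([] :: 'i list)"
          by (rule reduced_sublist_le[OF vc I]) (use I zs' e in auto)
        then show False by simp
      qed
    qed (use zs in auto)
    then have zsa: "zs = altword t i (length zs)" "zs @ [i] = altword i t (Suc (length zs))" by auto
    \<comment> \<open>An alternating word longer than m could be shortened by
      \<open>altword_relation\<close>.\<close>
    have len: "m i t = 0 \<or> Suc (0 + length zs) \<le> m i t"
    proof (rule ccontr)
      assume "\<not> ?thesis"
      then have n: "0 < m i t" "Suc (length zs) = (length zs - m i t) + Suc (m i t)" by auto
      obtain as where as: "zs @ [i] = as @ altword i t (Suc (m i t)) @ []" "set as \<subseteq> {i, t}"
        using altword_split[of i t "length zs - m i t" "Suc (m i t)"]
        unfolding n(2)[symmetric] zsa(2)[symmetric] append_Nil2 by blast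
      obtain bs where bs: "set bs \<subseteq> I" "length bs = m i t - 1" "word_val bs = word_val (altword i t (Suc (m i t)))"
        using altword_relation[OF i t(1) n(1)] by blast
      have I: "set (as @ altword i t (Suc (m i t)) @ []) \<subseteq> I" using zsI i unfolding as(1)[symmetric] by simp
      have "length (altword i t (Suc (m i t))) \<le> length bs"
        by (rule reduced_sublist_le[OF vc I bs(1,3)]) (use zs' as in simp)
      then show False using bs(2) by (simp del: altword.simps)
    qed
    have U: "(if m i t = 0 then real (Suc 0) else dcoeff (m i t) (Suc 0)) = 1"
      "(if m i t = 0 then real 0 else dcoeff (m i t) 0) = 0"
      using m_off_diag[OF i t(1) it] by auto
    obtain x y where xy: "0 \<le> x" "0 \<le> y" "foldr reflect zs (simple_root i) = (\<lambda>r. x * simple_root i r + y * simple_root t r)"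
      using altword_action[OF i t(1) it len, unfolded U] zsa(1) by (metis (no_types, lifting) add.right_neutral mult_1 mult_zero_left ext)
    have "act w (simple_root i) = act v (foldr reflect zs (simple_root i))"
      using zs(2) vc zsI act_mult[OF vc word_val_in[OF zsI]] act_word_val[OF zsI] by simp
    also have "\<dots> = (\<lambda>r. x * act v (simple_root i) r + y * act v (simple_root t) r)"
      unfolding xy by (rule act_lin[OF vc])
    finally show ?thesis using pos xy by simp
  qed
qed


abbreviation neg :: "('i \<Rightarrow> real) \<Rightarrow> 'i \<Rightarrow> real" where
  "neg v \<equiv> (\<lambda>k. - v k)"

lemma act_neg: "w \<in> carrier W \<Longrightarrow> act w (neg v) = neg (act w v)"
  using act_lin[of w "-1" v 0 v] by simp

lemma bilinear_form_neg [simp]: "bilinear_form (neg v) w = - bilinear_form v w" "bilinear_form v (neg w) = - bilinear_form v w"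
  using bilinear_form_lin[of "-1" v 0 v w] bilinear_form_lin'[of v "-1" w 0 w] by simp_all

lemma reflect_neg: "reflect i (neg v) = neg (reflect i v)"
  by (simp add: reflect_def algebra_simps)

lemma reflect_simple_root [simp]: "i \<in> I \<Longrightarrow> reflect i (simple_root i) = neg (simple_root i)"
  by (simp add: reflect_def pairing_simple)

lemma pairing_reflect: "i \<in> I \<Longrightarrow> pairing (reflect i v) i = - pairing v i"
  using bilinear_form_reflect[of i v "simple_root i"] by simp

lemma reflect_other: "k \<noteq> i \<Longrightarrow> reflect i v k = v k"
  by (simp add: reflect_def simple_root_def)

lemma root_act: "w \<in> carrier W \<Longrightarrow> \<beta> \<in> roots \<Longrightarrow> act w \<beta> \<in> roots"
proof -
  assume w: "w \<in> carrier W" and "\<beta> \<in> roots"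
  then obtain v i where v: "v \<in> carrier W" "i \<in> I" "\<beta> = act v (simple_root i)" unfolding roots_def by blast
  then have "act w \<beta> = act (w \<otimes> v) (simple_root i)" "w \<otimes> v \<in> carrier W" using w by (simp_all add: act_mult)
  then show ?thesis using v(2) unfolding roots_def by blast
qed

lemma simple_root_is_root: "i \<in> I \<Longrightarrow> simple_root i \<in> roots"
  unfolding roots_def by (auto intro!: exI[of _ \<one>])

lemma root_reflect: "i \<in> I \<Longrightarrow> \<beta> \<in> roots \<Longrightarrow> reflect i \<beta> \<in> roots"
  using root_act[of "s i" \<beta>] by (simp add: act_s)

lemma rootE:
  assumes "\<beta> \<in> roots" obtains w i where "w \<in> carrier W" "i \<in> I" "\<beta> = act w (simple_root i)"
proof -
  obtain w i where "w \<in> carrier W" "i \<in> I" "\<beta> = act w (simple_root i)"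
    using assms unfolding roots_def by blast
  then show thesis by (rule that)
qed

lemma root_neg: "\<beta> \<in> roots \<Longrightarrow> neg \<beta> \<in> roots"
proof -
  assume "\<beta> \<in> roots"
  then obtain w i where w: "w \<in> carrier W" "i \<in> I" "\<beta> = act w (simple_root i)" by (rule rootE)
  then have "neg \<beta> = act (w \<otimes> s i) (simple_root i)" "w \<otimes> s i \<in> carrier W" by (simp_all add: act_mult act_s act_neg)
  then show ?thesis using w(2) unfolding roots_def by blast
qed

lemma root_norm: "\<beta> \<in> roots \<Longrightarrow> bilinear_form \<beta> \<beta> = 1"
  by (erule rootE) (simp add: bilinear_form_act pairing_simple)

lemma root_outside:
  assumes "\<beta> \<in> roots" "k \<notin> I" shows "\<beta> k = 0"
proof -
  obtain w i where w: "w \<in> carrier W" "i \<in> I" "\<beta> = act w (simple_root i)" using assms(1) by (rule rootE)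
  obtain xs where xs: "set xs \<subseteq> I" "word_val xs = w" using word_val_surj w by metis
  have "foldr reflect xs (simple_root i) k = 0" using xs(1) assms(2) w(2)
    by (induction xs) (auto simp: reflect_def simple_root_def)
  then show ?thesis using w xs act_word_val by metis
qed

lemma pos_rootI: "\<beta> \<in> roots \<Longrightarrow> (\<And>k. 0 \<le> \<beta> k) \<Longrightarrow> \<beta> \<in> pos_roots"
  by (simp add: pos_roots_def)

lemma pos_rootD: "\<beta> \<in> pos_roots \<Longrightarrow> \<beta> \<in> roots" "\<beta> \<in> pos_roots \<Longrightarrow> 0 \<le> \<beta> k"
  using root_outside[of \<beta> k] by (cases "k \<in> I"; auto simp: pos_roots_def)+

lemma simple_root_pos: "i \<in> I \<Longrightarrow> simple_root i \<in> pos_roots"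
  by (rule pos_rootI[OF simple_root_is_root]) (auto simp: simple_root_def)

lemma root_dichotomy: "\<beta> \<in> roots \<Longrightarrow> \<beta> \<notin> pos_roots \<longleftrightarrow> neg \<beta> \<in> pos_roots"
proof
  assume r: "\<beta> \<in> roots" and n: "\<beta> \<notin> pos_roots"
  obtain w i where w: "w \<in> carrier W" "i \<in> I" "\<beta> = act w (simple_root i)" using r by (rule rootE)
  show "neg \<beta> \<in> pos_roots"
  proof (rule word_length_s_cases[OF w(1,2)])
    assume "word_length (w \<otimes> s i) = Suc (word_length w)"
    then show ?thesis using act_simple_root_nonneg[OF w(1,2)] n r w(3) pos_rootI by blast
  next
    assume "word_length w = Suc (word_length (w \<otimes> s i))"
    then have "0 \<le> act (w \<otimes> s i) (simple_root i) k" for k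
      using act_simple_root_nonneg[of "w \<otimes> s i" i] w by simp
    moreover have "act (w \<otimes> s i) (simple_root i) = neg \<beta>" using w by (simp add: act_mult act_s act_neg)
    ultimately show ?thesis using root_neg[OF r] by (auto intro: pos_rootI)
  qed
next
  assume r: "\<beta> \<in> roots" and n: "neg \<beta> \<in> pos_roots"
  show "\<beta> \<notin> pos_roots"
  proof
    assume p: "\<beta> \<in> pos_roots"
    have "\<beta> k = 0" for k using pos_rootD(2)[OF p, of k] pos_rootD(2)[OF n, of k] by simp
    then have "bilinear_form \<beta> \<beta> = 0" by (simp add: bilinear_form_gram)
    then show False using root_norm[OF r] by simp
  qed
qed

lemma nonpos_not_pos: "\<beta> \<in> roots \<Longrightarrow> (\<And>k. \<beta> k \<le> 0) \<Longrightarrow> \<beta> \<notin> pos_roots"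
  using root_dichotomy[of \<beta>] root_neg pos_rootI[of "neg \<beta>"] by auto

lemma not_pos_nonpos: "\<beta> \<in> roots \<Longrightarrow> \<beta> \<notin> pos_roots \<Longrightarrow> \<beta> k \<le> 0"
  using root_dichotomy[of \<beta>] pos_rootD(2)[of "neg \<beta>" k] by auto

lemma neg_simple_root_not_pos: "i \<in> I \<Longrightarrow> neg (simple_root i) \<notin> pos_roots"
  using root_dichotomy[OF simple_root_is_root] simple_root_pos by blast

lemma act_nonpos_not_pos:
  assumes "w \<in> carrier W" "\<gamma> \<in> roots" "\<delta> \<in> roots" "\<beta> \<in> roots" "\<beta> = (\<lambda>k. 1 * \<gamma> k + a * \<delta> k)"
    "act w \<gamma> \<notin> pos_roots" "\<And>k. a * act w \<delta> k \<le> 0"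
  shows "act w \<beta> \<notin> pos_roots"
proof (rule nonpos_not_pos)
  show "act w \<beta> \<in> roots" using assms root_act by blast
  show "act w \<beta> k \<le> 0" for k
    using assms(7)[of k] not_pos_nonpos[OF root_act[OF assms(1,2)] assms(6), of k]
    unfolding assms(5) act_lin[OF assms(1)] by simp
qed

lemma pos_root_eq_simple_root:
  assumes p: "\<beta> \<in> pos_roots" and i: "i \<in> I" and z: "\<And>k. k \<noteq> i \<Longrightarrow> \<beta> k = 0"
  shows "\<beta> = simple_root i"
proof -
  have b: "\<beta> = (\<lambda>k. \<beta> i * simple_root i k + 0 * simple_root i k)" using z by (auto simp: simple_root_def)
  have "bilinear_form \<beta> \<beta> = \<beta> i * \<beta> i"
    by (subst b, subst (2) b, subst bilinear_form_lin, subst bilinear_form_lin') (use i in \<open>simp add: pairing_simple\<close>)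
  then have "\<beta> i = 1" using root_norm[OF pos_rootD(1)[OF p]] pos_rootD(2)[OF p, of i]
    by (metis power2_eq_1_iff power2_eq_square neg_0_le_iff_le not_one_le_zero)
  then show ?thesis using b by auto
qed

text \<open>A positive root other than the simple root of i has a positive coordinate away from i,
  which the reflection leaves unchanged.\<close>

lemma reflect_pos:
  assumes p: "\<beta> \<in> pos_roots" and i: "i \<in> I" and ne: "\<beta> \<noteq> simple_root i"
  shows "reflect i \<beta> \<in> pos_roots"
proof (rule ccontr)
  assume "reflect i \<beta> \<notin> pos_roots"
  then have "reflect i \<beta> k \<le> 0" for k using not_pos_nonpos root_reflect[OF i pos_rootD(1)[OF p]] by blast
  then have "\<beta> k = 0" if "k \<noteq> i" for k
    using reflect_other[OF that, of \<beta>] pos_rootD(2)[OF p, of k] by (metis order_antisym)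
  then show False using pos_root_eq_simple_root[OF p i] ne by blast
qed

lemma word_length_decreases:
  assumes "w \<in> carrier W" "i \<in> I" "act w (simple_root i) \<notin> pos_roots"
  shows "word_length w = Suc (word_length (w \<otimes> s i))"
proof (rule word_length_s_cases[OF assms(1,2)])
  assume "word_length (w \<otimes> s i) = Suc (word_length w)"
  then have "act w (simple_root i) \<in> pos_roots"
    using act_simple_root_nonneg[OF assms(1,2)] root_act[OF assms(1) simple_root_is_root[OF assms(2)]]
    by (auto intro: pos_rootI)
  then show ?thesis using assms(3) by simp
qed

lemma bilinear_form_self_reflect: "\<beta> \<in> roots \<Longrightarrow> i \<in> I \<Longrightarrow> bilinear_form \<beta> (reflect i \<beta>) = 1 - 2 * (pairing \<beta> i)\<^sup>2"
  unfolding reflect_lin_form bilinear_form_lin' by (simp add: root_norm power2_eq_square)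

lemma one_minus_two_square_le: "\<bar>x\<bar> \<ge> 1 \<Longrightarrow> 1 - 2 * x\<^sup>2 \<le> (-1 :: real)"
  using abs_le_square_iff[of 1 x] by simp

text \<open>A word cannot make two positive roots with product at most \<open>-1\<close> negative: these generate an infinite
  dihedral reflection group, and consecutive roots of its infinite positive system again have product at most
  \<open>-1\<close>, which drives the induction when the first letter is itself one of the two roots.\<close>

lemma no_common_inversion:
  assumes "set xs \<subseteq> I" "\<gamma> \<in> pos_roots" "\<delta> \<in> pos_roots" "bilinear_form \<gamma> \<delta> \<le> -1"
    "foldr reflect xs \<gamma> \<notin> pos_roots" "foldr reflect xs \<delta> \<notin> pos_roots"
  shows False
  using assms
proof (induction xs arbitrary: \<gamma> \<delta> rule: rev_induct)
  case (snoc j xs)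
  have j: "j \<in> I" and xs: "set xs \<subseteq> I" using snoc.prems by auto
  define w where "w = word_val xs"
  have w: "w \<in> carrier W" "foldr reflect xs v = act w v" for v using xs by (simp_all add: w_def act_word_val)
  have simple: False if p: "\<gamma> \<in> pos_roots" and b: "pairing \<gamma> j \<le> -1"
    and n: "act w (reflect j \<gamma>) \<notin> pos_roots" "act w (neg (simple_root j)) \<notin> pos_roots" for \<gamma>
  proof -
    have ne: "\<gamma> \<noteq> simple_root j" using b j by (auto simp: pairing_simple)
    note p' = reflect_pos[OF p j ne]
    have "act w (simple_root j) \<in> pos_roots"
      using n(2) root_dichotomy[OF root_act[OF w(1) simple_root_is_root[OF j]]] by (simp add: w act_neg)
    then have "act w \<gamma> \<notin> pos_roots"
      using n(1) w(1) p p' j b pos_rootD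
      by (intro act_nonpos_not_pos[of w "reflect j \<gamma>" "simple_root j" \<gamma> "2 * pairing \<gamma> j"])
        (auto simp: simple_root_is_root reflect_def mult_le_0_iff)
    moreover have "bilinear_form \<gamma> (reflect j \<gamma>) \<le> -1"
      using bilinear_form_self_reflect[OF pos_rootD(1)[OF p] j] one_minus_two_square_le[of "pairing \<gamma> j"] b by simp
    ultimately show False using snoc.IH[OF xs p p'] n(1) w(2) by simp
  qed
  show ?case
  proof (cases "\<delta> = simple_root j \<or> \<gamma> = simple_root j")
    case True
    then show ?thesis
      using simple[of \<gamma>] simple[of \<delta>] snoc.prems j
      by (auto simp: w bilinear_form_sym[of "simple_root j" \<delta>])
  next
    case False
    then show ?thesis
      using snoc.IH[OF xs reflect_pos[OF snoc.prems(2) j] reflect_pos[OF snoc.prems(3) j]] snoc.prems j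
      by (simp add: bilinear_form_reflect)
  qed
qed simp

lemma no_common_inversion_act:
  assumes "w \<in> carrier W" "\<gamma> \<in> pos_roots" "\<delta> \<in> pos_roots" "bilinear_form \<gamma> \<delta> \<le> -1" "act w \<gamma> \<notin> pos_roots"
  shows "act w \<delta> \<in> pos_roots"
proof (rule ccontr)
  assume n: "act w \<delta> \<notin> pos_roots"
  obtain xs where "set xs \<subseteq> I" "word_val xs = w" using word_val_surj assms(1) .
  then show False using no_common_inversion[OF _ assms(2-4), of xs] n assms(5) act_word_val[of xs] by simp
qed

section \<open>Dominance\<close>

text \<open>The dominance order of Brink and Howlett, phrased so that a separating wall may be
  replaced by any root that it dominates.\<close>

definition dominates :: "('i \<Rightarrow> real) \<Rightarrow> ('i \<Rightarrow> real) \<Rightarrow> bool" where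
  "dominates \<gamma> \<delta> \<longleftrightarrow> (\<forall>w\<in>carrier W. act w \<gamma> \<notin> pos_roots \<longrightarrow> act w \<delta> \<notin> pos_roots)"

text \<open>Otherwise some w would make both \<gamma> and its reflection in i negative; their
  product is 1 - 2 x^2 <= -1 for x = \<open>pairing \<gamma> i\<close>, against
  \<open>no_common_inversion\<close>.\<close>

lemma dominates_simple_root:
  assumes p: "\<gamma> \<in> pos_roots" and i: "i \<in> I" "\<gamma> \<noteq> simple_root i" and b: "1 \<le> pairing \<gamma> i"
  shows "dominates \<gamma> (simple_root i)"
  unfolding dominates_def
proof (intro ballI impI notI)
  fix w assume w: "w \<in> carrier W" "act w \<gamma> \<notin> pos_roots" "act w (simple_root i) \<in> pos_roots"
  note p' = reflect_pos[OF p i]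
  have "act w (reflect i \<gamma>) \<notin> pos_roots"
    by (rule act_nonpos_not_pos[OF w(1) _ _ _ reflect_lin_form w(2)])
      (use p p' i b w(3) pos_rootD in \<open>auto simp: simple_root_is_root mult_le_0_iff\<close>)
  then show False
    using no_common_inversion_act[OF w(1) p p' _ w(2)] bilinear_form_self_reflect[OF pos_rootD(1)[OF p] i(1)]
      one_minus_two_square_le[of "pairing \<gamma> i"] b by simp
qed

text \<open>If \<open>w\<close> is a shortest element making \<open>\<gamma>\<close> negative, its last letter \<open>i\<close> satisfies \<open>B(\<gamma>, \<alpha>\<^sub>i) > 0\<close>, so the
  induction only ever passes from \<open>s\<^sub>i \<gamma>\<close> up to \<open>\<gamma>\<close>.\<close>

lemma dominates_elementary:
  assumes simple: "\<And>i. i \<in> I \<Longrightarrow> simple_root i \<in> E"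
    and closed: "\<And>\<delta> i. \<delta> \<in> E \<Longrightarrow> i \<in> I \<Longrightarrow> \<delta> \<noteq> simple_root i \<Longrightarrow> -1 < pairing \<delta> i \<Longrightarrow> reflect i \<delta> \<in> E"
    and "\<gamma> \<in> pos_roots"
  shows "\<exists>\<delta>\<in>E \<inter> pos_roots. dominates \<gamma> \<delta>"
proof -
  have "\<gamma> \<in> pos_roots \<Longrightarrow> w \<in> carrier W \<Longrightarrow> act w \<gamma> \<notin> pos_roots \<Longrightarrow> ?thesis" for w
  proof (induction "word_length w" arbitrary: \<gamma> w rule: less_induct)
    case less
    note p = less.prems(1) and w = less.prems(2,3)
    show ?case
    proof (cases "\<exists>u\<in>carrier W. word_length u < word_length w \<and> act u \<gamma> \<notin> pos_roots")
      case True
      then show ?thesis using less.hyps p by blast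
    next
      case False
      obtain xs where xs: "set xs \<subseteq> I" "word_val xs = w" "length xs = word_length w" using reduced_word[OF w(1)] .
      have "xs \<noteq> []" using xs w p by auto
      then obtain ys i where ys: "xs = ys @ [i]" by (metis append_butlast_last_id)
      define u where "u = word_val ys"
      have i: "i \<in> I" and u: "u \<in> carrier W" "w = u \<otimes> s i" "word_length u < word_length w"
        using xs ys word_length_le[of ys] by (auto simp: u_def word_val_append)
      show ?thesis
      proof (cases "\<gamma> = simple_root i")
        case True
        then show ?thesis using simple[OF i] p by (auto simp: dominates_def)
      next
        case ne: False
        note p' = reflect_pos[OF p i ne]
        have n: "act u (reflect i \<gamma>) \<notin> pos_roots" using w(2) u i by (simp add: act_mult act_s)
        have up: "act u (simple_root i) \<in> pos_roots"
          using word_length_decreases[OF u(1) i] u by auto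
        have "0 < pairing \<gamma> i"
        proof (rule ccontr)
          assume b: "\<not> 0 < pairing \<gamma> i"
          have "act u \<gamma> \<notin> pos_roots"
            using n u(1) p p' i b pos_rootD up
            by (intro act_nonpos_not_pos[of u "reflect i \<gamma>" "simple_root i" \<gamma> "2 * pairing \<gamma> i"])
              (auto simp: simple_root_is_root reflect_def mult_le_0_iff)
          then show False using False u by blast
        qed
        obtain \<delta> where \<delta>: "\<delta> \<in> E" "\<delta> \<in> pos_roots" "dominates (reflect i \<gamma>) \<delta>"
          using less.hyps[OF u(3) p' u(1) n] by blast
        have ne': "\<delta> \<noteq> simple_root i" using \<delta>(3) n u(1) up unfolding dominates_def by blast
        note q = reflect_pos[OF \<delta>(2) i ne']
        have d: "dominates \<gamma> (reflect i \<delta>)"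
          unfolding dominates_def
        proof (intro ballI impI)
          fix v assume v: "v \<in> carrier W" "act v \<gamma> \<notin> pos_roots"
          then have "act (v \<otimes> s i) (reflect i \<gamma>) \<notin> pos_roots" using i by (simp add: act_mult act_s)
          then have "act (v \<otimes> s i) \<delta> \<notin> pos_roots" using \<delta>(3) v i unfolding dominates_def by simp
          then show "act v (reflect i \<delta>) \<notin> pos_roots" using v i by (simp add: act_mult act_s)
        qed
        show ?thesis
        proof (cases "-1 < pairing \<delta> i")
          case True
          then show ?thesis using closed[OF \<delta>(1) i ne'] q d by blast
        next
          \<comment> \<open>Now the reflection of \<delta> has product at least 1 with the simple
            root of i and dominates it, so that simple root serves instead.\<close>
          case False
          have "reflect i \<delta> \<noteq> simple_root i"
          proof
            assume "reflect i \<delta> = simple_root i"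
            then have "\<delta> = neg (simple_root i)" using i by (metis reflect_reflect reflect_simple_root)
            then show False using \<delta>(2) neg_simple_root_not_pos[OF i] by simp
          qed
          then have "dominates (reflect i \<delta>) (simple_root i)"
            using dominates_simple_root[OF q i] False pairing_reflect[OF i, of \<delta>] by simp
          then show ?thesis using d simple[OF i] simple_root_pos[OF i] unfolding dominates_def by blast
        qed
      qed
    qed
  qed
  moreover obtain v i where v: "v \<in> carrier W" "i \<in> I" "\<gamma> = act v (simple_root i)"
    using rootE[OF pos_rootD(1)[OF assms(3)]] .
  then have "act (s i \<otimes> inv v) \<gamma> = neg (simple_root i)" by (simp add: act_mult act_s)
  then have "act (s i \<otimes> inv v) \<gamma> \<notin> pos_roots" using neg_simple_root_not_pos v by simp
  ultimately show ?thesis using assms(3) v by (metis inv_closed m_closed s_in)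
qed

lemma mem_root_set: "L \<subseteq> carrier W \<Longrightarrow> \<beta> \<in> root_set L \<longleftrightarrow> \<beta> \<in> roots \<and> (\<forall>w\<in>L. act w \<beta> \<in> pos_roots)"
  unfolding root_set_def half_space_def by blast

lemma toggle_in: "u \<in> carrier W \<Longrightarrow> i \<in> I \<Longrightarrow> toggle L i u \<in> carrier W"
  by (simp add: toggle_def)

end

section \<open>Periodic orbits of promotion\<close>

text \<open>\<open>R t\<close> is the set of roots of \<open>L\<close> seen from the point \<open>U t\<close> of a periodic orbit that avoids \<open>L\<close>. The negative
  roots in \<open>R t\<close> are the walls separating \<open>U t\<close> from \<open>L\<close>; toggles never create such walls, so on a periodic
  orbit they can never be crossed.\<close>

locale periodic_orbit = coxeter_system W I s
  for W :: "('w, 'x) monoid_scheme" (structure) and I :: "'i set" and s :: "'i \<Rightarrow> 'w" +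
  fixes L :: "'w set" and idx :: "nat \<Rightarrow> 'i" and U :: "nat \<Rightarrow> 'w" and T :: nat
  assumes L: "L \<subseteq> carrier W" "L \<noteq> {}"
    and idx: "idx t \<in> I"
    and U_0: "U 0 \<in> carrier W" and U_Suc: "U (Suc t) = toggle L (idx t) (U t)"
    and T: "0 < T" and U_period: "U (t + T) = U t"
    and outside: "\<exists>\<beta>\<in>root_set L. act (U 0) \<beta> \<notin> pos_roots"
begin

lemma U_in [simp]: "U t \<in> carrier W"
  by (induction t) (simp_all add: U_0 U_Suc toggle_in idx)

definition R :: "nat \<Rightarrow> ('i \<Rightarrow> real) set" where
  "R t = {\<rho> \<in> roots. act (inv (U t)) \<rho> \<in> root_set L}"

lemma mem_R: "\<rho> \<in> R t \<longleftrightarrow> \<rho> \<in> roots \<and> (\<forall>w\<in>L. act (w \<otimes> inv (U t)) \<rho> \<in> pos_roots)"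
proof -
  have "act (w \<otimes> inv (U t)) \<rho> = act w (act (inv (U t)) \<rho>)" if "w \<in> L" for w
    using that L by (intro act_mult) auto
  then show ?thesis using L unfolding R_def mem_root_set[OF L(1)] by (auto intro: root_act)
qed

lemma U_step: "U (Suc t) = (if simple_root (idx t) \<in> R t then U t else s (idx t) \<otimes> U t)"
  unfolding U_Suc toggle_def R_def by (simp add: simple_root_is_root idx)

lemma R_fail: "simple_root (idx t) \<in> R t \<Longrightarrow> R (Suc t) = R t"
  using U_step[of t] unfolding R_def by simp

lemma R_succ:
  assumes "simple_root (idx t) \<notin> R t" shows "reflect (idx t) \<rho> \<in> R (Suc t) \<longleftrightarrow> \<rho> \<in> R t"
proof -
  have "inv (U (Suc t)) = inv (U t) \<otimes> s (idx t)"
    using U_step[of t] assms idx by (simp add: inv_mult_group)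
  then have "act (inv (U (Suc t))) (reflect (idx t) \<rho>) = act (inv (U t)) \<rho>"
    using idx by (simp add: act_mult act_s)
  moreover have "reflect (idx t) \<rho> \<in> roots \<longleftrightarrow> \<rho> \<in> roots"
    using root_reflect[OF idx] idx by (metis reflect_reflect)
  ultimately show ?thesis unfolding R_def by simp
qed

lemma R_neg: "\<rho> \<in> R t \<Longrightarrow> neg \<rho> \<notin> R t"
proof
  assume r: "\<rho> \<in> R t" "neg \<rho> \<in> R t"
  obtain w where w: "w \<in> L" using L by blast
  then have c: "w \<otimes> inv (U t) \<in> carrier W" using L by auto
  have "act (w \<otimes> inv (U t)) \<rho> \<in> pos_roots" "act (w \<otimes> inv (U t)) (neg \<rho>) \<in> pos_roots" "\<rho> \<in> roots"
    using r w unfolding mem_R by blast+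
  then show False using root_dichotomy[OF root_act[OF c]] unfolding act_neg[OF c] by blast
qed

lemma R_cone:
  assumes "x \<in> R t" "y \<in> R t" "z \<in> R t" "0 \<le> a" "0 \<le> b" "0 \<le> c"
    and r: "\<rho> \<in> roots" "\<rho> = (\<lambda>k. a * x k + b * y k + c * z k)"
  shows "\<rho> \<in> R t"
  unfolding mem_R
proof (intro conjI ballI pos_rootI)
  fix w assume w: "w \<in> L"
  then have v: "w \<otimes> inv (U t) \<in> carrier W" using L by auto
  show "act (w \<otimes> inv (U t)) \<rho> \<in> roots" using v r root_act by blast
  have e: "\<rho> = (\<lambda>k. 1 * (a * x k + b * y k) + c * z k)" using r by simp
  have "0 \<le> act (w \<otimes> inv (U t)) v k" if "v \<in> R t" for v k
    using that w pos_rootD(2) unfolding mem_R by blast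
  then show "0 \<le> act (w \<otimes> inv (U t)) \<rho> k" for k
    unfolding e act_lin[OF v] using assms by simp
qed (rule r(1))

lemma R_dominated: "neg \<gamma> \<in> R t \<Longrightarrow> \<delta> \<in> roots \<Longrightarrow> dominates \<gamma> \<delta> \<Longrightarrow> neg \<delta> \<in> R t"
  unfolding mem_R
proof (intro conjI ballI)
  fix w assume g: "neg \<gamma> \<in> roots \<and> (\<forall>w\<in>L. act (w \<otimes> inv (U t)) (neg \<gamma>) \<in> pos_roots)"
    and d: "\<delta> \<in> roots" "dominates \<gamma> \<delta>" and w: "w \<in> L"
  have v: "w \<otimes> inv (U t) \<in> carrier W" using w L by auto
  have "\<gamma> \<in> roots" using root_neg[of "neg \<gamma>"] g by simp
  moreover have "act (w \<otimes> inv (U t)) (neg \<gamma>) \<in> pos_roots" using g w by blast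
  ultimately have "act (w \<otimes> inv (U t)) \<gamma> \<notin> pos_roots"
    using root_dichotomy[OF root_act[OF v]] unfolding act_neg[OF v] by blast
  then have "act (w \<otimes> inv (U t)) \<delta> \<notin> pos_roots" using d v unfolding dominates_def by blast
  then show "act (w \<otimes> inv (U t)) (neg \<delta>) \<in> pos_roots"
    using root_dichotomy[OF root_act[OF v d(1)]] unfolding act_neg[OF v] by blast
qed (auto intro: root_neg)

lemma R_obtuse:
  assumes "neg \<gamma> \<in> R t" "\<gamma> \<in> pos_roots" "i \<in> I" "pairing \<gamma> i \<le> -1"
  shows "simple_root i \<in> R t"
  unfolding mem_R
proof (intro conjI ballI)
  fix w assume w: "w \<in> L"
  have v: "w \<otimes> inv (U t) \<in> carrier W" using w L by auto
  have "act (w \<otimes> inv (U t)) (neg \<gamma>) \<in> pos_roots" using assms(1) w unfolding mem_R by blast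
  then have "act (w \<otimes> inv (U t)) \<gamma> \<notin> pos_roots"
    using root_dichotomy[OF root_act[OF v pos_rootD(1)[OF assms(2)]]] unfolding act_neg[OF v] by blast
  then show "act (w \<otimes> inv (U t)) (simple_root i) \<in> pos_roots"
    using no_common_inversion_act[OF v assms(2) simple_root_pos[OF assms(3)] assms(4)] by blast
qed (rule simple_root_is_root[OF assms(3)])

definition separating :: "nat \<Rightarrow> ('i \<Rightarrow> real) set" where
  "separating t = {\<beta> \<in> root_set L. act (U t) \<beta> \<notin> pos_roots}"

text \<open>A wall can start to separate only if its root, seen from U t, is the simple root being
  toggled; but a root of L in this position makes the toggle fail.\<close>

lemma separating_Suc: "separating (Suc t) \<subseteq> separating t"
proof
  fix \<beta> assume b: "\<beta> \<in> separating (Suc t)"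
  then have br: "\<beta> \<in> root_set L" "\<beta> \<in> roots" unfolding separating_def by (auto simp: mem_root_set L)
  show "\<beta> \<in> separating t"
  proof (rule ccontr)
    assume n: "\<beta> \<notin> separating t"
    then have p: "act (U t) \<beta> \<in> pos_roots" using br unfolding separating_def by blast
    have f: "simple_root (idx t) \<notin> R t" using b n U_step[of t] unfolding separating_def by auto
    then have "act (U (Suc t)) \<beta> = reflect (idx t) (act (U t) \<beta>)"
      using U_step[of t] idx by (simp add: act_mult act_s)
    then have "act (U t) \<beta> = simple_root (idx t)" using reflect_pos[OF p idx] b unfolding separating_def by auto
    then have "act (inv (U t)) (simple_root (idx t)) = \<beta>" by (metis U_in act_inv(2))
    then show False using f br unfolding R_def by (simp add: simple_root_is_root idx)
  qed
qed

lemma separating_antimono: "t \<le> t' \<Longrightarrow> separating t' \<subseteq> separating t"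
  by (rule lift_Suc_antimono_le[of separating]) (rule separating_Suc)

lemma not_crossed: "neg (simple_root (idx t)) \<notin> R t"
proof
  assume r: "neg (simple_root (idx t)) \<in> R t"
  define \<beta> where "\<beta> = act (inv (U t)) (neg (simple_root (idx t)))"
  have b: "\<beta> \<in> root_set L" using r unfolding R_def \<beta>_def by simp
  have ub: "act (U t) \<beta> = neg (simple_root (idx t))" by (simp add: \<beta>_def)
  then have "\<beta> \<in> separating t" using b neg_simple_root_not_pos[OF idx] unfolding separating_def by simp
  then have "\<beta> \<in> separating (t + T)" unfolding separating_def by (simp add: U_period)
  \<comment> \<open>One period later \<beta> separates again, so by monotonicity it does so right
    after step t, where the successful toggle has just made it positive.\<close>
  then have "\<beta> \<in> separating (Suc t)" using separating_antimono[of "Suc t" "t + T"] T by auto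
  moreover have "simple_root (idx t) \<notin> R t" using R_neg r by blast
  then have "act (U (Suc t)) \<beta> = simple_root (idx t)"
    using U_step[of t] idx ub by (simp add: act_mult act_s reflect_neg)
  ultimately show False using simple_root_pos[OF idx] unfolding separating_def by simp
qed

lemma elementary_wall:
  assumes "\<And>i. i \<in> I \<Longrightarrow> simple_root i \<in> E"
    and "\<And>\<delta> i. \<delta> \<in> E \<Longrightarrow> i \<in> I \<Longrightarrow> \<delta> \<noteq> simple_root i \<Longrightarrow> -1 < pairing \<delta> i \<Longrightarrow> reflect i \<delta> \<in> E"
  shows "\<exists>\<delta>\<in>E \<inter> pos_roots. neg \<delta> \<in> R t"
proof -
  obtain \<beta> where b: "\<beta> \<in> separating 0" using outside unfolding separating_def by blast
  have "U (k * T) = U 0" for k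
  proof (induction k)
    case (Suc k)
    then show ?case using U_period[of "k * T"] by (simp add: add.commute)
  qed simp
  \<comment> \<open>At time t T the orbit is back at its start, and t T >= t, so a wall of time 0
    separates at every time t.\<close>
  then have "\<beta> \<in> separating (t * T)" using b unfolding separating_def by simp
  then have "\<beta> \<in> separating t" using separating_antimono[of t "t * T"] T by auto
  then have b: "\<beta> \<in> root_set L" "\<beta> \<in> roots" "act (U t) \<beta> \<notin> pos_roots" unfolding separating_def by (auto simp: mem_root_set L)
  define \<gamma> where "\<gamma> = neg (act (U t) \<beta>)"
  have g: "\<gamma> \<in> pos_roots" using root_dichotomy[OF root_act[OF U_in b(2)]] b by (simp add: \<gamma>_def)
  have r: "neg \<gamma> \<in> R t" unfolding R_def \<gamma>_def using b root_act by simp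
  obtain \<delta> where d: "\<delta> \<in> E" "\<delta> \<in> pos_roots" "dominates \<gamma> \<delta>"
    using dominates_elementary[OF assms g] by blast
  then show ?thesis using R_dominated[OF r pos_rootD(1)[OF d(2)] d(3)] by blast
qed

lemma functional_evolution:
  "\<exists>F K. (\<forall>i\<in>I. F t0 i = f i) \<and> (\<forall>t. \<forall>i\<in>I. F t i \<le> K) \<and>
    (\<forall>t. \<forall>i\<in>I. F (Suc t) i = (if simple_root (idx t) \<in> R t then F t i else F t i - 2 * gram i (idx t) * F t (idx t)))"
proof -
  \<comment> \<open>The functional with values f at time t0, pulled back along the walk. It depends
    on the time only through U, which takes finitely many values; hence the bound.\<close>
  define G where "G u i = (\<Sum>k\<in>I. f k * act (U t0 \<otimes> inv u) (simple_root i) k)" for u i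
  have "U t \<in> U ` {..<T}" for t
  proof (induction t rule: less_induct)
    case (less t)
    show ?case
    proof (cases "t < T")
      case False
      then show ?thesis using less[of "t - T"] U_period[of "t - T"] T by simp
    qed simp
  qed
  then have bd: "G (U t) i \<le> Max ((\<lambda>(u, i). G u i) ` ((U ` {..<T}) \<times> I))" if "i \<in> I" for t i
    using that finite_index by (intro Max_ge) force+
  have st: "G (U (Suc t)) i = (if simple_root (idx t) \<in> R t then G (U t) i else G (U t) i - 2 * gram i (idx t) * G (U t) (idx t))"
    if i: "i \<in> I" for t i
  proof (cases "simple_root (idx t) \<in> R t")
    case True
    then show ?thesis using U_step[of t] by simp
  next
    case False
    then have e: "U t0 \<otimes> inv (U (Suc t)) = (U t0 \<otimes> inv (U t)) \<otimes> s (idx t)"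
      using U_step[of t] idx by (simp add: inv_mult_group m_assoc)
    have "act (U t0 \<otimes> inv (U (Suc t))) (simple_root i) = act (U t0 \<otimes> inv (U t)) (reflect (idx t) (simple_root i))"
      unfolding e using idx by (simp add: act_mult act_s)
    also have "\<dots> = (\<lambda>k. 1 * act (U t0 \<otimes> inv (U t)) (simple_root i) k +
        (- 2 * gram i (idx t)) * act (U t0 \<otimes> inv (U t)) (simple_root (idx t)) k)"
      unfolding reflect_lin_form pairing_simple[OF i idx] by (intro act_lin) simp
    finally show ?thesis
      using False by (simp add: G_def algebra_simps sum.distrib sum_subtractf sum_distrib_left)
  qed
  have "G (U t0) i = f i" if "i \<in> I" for i
  proof -
    have "G (U t0) i = (\<Sum>k\<in>I. if k = i then f k else 0)"
      unfolding G_def by (intro sum.cong HOL.refl) (simp add: simple_root_def)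
    then show ?thesis using that finite_index by simp
  qed
  then show ?thesis using bd st by (intro exI[of _ "\<lambda>t. G (U t)"]) blast
qed

end


section \<open>Periodic orbits in rank 3 as walks in coordinates\<close>

locale rank3_orbit = periodic_orbit W I s L idx U T
  for W :: "('w, 'x) monoid_scheme" (structure) and I :: "'i set" and s :: "'i \<Rightarrow> 'w"
    and L idx U T +
  assumes idx_period: "idx (Suc (Suc (Suc t))) = idx t"
    and idx_distinct: "idx t \<noteq> idx (Suc t)" "idx t \<noteq> idx (Suc (Suc t))"
    and idx_all: "I = {idx t, idx (Suc t), idx (Suc (Suc t))}"
begin

definition frame :: "nat \<Rightarrow> real \<Rightarrow> real \<Rightarrow> real \<Rightarrow> 'i \<Rightarrow> real" where
  "frame t x y z = (\<lambda>k. x * simple_root (idx t) k + y * simple_root (idx (Suc t)) k + z * simple_root (idx (Suc (Suc t))) k)"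

definition angle :: "nat \<Rightarrow> real" where
  "angle t = - gram (idx t) (idx (Suc t))"

lemma idx_distinct3: "idx (Suc t) \<noteq> idx (Suc (Suc t))"
  using idx_distinct(1)[of "Suc t"] .

lemma frame_rot: "frame (Suc t) y z x = frame t x y z"
  by (simp add: frame_def idx_period algebra_simps)

lemma frame_coords:
  "frame t x y z (idx t) = x" "frame t x y z (idx (Suc t)) = y" "frame t x y z (idx (Suc (Suc t))) = z"
  using idx_distinct[of t] idx_distinct3[of t] by (simp_all add: frame_def simple_root_def)

lemma frame_simple:
  "simple_root (idx t) = frame t 1 0 0" "simple_root (idx (Suc t)) = frame t 0 1 0"
  "simple_root (idx (Suc (Suc t))) = frame t 0 0 1"
  by (simp_all add: frame_def)

lemma frame_neg: "neg (frame t x y z) = frame t (-x) (-y) (-z)"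
  by (auto simp: frame_def)

lemma bilinear_form_frame: "bilinear_form (frame t x y z) v = x * bilinear_form (simple_root (idx t)) v +
   y * bilinear_form (simple_root (idx (Suc t))) v + z * bilinear_form (simple_root (idx (Suc (Suc t)))) v"
proof -
  have e: "frame t x y z = (\<lambda>k. 1 * (x * simple_root (idx t) k + y * simple_root (idx (Suc t)) k) + z * simple_root (idx (Suc (Suc t))) k)"
    by (simp add: frame_def)
  show ?thesis unfolding e bilinear_form_lin by simp
qed

lemma gram_angle: "gram (idx t) (idx (Suc t)) = - angle t" "gram (idx (Suc t)) (idx t) = - angle t"
  "gram (idx (Suc t)) (idx (Suc (Suc t))) = - angle (Suc t)" "gram (idx (Suc (Suc t))) (idx (Suc t)) = - angle (Suc t)"
  "gram (idx t) (idx (Suc (Suc t))) = - angle (Suc (Suc t))" "gram (idx (Suc (Suc t))) (idx t) = - angle (Suc (Suc t))"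
  using gram_sym[OF idx idx] by (simp_all add: angle_def idx_period)

lemma pairing_frame:
  "pairing (frame t x y z) (idx t) = x - angle t * y - angle (Suc (Suc t)) * z"
  by (simp add: bilinear_form_frame pairing_simple idx gram_angle algebra_simps)

lemma reflect_frame:
  "reflect (idx t) (frame t x y z) = frame t (2 * angle t * y + 2 * angle (Suc (Suc t)) * z - x) y z"
  unfolding reflect_def pairing_frame by (auto simp: frame_def algebra_simps)

lemma bilinear_form_frame_self: "bilinear_form (frame t x y z) (frame t x y z) =
  x\<^sup>2 + y\<^sup>2 + z\<^sup>2 - 2 * angle t * x * y - 2 * angle (Suc t) * y * z - 2 * angle (Suc (Suc t)) * x * z"
proof -
  have a: "angle (Suc (Suc (Suc t))) = angle t" "angle (Suc (Suc (Suc (Suc t)))) = angle (Suc t)"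
    by (simp_all add: angle_def idx_period)
  have p1: "pairing (frame t x y z) (idx (Suc t)) = y - angle (Suc t) * z - angle t * x"
    using pairing_frame[of "Suc t" y z x] by (simp add: frame_rot a)
  have p2: "pairing (frame t x y z) (idx (Suc (Suc t))) = z - angle (Suc (Suc t)) * x - angle (Suc t) * y"
    using pairing_frame[of "Suc (Suc t)" z x y] by (simp add: frame_rot a)
  show ?thesis
    unfolding bilinear_form_frame[of t x y z "frame t x y z"] bilinear_form_sym[of "simple_root _" "frame t x y z"]
      p1 p2 pairing_frame
    by (simp add: power2_eq_square algebra_simps)
qed

lemma frame_pos: "frame t x y z \<in> pos_roots \<longleftrightarrow> frame t x y z \<in> roots \<and> 0 \<le> x \<and> 0 \<le> y \<and> 0 \<le> z"
  unfolding pos_roots_def by (subst (2) idx_all[of t]) (auto simp: frame_coords)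

lemma is_cox_game: "cox_game angle (\<lambda>t x y z. frame t x y z \<in> roots) (\<lambda>t x y z. frame t x y z \<in> R t)"
proof (unfold_locales, goal_cases)
  case (1 t)
  then show ?case unfolding angle_def by (rule gram_cos[OF idx idx idx_distinct(1)])
next
  case (2 t)
  then show ?case by (simp add: angle_def idx_period)
next
  case (3 t x y z)
  then show ?case by (simp add: mem_R)
next
  case (4 t y z x)
  then show ?case by (simp add: frame_rot)
next
  case (5 t x y z)
  then show ?case
    using root_dichotomy[of "frame t x y z"] unfolding frame_neg frame_pos by auto
next
  case (6 t x y z)
  then show ?case using root_norm[of "frame t x y z"] by (simp add: bilinear_form_frame_self)
next
  case (7 t)
  then show ?case using root_neg[OF simple_root_is_root[OF idx[of t]]] by (simp add: frame_simple(1) frame_neg)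
next
  case (8 t x y z)
  then show ?case using root_reflect[OF idx[of t]] reflect_frame[of t x y z] by metis
next
  case (9 t y z x)
  show ?case
  proof (cases "frame t 1 0 0 \<in> R t")
    case True
    then show ?thesis using R_fail[of t] by (simp add: frame_rot frame_simple(1))
  next
    case False
    then show ?thesis using R_succ[of t "frame t x y z"] by (simp add: frame_rot frame_simple(1) reflect_frame)
  qed
next
  case (10 t)
  then show ?case using not_crossed[of t] by (simp add: frame_simple(1) frame_neg)
next
  case (11 t x1 y1 z1 x2 y2 z2 x3 y3 z3 k1 k2 k3 x y z)
  show ?case
    by (rule R_cone[OF 11(1-6) 11(10)]) (simp add: 11(7-9) frame_def algebra_simps)
next
  case (12 t x y z)
  have r: "frame t x y z \<in> roots"
    using 12(1) root_neg[of "frame t (-x) (-y) (-z)"] unfolding mem_R frame_neg by simp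
  show ?case
    using R_obtuse[of "frame t x y z" t "idx t"] 12 r idx[of t]
    by (simp add: frame_neg frame_pos frame_simple(1)[symmetric] pairing_frame)
next
  case (13 t0 u v w)
  define f where "f i = (if i = idx t0 then u else if i = idx (Suc t0) then v else w)" for i
  obtain F K where F: "\<forall>i\<in>I. F t0 i = f i" "\<forall>t. \<forall>i\<in>I. F t i \<le> K"
    "\<forall>t. \<forall>i\<in>I. F (Suc t) i = (if simple_root (idx t) \<in> R t then F t i else F t i - 2 * gram i (idx t) * F t (idx t))"
    using functional_evolution[of t0 f] by blast
  have "cox_evolution angle (\<lambda>t x y z. frame t x y z \<in> R t) t0
    (\<lambda>t. F t (idx t)) (\<lambda>t. F t (idx (Suc t))) (\<lambda>t. F t (idx (Suc (Suc t))))"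
    unfolding cox_evolution_def Let_def
    by (auto simp: F(3) idx frame_simple(1) gram_angle idx_period)
  moreover have "F t0 (idx t0) = u" "F t0 (idx (Suc t0)) = v" "F t0 (idx (Suc (Suc t0))) = w"
    using F(1) idx idx_distinct[of t0] idx_distinct3[of t0] by (auto simp: f_def)
  ultimately show ?case using F(2) idx by (intro exI conjI allI impI) auto
next
  case (14 E t)
  have "\<exists>\<delta>\<in>{frame t x y z | x y z. E x y z} \<inter> pos_roots. neg \<delta> \<in> R t"
  proof (rule elementary_wall)
    fix i assume "i \<in> I"
    then consider "i = idx t" | "i = idx (Suc t)" | "i = idx (Suc (Suc t))" using idx_all[of t] by blast
    then show "simple_root i \<in> {frame t x y z | x y z. E x y z}"
      using 14(1-3) frame_simple[of t] by cases force+
  next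
    fix \<delta> i assume d: "\<delta> \<in> {frame t x y z | x y z. E x y z}" "\<delta> \<noteq> simple_root i" "-1 < pairing \<delta> i" and i: "i \<in> I"
    obtain x y z where e: "\<delta> = frame t x y z" "E x y z" using d(1) by blast
    have r: "frame t x y z = frame (Suc t) y z x" "frame t x y z = frame (Suc (Suc t)) z x y"
      by (simp_all add: frame_rot)
    have a: "angle (Suc (Suc (Suc t))) = angle t" "angle (Suc (Suc (Suc (Suc t)))) = angle (Suc t)"
      by (simp_all add: angle_def idx_period)
    consider "i = idx t" | "i = idx (Suc t)" | "i = idx (Suc (Suc t))" using idx_all[of t] i by blast
    then show "reflect i \<delta> \<in> {frame t x y z | x y z. E x y z}"
    proof cases
      case 1
      have "(x, y, z) \<noteq> (1, 0, 0)" using d(2) by (auto simp: e 1 frame_simple(1)[of t])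
      moreover have "-1 < x - angle t * y - angle (Suc (Suc t)) * z"
        using d(3) unfolding e 1 pairing_frame .
      ultimately have "E (2 * angle t * y + 2 * angle (Suc (Suc t)) * z - x) y z" by (rule 14(4)[OF e(2)])
      then show ?thesis unfolding 1 e reflect_frame by blast
    next
      case 2
      have "(x, y, z) \<noteq> (0, 1, 0)" using d(2) by (auto simp: e 2 frame_simple(2)[of t])
      moreover have "-1 < y - angle (Suc t) * z - angle t * x"
        using d(3) unfolding e 2 r(1) pairing_frame a .
      ultimately have "E x (2 * angle (Suc t) * z + 2 * angle t * x - y) z" by (rule 14(5)[OF e(2)])
      moreover have "reflect i \<delta> = frame t x (2 * angle (Suc t) * z + 2 * angle t * x - y) z"
        unfolding 2 e r(1) reflect_frame a by (simp add: frame_rot)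
      ultimately show ?thesis by blast
    next
      case 3
      have "(x, y, z) \<noteq> (0, 0, 1)" using d(2) by (auto simp: e 3 frame_simple(3)[of t])
      moreover have "-1 < z - angle (Suc (Suc t)) * x - angle (Suc t) * y"
        using d(3) unfolding e 3 r(2) pairing_frame a .
      ultimately have "E x y (2 * angle (Suc (Suc t)) * x + 2 * angle (Suc t) * y - z)" by (rule 14(6)[OF e(2)])
      moreover have "reflect i \<delta> = frame t x y (2 * angle (Suc (Suc t)) * x + 2 * angle (Suc t) * y - z)"
        unfolding 3 e r(2) reflect_frame a by (simp add: frame_rot)
      ultimately show ?thesis by blast
    qed
  qed
  then obtain x y z where "E x y z" "frame t x y z \<in> pos_roots" "neg (frame t x y z) \<in> R t" by blast
  then show ?case unfolding frame_neg frame_pos by blast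
qed

lemma rank3_False: False
  by (rule cox_game.cox_game_False[OF is_cox_game])

end

section \<open>Periodic orbits in rank 2\<close>

locale rank2_orbit = periodic_orbit W I s L idx U T
  for W :: "('w, 'x) monoid_scheme" (structure) and I :: "'i set" and s :: "'i \<Rightarrow> 'w"
    and L idx U T +
  assumes idx_period: "idx (Suc (Suc t)) = idx t"
    and idx_distinct: "idx t \<noteq> idx (Suc t)"
    and idx_all: "I = {idx t, idx (Suc t)}"
begin

lemma root_expand: "\<gamma> \<in> roots \<Longrightarrow> \<gamma> = (\<lambda>k. \<gamma> (idx t) * simple_root (idx t) k + \<gamma> (idx (Suc t)) * simple_root (idx (Suc t)) k)"
  using root_outside[of \<gamma>] idx_all[of t] idx_distinct[of t] by (auto simp: simple_root_def)

text \<open>A failure would combine with the wall to the wall of the other letter, which is toggled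
  next. In rank 2 the wall is therefore simply rotated.\<close>

lemma never_fails:
  assumes "neg \<gamma> \<in> R t" "\<gamma> \<in> pos_roots" shows "simple_root (idx t) \<notin> R t" "0 < \<gamma> (idx (Suc t))"
proof -
  note nn = pos_rootD(2)[OF assms(2)] and r = pos_rootD(1)[OF assms(2)]
  let ?x = "\<gamma> (idx t)" and ?y = "\<gamma> (idx (Suc t))"
  show y: "0 < ?y"
  proof (rule ccontr)
    assume "\<not> 0 < ?y"
    then have "?y = 0" using nn[of "idx (Suc t)"] by simp
    then have "\<gamma> k = 0" if "k \<noteq> idx t" for k
      using root_outside[OF r, of k] idx_all[of t] that by (cases "k = idx (Suc t)") auto
    then have "\<gamma> = simple_root (idx t)" by (rule pos_root_eq_simple_root[OF assms(2) idx])
    then show False using assms(1) not_crossed[of t] by simp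
  qed
  show "simple_root (idx t) \<notin> R t"
  proof
    assume f: "simple_root (idx t) \<in> R t"
    have "neg (simple_root (idx (Suc t))) \<in> R t"
    proof (rule R_cone[OF assms(1) f f, of "1 / ?y" "?x / ?y" 0])
      show "neg (simple_root (idx (Suc t))) = (\<lambda>k. 1 / ?y * - \<gamma> k + ?x / ?y * simple_root (idx t) k + 0 * simple_root (idx t) k)"
      proof
        fix k
        have k: "\<gamma> k = ?x * simple_root (idx t) k + ?y * simple_root (idx (Suc t)) k"
          by (rule fun_cong[OF root_expand[OF r]])
        show "- simple_root (idx (Suc t)) k = 1 / ?y * - \<gamma> k + ?x / ?y * simple_root (idx t) k + 0 * simple_root (idx t) k"
          unfolding k using y by (simp add: field_simps)
      qed
    qed (use y nn root_neg simple_root_is_root idx in auto)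
    then show False using R_fail[OF f] not_crossed[of "Suc t"] by simp
  qed
qed

lemma rank2_False: False
proof -
  define P where "P = - gram (idx 0) (idx 1)"
  have g: "gram (idx t) (idx (Suc t)) = - P" for t
  proof (induction t)
    case (Suc t)
    then show ?case using gram_sym[OF idx idx, of "Suc t" t] by (simp add: idx_period)
  qed (simp add: P_def)
  have P: "0 \<le> P" "P \<le> 1"
    using coxeter_cos_bounds[OF gram_cos[OF idx idx idx_distinct[of 0]]] by (simp_all add: P_def)
  show False
  proof (cases "P = 1")
    case True
    have "\<exists>\<delta>\<in>simple_root ` I \<inter> pos_roots. neg \<delta> \<in> R 0"
    proof (rule elementary_wall)
      fix \<delta> i assume d: "\<delta> \<in> simple_root ` I" "i \<in> I" "\<delta> \<noteq> simple_root i" "-1 < pairing \<delta> i"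
      then obtain j where j: "j \<in> I" "\<delta> = simple_root j" by blast
      have "i = idx 0 \<or> i = idx (Suc 0)" "j = idx 0 \<or> j = idx (Suc 0)" using idx_all[of 0] d(2) j(1) by blast+
      moreover have "i \<noteq> j" using d(3) j by blast
      ultimately have "gram j i = -1" using g[of 0] gram_sym[OF idx idx, of 0 "Suc 0"] True by auto
      then show "reflect i \<delta> \<in> simple_root ` I" using d(2,4) j by (simp add: pairing_simple)
    qed auto
    then have "neg (simple_root (idx (Suc 0))) \<in> R 0" using idx_all[of 0] not_crossed[of 0] by auto
    moreover from this have "simple_root (idx 0) \<in> R 0"
      using R_obtuse[OF _ simple_root_pos[OF idx] idx, of "Suc 0" 0 0] g[of 0] gram_sym[OF idx idx, of 0 "Suc 0"] True
      by (simp add: pairing_simple idx)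
    ultimately show False using never_fails(1) simple_root_pos[OF idx] by blast
  next
    case False
    obtain \<gamma>0 where g0: "\<gamma>0 \<in> pos_roots" "neg \<gamma>0 \<in> R 0"
      using elementary_wall[of UNIV 0] by blast
    define \<gamma> where "\<gamma> = rec_nat \<gamma>0 (\<lambda>t. reflect (idx t))"
    have \<gamma>: "\<gamma> 0 = \<gamma>0" "\<gamma> (Suc t) = reflect (idx t) (\<gamma> t)" for t by (simp_all add: \<gamma>_def)
    have inv: "\<gamma> t \<in> pos_roots \<and> neg (\<gamma> t) \<in> R t" for t
    proof (induction t)
      case (Suc t)
      have "\<gamma> t \<noteq> simple_root (idx t)" using Suc not_crossed[of t] by auto
      then show ?case using Suc reflect_pos[OF _ idx] never_fails(1)[of "\<gamma> t" t] R_succ[of t "neg (\<gamma> t)"]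
        by (simp add: \<gamma> reflect_neg)
    qed (use g0 \<gamma> in auto)
    define q where "q t = \<gamma> t (idx (Suc t))" for t
    have q: "q (Suc (Suc t)) = 2 * P * q (Suc t) - q t" for t
    proof -
      have r: "\<gamma> (Suc t) \<in> roots" using inv[of "Suc t"] pos_rootD by blast
      have "pairing (\<gamma> (Suc t)) (idx (Suc t)) = \<gamma> (Suc t) (idx (Suc t)) - P * \<gamma> (Suc t) (idx (Suc (Suc t)))"
        by (subst root_expand[OF r, of "Suc t"], subst bilinear_form_lin)
          (simp add: pairing_simple idx gram_sym[OF idx idx, of "Suc (Suc t)" "Suc t"] g)
      then have "\<gamma> (Suc (Suc t)) (idx (Suc t)) = 2 * P * \<gamma> (Suc t) (idx (Suc (Suc t))) - \<gamma> (Suc t) (idx (Suc t))"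
        unfolding \<gamma>(2)[of "Suc t"] reflect_def by (simp add: simple_root_def)
      moreover have "\<gamma> (Suc t) (idx (Suc t)) = \<gamma> t (idx (Suc t))"
        using reflect_other[of "idx (Suc t)" "idx t" "\<gamma> t"] idx_distinct[of t] \<gamma>(2)[of t] by metis
      ultimately show ?thesis by (simp add: q_def idx_period)
    qed
    have pos: "0 < q t" for t using never_fails(2) inv unfolding q_def by blast
    \<comment> \<open>The values at even times play the role of Y and P times those at odd times
      that of W, with C = P^2 < 1.\<close>
    show False
    proof (rule concave_sequence_not_positive[of "\<lambda>n. q (2 * n)" "\<lambda>n. P * q (Suc (2 * n))" "P\<^sup>2"])
      fix n
      show "P\<^sup>2 < 1" using P False by (simp add: power_less_one_iff abs_square_less_1)
      show "q (2 * Suc n) \<le> 2 * (P * q (Suc (2 * n))) - q (2 * n)" using q[of "2 * n"] by simp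
      show "P * q (Suc (2 * Suc n)) \<le> 2 * P\<^sup>2 * q (2 * Suc n) - P * q (Suc (2 * n))"
      proof -
        have "q (Suc (2 * Suc n)) = 2 * P * q (2 * Suc n) - q (Suc (2 * n))" using q[of "Suc (2 * n)"] by simp
        then have "P * q (Suc (2 * Suc n)) = P * (2 * P * q (2 * Suc n) - q (Suc (2 * n)))" by simp
        then show ?thesis by (simp only: power2_eq_square algebra_simps)
      qed
      show "0 < q (2 * n)" "0 \<le> P * q (Suc (2 * n))" using pos P by (simp_all add: less_imp_le)
    qed
  qed
qed

end

lemma (in periodic_orbit) rank1_False:
  assumes "card I \<le> 1" shows False
proof -
  obtain \<gamma> where g: "\<gamma> \<in> pos_roots" "neg \<gamma> \<in> R 0"
    using elementary_wall[of UNIV 0] by blast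
  have "I = {idx 0}" using assms idx[of 0] finite_index by (metis card_le_Suc0_iff_eq One_nat_def singletonD subsetI subset_antisym empty_subsetI insert_subset)
  then have "\<gamma> k = 0" if "k \<noteq> idx 0" for k using root_outside[OF pos_rootD(1)[OF g(1)]] that by blast
  then have "\<gamma> = simple_root (idx 0)" by (rule pos_root_eq_simple_root[OF g(1) idx])
  then show False using g not_crossed[of 0] by simp
qed

section \<open>From periodic points of promotion to orbits of single toggles\<close>

context coxeter_system
begin

primrec orbit :: "'w set \<Rightarrow> 'i list \<Rightarrow> 'w \<Rightarrow> nat \<Rightarrow> 'w" where
  "orbit L xs u 0 = u"
| "orbit L xs u (Suc t) = toggle L (xs ! (t mod length xs)) (orbit L xs u t)"

lemma orbit_add: "orbit L xs u (a * length xs + t) = orbit L xs (orbit L xs u (a * length xs)) t"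
  by (induction t) simp_all

lemma orbit_take: "t \<le> length xs \<Longrightarrow> orbit L xs u t = fold (toggle L) (take t xs) u"
  by (induction t) (simp_all add: take_Suc_conv_app_nth)

lemma orbit_promotion: "(promotion L xs ^^ k) u = orbit L xs u (k * length xs)"
proof (induction k)
  case (Suc k)
  have "orbit L xs u (Suc k * length xs) = orbit L xs (orbit L xs u (k * length xs)) (length xs)"
    using orbit_add[of L xs u k "length xs"] by (simp add: add.commute)
  then show ?case using Suc orbit_take[of "length xs" xs] by (simp add: promotion_def)
qed simp

theorem futuristic_of_rank_le_3:
  assumes "card I \<le> 3"
  shows futuristic
  unfolding futuristic_def heavy_def
proof (intro allI impI)
  fix L c xs u
  assume H: "L \<noteq> {} \<and> convex_subset L \<and> coxeter_element c" and xs: "index_ordering xs \<and> coxeter_element_of xs = c"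
    and per: "periodic_point (promotion L xs) u"
  show "u \<in> L"
  proof (rule ccontr)
    assume u: "u \<notin> L"
    obtain A where A: "A \<subseteq> roots" "L = carrier W \<inter> (\<Inter>\<beta>\<in>A. half_space \<beta>)"
      using H unfolding convex_subset_def by blast
    obtain K where uc: "u \<in> carrier W" and K: "1 \<le> K" "(promotion L xs ^^ K) u = u"
      using per unfolding periodic_point_def by blast
    obtain \<beta> where \<beta>: "\<beta> \<in> A" "u \<notin> half_space \<beta>" using u uc A(2) by blast
    have bR: "\<beta> \<in> root_set L" using A \<beta>(1) unfolding root_set_def by blast
    have bu: "act u \<beta> \<notin> pos_roots" using \<beta>(2) uc unfolding half_space_def by blast
    have xsI: "set xs = I" "distinct xs" using xs unfolding index_ordering_def by auto
    have "I \<noteq> {}" using A(1) \<beta>(1) unfolding roots_def by blast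
    then have n: "0 < length xs" using xsI by auto
    define idx where "idx t = xs ! (t mod length xs)" for t
    have idx: "idx t \<in> I" for t using xsI n nth_mem[of "t mod length xs" xs] by (simp add: idx_def)
    \<comment> \<open>A period of the refined orbit: one promotion consists of
      \<open>length xs\<close> toggles.\<close>
    define T where "T = K * length xs"
    have T: "orbit L xs u T = u" using K orbit_promotion[where L = L and xs = xs and u = u and k = K] by (simp add: T_def)
    have "orbit L xs u (t + T) = orbit L xs u t" for t
      using orbit_add[of L xs u K t] T by (simp add: T_def add.commute)
    then interpret o: periodic_orbit W I s L idx "orbit L xs u" T
      by unfold_locales (use A H n K idx uc bR bu in \<open>auto simp: T_def idx_def\<close>)
    have "length xs \<le> 3" using assms distinct_card[OF xsI(2)] xsI(1) by simp
    then consider "length xs \<le> 1" | "length xs = 2" | "length xs = 3" by linarith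
    then show False
    proof cases
      case 1
      then show ?thesis using o.rank1_False distinct_card[OF xsI(2)] xsI(1) by simp
    next
      case 2
      then obtain a b where ab: "xs = [a, b]" by (auto simp: numeral_2_eq_2 length_Suc_conv)
      have m: "t mod 2 = 0 \<and> Suc t mod 2 = 1 \<and> Suc (Suc t) mod 2 = 0 \<or> t mod 2 = 1 \<and> Suc t mod 2 = 0 \<and> Suc (Suc t) mod 2 = 1"
        for t by presburger
      have i: "idx t = (if t mod 2 = 0 then a else b)" for t
      proof -
        have "t mod 2 = 0 \<or> t mod 2 = 1" by presburger
        then show ?thesis unfolding idx_def 2 by (elim disjE) (simp_all only: ab if_True if_False, simp_all)
      qed
      interpret r: rank2_orbit W I s L idx "orbit L xs u" T
      proof unfold_locales
        fix t
        show "idx (Suc (Suc t)) = idx t" using m[of t] unfolding i by auto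
        show "idx t \<noteq> idx (Suc t)" using m[of t] ab xsI(2) unfolding i by auto
        show "I = {idx t, idx (Suc t)}" using m[of t] ab xsI(1) unfolding i by auto
      qed
      show ?thesis by (rule r.rank2_False)
    next
      case 3
      then obtain a b c where abc: "xs = [a, b, c]" by (auto simp: numeral_3_eq_3 length_Suc_conv)
      have i: "idx t = (if t mod 3 = 0 then a else if t mod 3 = 1 then b else c)" for t
      proof -
        have "t mod 3 = 0 \<or> t mod 3 = 1 \<or> t mod 3 = 2" by linarith
        then show ?thesis unfolding idx_def 3 by (elim disjE) (simp_all only: abc if_True if_False, simp_all)
      qed
      have m: "t mod 3 = 0 \<and> Suc t mod 3 = 1 \<and> Suc (Suc t) mod 3 = 2 \<and> Suc (Suc (Suc t)) mod 3 = 0 \<or>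
        t mod 3 = 1 \<and> Suc t mod 3 = 2 \<and> Suc (Suc t) mod 3 = 0 \<and> Suc (Suc (Suc t)) mod 3 = 1 \<or>
        t mod 3 = 2 \<and> Suc t mod 3 = 0 \<and> Suc (Suc t) mod 3 = 1 \<and> Suc (Suc (Suc t)) mod 3 = 2" for t
        by presburger
      interpret r: rank3_orbit W I s L idx "orbit L xs u" T
      proof unfold_locales
        fix t
        show "idx (Suc (Suc (Suc t))) = idx t" using m[of t] unfolding i by auto
        show "idx t \<noteq> idx (Suc t)" "idx t \<noteq> idx (Suc (Suc t))"
          using m[of t] abc xsI(2) unfolding i by auto
        show "I = {idx t, idx (Suc t), idx (Suc (Suc t))}" using m[of t] abc xsI(1) unfolding i by auto
      qed
      show ?thesis by (rule r.rank3_False)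
    qed
  qed
qed

end

theorem theorem1p18:
  fixes W :: "('w, 'x) monoid_scheme" and I :: "'i set" and s :: "'i \<Rightarrow> 'w"
  assumes "coxeter_system W I s"
    and "card I \<le> 3"
  shows "coxeter_system.futuristic W I s"
  using coxeter_system.futuristic_of_rank_le_3[OF assms] .

end
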